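(* Let $(X_t,P^x)$, $x\in\mathcal X$, be $\mathcal X$-valued càdlàg Markov processes with invariant ergodic probability measure $\mu_*$ and $L^2(\mu_* )$-generator $(A,D(A))$ (as in the context), and let $\mu$ be an initial distribution. Let $\langle\cdot,\cdot\rangle_\#$ be an inner product on $L^2(\mu_* )$, with induced norm $\|\cdot\|_\#$, such that: 1. there exist $0<c\le C<\infty$ such that $c\|g\|\le\|g\|_\#\le C\|g\|$ for all $g\in L^2(\mu_* )$; 2. $\langle g,1\rangle_\#=\langle g,1\rangle$ for all $g\in L^2(\mu_* )$; 3. there is $\alpha>0$ such that $\|g\|_\#^2\le\alpha\langle -Ag,g\rangle_\#$ for all $g\in D(A)$ with $\mu_*[g]=0$. Let $(\widetilde X_t,\widetilde P^{\widetilde\mu})$ be an alternative (not necessarily Markov) $\mathcal X$-valued process with initial distribution $\widetilde\mu$. For bounded measurable $f:\mathcal X\to\mathbb R$ let $\widehat f=f-\mu_*[f]$, let $M_{\pm\widehat f}$ denote the operator of multiplication by $\pm\widehat f$ on $L^2(\mu_* )$, let $M_{\pm\widehat f}^\dagger$ be its adjoint with respect to $\langle\cdot,\cdot\rangle_\#$, and set $$v_\pm=2\alpha\left\|\tfrac12\left(M_{\pm\widehat f}+M_{\pm\widehat f}^\dagger\right)1\right\|_\#^2,\qquad b_\pm=\alpha\max\left\{0,\ \sup_{\|g\|_\#=1}\langle M_{\pm\widehat f}\,g,g\rangle_\#\right\},$$ $$F_T=\frac1T\int_0^T f(X_t)\,dt,\qquad \widetilde F_T=\frac1T\int_0^T f(\widetilde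 X_t)\,dt .$$ (i) For every $T>0$ with $R\big(\widetilde P^{\widetilde\mu}_T\|P^\mu_T\big)<\infty$, and for each choice of sign, $$\pm\left(\widetilde E^{\widetilde\mu}[\widetilde F_T]-E^\mu[F_T]\right)\ \le\ \sqrt{2v_\pm\,\eta_T}+b_\pm\,\eta_T+\frac{C}{c}\,\frac{1-e^{-T/\alpha}}{T/\alpha}\left\|\frac{d\mu}{d\mu_*}\right\|\sqrt{\mathrm{Var}_{\mu_*}[f]},$$ where $$\eta_T=\frac1T\left(\log(c^{-1})+\log\left\|\frac{d\mu}{d\mu_*}\right\|+R\big(\widetilde P^{\widetilde\mu}_T\|P^\mu_T\big)\right).$$ (ii) If, in addition, $R\big(\widetilde P^{\widetilde\mu}_T\|P^\mu_T\big)<\infty$ for all $T>0$, the process $(\widetilde X_t,\widetilde P^{\widetilde\mu})$ is ergodic with invariant measure $\widetilde\mu_*$, the limit $$\eta_\infty=\lim_{T\to\infty}\frac1T R\big(\widetilde P^{\widetilde\mu}_T\|P^{\mu_*}_T\big)$$ exists, and $\left\|\frac{d\mu}{d\mu_*}\right\|<\infty$, then for each choice of sign $$\pm\left(\widetilde\mu_*[f]-\mu_*[f]\right)\ \le\ \sqrt{2v_\pm\,\eta_\infty}+b_\pm\,\eta_\infty .$$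
   Context: $\mathcal X$ is a Polish space; the Markov processes are time-homogeneous, with $X_0=x$ $P^x$-a.s.; $P^\mu=\int P^x\,d\mu(x)$ with expectation $E^\mu$. $\mu_*$ is an invariant ergodic probability measure on $\mathcal X$, $\langle\cdot,\cdot\rangle$ and $\|\cdot\|$ are the scalar product and norm of the real Hilbert space $L^2(\mu_* )$, $\mu_*[f]=\int f\,d\mu_*$, $\mathrm{Var}_{\mu_*}$ is the variance under $\mu_*$, and $(A,D(A))$ is the generator of the strongly continuous semigroup $T_t[g](x)=E^x[g(X_t)]$ on $L^2(\mu_* )$. The initial distribution $\mu$ is absolutely continuous with respect to $\mu_*$ with $\left\|\frac{d\mu}{d\mu_*}\right\|<\infty$. $P^\mu_T$ and $\widetilde P^{\widetilde\mu}_T$ are the distributions on path space over the time window $[0,T]$ of the baseline process started from $\mu$ and of the alternative process $\widetilde X$ (with càdlàg paths), respectively; $\widetilde E^{\widetilde\mu}$ is expectation under $\widetilde P^{\widetilde\mu}$. $R(Q_1\|Q_2)$ is relative entropy (Kullback–Leibler divergence): $\int\log(dQ_1/dQ_2)\,dQ_1$ if $Q_1\ll Q_2$, and $+\infty$ otherwise. That the alternative process is ergodic with invariant measure $\widetilde\mu_*$ means that for every bounded measurable $f$, $\frac1T\int_0^T f(\widetilde X_t)\,dt\to\widetilde\mu_*[f]=\int f\,d\widetilde\mu_*$ as $T\to\infty$, $\widetilde P^{\widetilde\mu}$-almost surely. *)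

theory Defs
  imports "HOL-Probability.Probability"
begin

section \<open>Cadlag Markov families\<close>

text \<open>Where a one-sided filter is trivial (right limits at a right end point of \<open>I\<close>, left limits
  at a left end point) the conditions below hold vacuously, so the definition covers both
  \<open>I = {0..}\<close> and \<open>I = {0..T}\<close>.\<close>

definition cadlag_on :: "real set \<Rightarrow> (real \<Rightarrow> 'a::topological_space) \<Rightarrow> bool" where
  "cadlag_on I w \<longleftrightarrow> (\<forall>t\<in>I. continuous (at t within (I \<inter> {t..})) w \<and>
     (\<exists>l. (w \<longlongrightarrow> l) (at t within (I \<inter> {..<t}))))"

definition natural_filtration ::
  "'w measure \<Rightarrow> (real \<Rightarrow> 'w \<Rightarrow> 'a::topological_space) \<Rightarrow> real \<Rightarrow> 'w measure" where
  "natural_filtration M X s =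
     sigma (space M) (\<Union>u\<in>{0..s}. {X u -` B \<inter> space M | B. B \<in> sets borel})"

text \<open>Only the sets of \<open>M\<close> matter; it carries the measurable structure shared by all the \<open>P x\<close>.
  The Markov property is required with respect to the natural filtration only, which is implied by
  the Markov property for any larger filtration.\<close>

locale cadlag_markov_family =
  fixes M :: "'w measure" and X :: "real \<Rightarrow> 'w \<Rightarrow> 'a::polish_space" and P :: "'a \<Rightarrow> 'w measure"
  assumes kernel: "P \<in> borel \<rightarrow>\<^sub>M prob_algebra M"
    and measurable_X: "\<And>t. 0 \<le> t \<Longrightarrow> X t \<in> M \<rightarrow>\<^sub>M borel"
    and cadlag_X: "\<And>\<omega>. \<omega> \<in> space M \<Longrightarrow> cadlag_on {0..} (\<lambda>t. X t \<omega>)"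
    and start: "\<And>x. AE \<omega> in P x. X 0 \<omega> = x"
    and markov: "\<And>x s t B. \<lbrakk>0 \<le> s; 0 \<le> t; B \<in> sets borel\<rbrakk> \<Longrightarrow>
      AE \<omega> in P x. real_cond_exp (P x) (natural_filtration M X s)
          (indicator {\<omega> \<in> space M. X (s + t) \<omega> \<in> B}) \<omega>
        = measure (P (X s \<omega>)) {\<omega>' \<in> space M. X t \<omega>' \<in> B}"

definition initial_law :: "('a \<Rightarrow> 'w measure) \<Rightarrow> 'a measure \<Rightarrow> 'w measure" where
  "initial_law P \<mu> = bind \<mu> P"

definition transition_semigroup ::
  "(real \<Rightarrow> 'w \<Rightarrow> 'a) \<Rightarrow> ('a \<Rightarrow> 'w measure) \<Rightarrow> real \<Rightarrow> ('a \<Rightarrow> real) \<Rightarrow> 'a \<Rightarrow> real" where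
  "transition_semigroup X P t g x = (\<integral>\<omega>. g (X t \<omega>) \<partial>P x)"

definition invariant_measure ::
  "(real \<Rightarrow> 'w \<Rightarrow> 'a::topological_space) \<Rightarrow> ('a \<Rightarrow> 'w measure) \<Rightarrow> 'a measure \<Rightarrow> bool" where
  "invariant_measure X P \<mu> \<longleftrightarrow> (\<forall>t\<ge>0. distr (initial_law P \<mu>) borel (X t) = \<mu>)"

definition ergodic_measure ::
  "(real \<Rightarrow> 'w \<Rightarrow> 'a::topological_space) \<Rightarrow> ('a \<Rightarrow> 'w measure) \<Rightarrow> 'a measure \<Rightarrow> bool" where
  "ergodic_measure X P \<mu> \<longleftrightarrow> (\<forall>B\<in>sets borel.
     (\<forall>t\<ge>0. AE x in \<mu>. transition_semigroup X P t (indicator B) x = indicator B x) \<longrightarrow>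
     measure \<mu> B = 0 \<or> measure \<mu> B = 1)"


section \<open>The real Hilbert space \<open>L\<^sup>2\<close>\<close>

text \<open>Elements of \<open>L\<^sup>2\<close> are represented by square integrable functions; operators and inner
  products act on representatives, and equality in \<open>L\<^sup>2\<close> is equality almost everywhere.\<close>

definition L2_fun :: "'a measure \<Rightarrow> ('a \<Rightarrow> real) set" where
  "L2_fun M = {g \<in> borel_measurable M. integrable M (\<lambda>x. (g x)\<^sup>2)}"

definition L2_inner :: "'a measure \<Rightarrow> ('a \<Rightarrow> real) \<Rightarrow> ('a \<Rightarrow> real) \<Rightarrow> real" where
  "L2_inner M g h = (\<integral>x. g x * h x \<partial>M)"

definition inner_norm :: "(('a \<Rightarrow> real) \<Rightarrow> ('a \<Rightarrow> real) \<Rightarrow> real) \<Rightarrow> ('a \<Rightarrow> real) \<Rightarrow> real" where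
  "inner_norm ip g = sqrt (ip g g)"

abbreviation L2_norm :: "'a measure \<Rightarrow> ('a \<Rightarrow> real) \<Rightarrow> real" where
  "L2_norm M \<equiv> inner_norm (L2_inner M)"

locale inner_product_on_L2 =
  fixes M :: "'a measure" and ip :: "('a \<Rightarrow> real) \<Rightarrow> ('a \<Rightarrow> real) \<Rightarrow> real"
  assumes ip_cong: "\<And>g g' h. \<lbrakk>g \<in> L2_fun M; g' \<in> L2_fun M; h \<in> L2_fun M; AE x in M. g x = g' x\<rbrakk>
      \<Longrightarrow> ip g h = ip g' h"
    and ip_commute: "\<And>g h. \<lbrakk>g \<in> L2_fun M; h \<in> L2_fun M\<rbrakk> \<Longrightarrow> ip g h = ip h g"
    and ip_add: "\<And>g g' h. \<lbrakk>g \<in> L2_fun M; g' \<in> L2_fun M; h \<in> L2_fun M\<rbrakk>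
      \<Longrightarrow> ip (\<lambda>x. g x + g' x) h = ip g h + ip g' h"
    and ip_scale: "\<And>r g h. \<lbrakk>g \<in> L2_fun M; h \<in> L2_fun M\<rbrakk> \<Longrightarrow> ip (\<lambda>x. r * g x) h = r * ip g h"
    and ip_nonneg: "\<And>g. g \<in> L2_fun M \<Longrightarrow> 0 \<le> ip g g"
    and ip_definite: "\<And>g. \<lbrakk>g \<in> L2_fun M; ip g g = 0\<rbrakk> \<Longrightarrow> AE x in M. g x = 0"

text \<open>As for the constant \<open>adjoint\<close> of the library, the adjoint is picked by its defining property.
  It exists for bounded operators when the norm of \<open>ip\<close> is equivalent to the \<open>L\<^sup>2\<close> norm, and it is
  then unique up to null sets.\<close>

definition adjoint_on_L2 :: "'a measure \<Rightarrow> (('a \<Rightarrow> real) \<Rightarrow> ('a \<Rightarrow> real) \<Rightarrow> real) \<Rightarrow>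
    (('a \<Rightarrow> real) \<Rightarrow> ('a \<Rightarrow> real)) \<Rightarrow> ('a \<Rightarrow> real) \<Rightarrow> ('a \<Rightarrow> real)" where
  "adjoint_on_L2 M ip S = (SOME S'. (\<forall>h\<in>L2_fun M. S' h \<in> L2_fun M) \<and>
     (\<forall>g\<in>L2_fun M. \<forall>h\<in>L2_fun M. ip (S g) h = ip g (S' h)))"

definition mult_op :: "('a \<Rightarrow> real) \<Rightarrow> ('a \<Rightarrow> real) \<Rightarrow> ('a \<Rightarrow> real)" where
  "mult_op h g = (\<lambda>x. h x * g x)"

definition has_L2_generator :: "'a measure \<Rightarrow> (real \<Rightarrow> ('a \<Rightarrow> real) \<Rightarrow> ('a \<Rightarrow> real)) \<Rightarrow>
    ('a \<Rightarrow> real) \<Rightarrow> ('a \<Rightarrow> real) \<Rightarrow> bool" where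
  "has_L2_generator M S g h \<longleftrightarrow> g \<in> L2_fun M \<and> h \<in> L2_fun M \<and>
     ((\<lambda>t. L2_norm M (\<lambda>x. (S t g x - g x) / t - h x)) \<longlongrightarrow> 0) (at_right 0)"

definition generator_domain :: "'a measure \<Rightarrow> (real \<Rightarrow> ('a \<Rightarrow> real) \<Rightarrow> ('a \<Rightarrow> real)) \<Rightarrow>
    ('a \<Rightarrow> real) set" where
  "generator_domain M S = {g. \<exists>h. has_L2_generator M S g h}"

text \<open>The value is determined up to null sets only.\<close>

definition generator :: "'a measure \<Rightarrow> (real \<Rightarrow> ('a \<Rightarrow> real) \<Rightarrow> ('a \<Rightarrow> real)) \<Rightarrow>
    ('a \<Rightarrow> real) \<Rightarrow> ('a \<Rightarrow> real)" where
  "generator M S g = (SOME h. has_L2_generator M S g h)"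


section \<open>Path laws, relative entropy, time averages\<close>

text \<open>The Borel sigma-algebra of the Skorokhod topology on the cadlag paths is the one generated by
  the coordinate maps.\<close>

definition cadlag_paths :: "real \<Rightarrow> (real \<Rightarrow> 'a::topological_space) measure" where
  "cadlag_paths T = restrict_space (PiM {0..T} (\<lambda>_. borel)) {w. cadlag_on {0..T} w}"

definition path_law :: "real \<Rightarrow> 'w measure \<Rightarrow> (real \<Rightarrow> 'w \<Rightarrow> 'a::topological_space) \<Rightarrow>
    (real \<Rightarrow> 'a) measure" where
  "path_law T N Y = distr N (cadlag_paths T) (\<lambda>\<omega>. restrict (\<lambda>t. Y t \<omega>) {0..T})"

text \<open>Note the argument order: \<^const>\<open>absolutely_continuous\<close> and \<^const>\<open>KL_divergence\<close> take the reference
  measure first. \<^const>\<open>KL_divergence\<close> is a Bochner integral and hence \<open>0\<close> for non-integrable log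
  densities; as the negative part of the log density is always integrable, non-integrability means
  that the relative entropy is infinite.\<close>

definition relative_entropy :: "'b measure \<Rightarrow> 'b measure \<Rightarrow> ereal" where
  "relative_entropy Q1 Q2 =
     (if absolutely_continuous Q2 Q1 \<and> integrable Q1 (entropy_density (exp 1) Q2 Q1)
      then ereal (KL_divergence (exp 1) Q2 Q1) else \<infinity>)"

definition time_average :: "(real \<Rightarrow> 'w \<Rightarrow> 'a) \<Rightarrow> ('a \<Rightarrow> real) \<Rightarrow> real \<Rightarrow> 'w \<Rightarrow> real" where
  "time_average Y f T \<omega> = (1 / T) * (LINT t:{0..T}|lborel. f (Y t \<omega>))"

locale cadlag_process = prob_space N
  for N :: "'v measure" and Y :: "real \<Rightarrow> 'v \<Rightarrow> 'a::polish_space" +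
  assumes measurable_Y: "\<And>t. 0 \<le> t \<Longrightarrow> Y t \<in> N \<rightarrow>\<^sub>M borel"
    and cadlag_Y: "\<And>\<omega>. \<omega> \<in> space N \<Longrightarrow> cadlag_on {0..} (\<lambda>t. Y t \<omega>)"

definition ergodic_process ::
  "'v measure \<Rightarrow> (real \<Rightarrow> 'v \<Rightarrow> 'a::topological_space) \<Rightarrow> 'a measure \<Rightarrow> bool" where
  "ergodic_process N Y \<nu> \<longleftrightarrow> (\<forall>f\<in>borel_measurable borel. bounded (range f) \<longrightarrow>
     (AE \<omega> in N. ((\<lambda>T. time_average Y f T \<omega>) \<longlongrightarrow> (\<integral>x. f x \<partial>\<nu>)) at_top))"


section \<open>Constants of the bound\<close>

definition centered :: "'a measure \<Rightarrow> ('a \<Rightarrow> real) \<Rightarrow> 'a \<Rightarrow> real" where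
  "centered M f x = f x - (\<integral>y. f y \<partial>M)"

definition density_norm :: "'a measure \<Rightarrow> 'a measure \<Rightarrow> real" where
  "density_norm \<mu>s \<mu> = L2_norm \<mu>s (\<lambda>x. enn2real (RN_deriv \<mu>s \<mu> x))"

definition v_const :: "'a measure \<Rightarrow> (('a \<Rightarrow> real) \<Rightarrow> ('a \<Rightarrow> real) \<Rightarrow> real) \<Rightarrow> real \<Rightarrow>
    ('a \<Rightarrow> real) \<Rightarrow> real" where
  "v_const M ip \<alpha> h = 2 * \<alpha> * (inner_norm ip (\<lambda>x. 1/2 *
     (mult_op h (\<lambda>_. 1) x + adjoint_on_L2 M ip (mult_op h) (\<lambda>_. 1) x)))\<^sup>2"

definition b_const :: "'a measure \<Rightarrow> (('a \<Rightarrow> real) \<Rightarrow> ('a \<Rightarrow> real) \<Rightarrow> real) \<Rightarrow> real \<Rightarrow>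
    ('a \<Rightarrow> real) \<Rightarrow> real" where
  "b_const M ip \<alpha> h =
     \<alpha> * max 0 (SUP g \<in> {g \<in> L2_fun M. inner_norm ip g = 1}. ip (mult_op h g) g)"

definition eta :: "real \<Rightarrow> real \<Rightarrow> real \<Rightarrow> real \<Rightarrow> real" where
  "eta T c d R = (1 / T) * (ln (inverse c) + ln d + R)"

end

theory Submission
  imports Defs
begin

text \<open>
The argument compares the alternative process with the baseline through an exponential moment, and
controls that moment by the energy \<open>ip (u t) (u t)\<close> of a solution of an evolution equation.

Write \<open>A\<close> for the generator, \<open>h\<close> for \<open>f\<close> minus its mean under the invariant measure or the
negative of this, and
\<open>I t\<close> for the integral of \<open>h (X s)\<close> over \<open>s\<close> between \<open>0\<close> and \<open>t\<close>. By the variational bound for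
relative entropy, \<open>l\<close> times the mean of the time integral along the alternative process is at most
the relative entropy plus the logarithm of the mean of \<open>exp (l * I T)\<close> under the baseline, for every
\<open>l > 0\<close>. By Cauchy-Schwarz and the equivalence of norms the latter mean is at most the norm of the
initial density, divided by \<open>c\<close>, times the \<open>ip\<close>-norm of \<open>u T\<close>, where \<open>u t x\<close> is the mean of
\<open>exp (l * I t)\<close> for the process started in \<open>x\<close>.

The function \<open>u\<close> solves \<open>u' = A u + l * h * u\<close> with \<open>u 0 = 1\<close>. The form of the operator on the right is
estimated by splitting a function into its mean and the rest: the Poincare inequality damps the
rest, the constant \<open>b\<close> bounds the potential on the rest, and the only coupling with the mean is through the
vector whose norm defines \<open>v\<close>. As long as \<open>l * b < 1\<close>, completing the square bounds the form by
\<open>l\<^sup>2 * v / (2 * (1 - l * b))\<close> times the squared norm (\<open>perturbed_form_le\<close>), so the norm of \<open>u\<close> grows at most at this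
exponential rate (\<open>exponential_moment_norm_le\<close>). Optimising over \<open>l\<close> gives the first two terms of the bound
(\<open>time_average_deviation\<close>). The third term accounts for the difference between the mean under the initial
distribution and under the invariant measure. It is governed by \<open>w t x\<close>, the mean of \<open>I t\<close>, which solves
\<open>w' = A w + h\<close> with \<open>w 0 = 0\<close>; the Poincare inequality damps it at rate \<open>1 / \<alpha>\<close>
(\<open>mean_time_integral_norm_le\<close>, \<open>relaxation_bound\<close>). The long-time statement is the limit of the first two
terms for the process started in equilibrium.

Both equations are instances of one statement about the mean \<open>u t x\<close> of \<open>G (I t)\<close> for smooth \<open>G\<close>, read as a
statement about right derivatives in \<open>L\<^sup>2\<close>. By the Markov property on path space
(\<open>path_law_shift\<close>), applying the semigroup for time \<open>r\<close> to \<open>u t\<close> replaces the window \<open>{0..t}\<close> of the time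
integral by \<open>{r..r + t}\<close>. Hence both difference quotients, in time and along the semigroup, reduce to
differentiating time integrals at their end points. For a merely measurable \<open>h\<close> this works in mean
(\<open>L1_right_differentiable\<close>), because under a stationary law cadlag paths make \<open>h (X s)\<close> right continuous
in mean (\<open>L1_right_continuous_sequence\<close>). The same difference quotients show
that \<open>u t\<close> and \<open>w t\<close> lie in the domain of \<open>A\<close>, where the Poincare inequality applies to them.
\<close>

section \<open>Inner products on square integrable functions\<close>

lemma L2_funD: "g \<in> L2_fun M \<Longrightarrow> g \<in> borel_measurable M" "g \<in> L2_fun M \<Longrightarrow> integrable M (\<lambda>x. (g x)\<^sup>2)"
  by (auto simp: L2_fun_def)

lemma L2_fun_scale: "g \<in> L2_fun M \<Longrightarrow> (\<lambda>x. r * g x) \<in> L2_fun M"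
  by (auto simp: L2_fun_def power_mult_distrib)

lemma L2_fun_add:
  assumes "g \<in> L2_fun M" "h \<in> L2_fun M"
  shows "(\<lambda>x. g x + h x) \<in> L2_fun M"
proof -
  note [measurable] = L2_funD(1)[OF assms(1)] L2_funD(1)[OF assms(2)]
  have "integrable M (\<lambda>x. 2 * (g x)\<^sup>2 + 2 * (h x)\<^sup>2)"
    using L2_funD(2)[OF assms(1)] L2_funD(2)[OF assms(2)] by simp
  then have "integrable M (\<lambda>x. (g x + h x)\<^sup>2)"
  proof (rule Bochner_Integration.integrable_bound)
    show "AE x in M. norm ((g x + h x)\<^sup>2) \<le> norm (2 * (g x)\<^sup>2 + 2 * (h x)\<^sup>2)"
    proof (intro AE_I2)
      fix x
      have "2 * (g x)\<^sup>2 + 2 * (h x)\<^sup>2 - (g x + h x)\<^sup>2 = (g x - h x)\<^sup>2"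
        by (simp add: power2_eq_square algebra_simps)
      then have "(g x + h x)\<^sup>2 \<le> 2 * (g x)\<^sup>2 + 2 * (h x)\<^sup>2"
        using zero_le_power2[of "g x - h x"] by linarith
      then show "norm ((g x + h x)\<^sup>2) \<le> norm (2 * (g x)\<^sup>2 + 2 * (h x)\<^sup>2)"
        by (metis abs_ge_self abs_of_nonneg order_trans real_norm_def zero_le_power2)
    qed
  qed simp
  then show ?thesis by (simp add: L2_fun_def)
qed

lemma L2_fun_diff:
  assumes "g \<in> L2_fun M" "h \<in> L2_fun M"
  shows "(\<lambda>x. g x - h x) \<in> L2_fun M"
  using L2_fun_add[OF assms(1) L2_fun_scale[OF assms(2), of "-1"]] by simp

lemma L2_fun_mult_bounded:
  assumes [measurable]: "h \<in> borel_measurable M" and h: "\<And>x. \<bar>h x\<bar> \<le> K" and g: "g \<in> L2_fun M"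
  shows "(\<lambda>x. h x * g x) \<in> L2_fun M"
proof -
  note [measurable] = L2_funD(1)[OF g]
  have "integrable M (\<lambda>x. K\<^sup>2 * (g x)\<^sup>2)" using L2_funD(2)[OF g] by simp
  then have "integrable M (\<lambda>x. (h x * g x)\<^sup>2)"
  proof (rule Bochner_Integration.integrable_bound)
    have "(h x)\<^sup>2 * (g x)\<^sup>2 \<le> K\<^sup>2 * (g x)\<^sup>2" for x
      using h[of x] by (intro mult_right_mono) (auto simp: abs_le_square_iff[symmetric])
    then show "AE x in M. norm ((h x * g x)\<^sup>2) \<le> norm (K\<^sup>2 * (g x)\<^sup>2)"
      by (auto simp: power_mult_distrib)
  qed simp
  then show ?thesis by (simp add: L2_fun_def)
qed

lemma (in finite_measure) L2_fun_bounded: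
  assumes [measurable]: "g \<in> borel_measurable M" and g: "\<And>x. \<bar>g x\<bar> \<le> K"
  shows "g \<in> L2_fun M"
proof -
  have "(g x)\<^sup>2 \<le> K\<^sup>2" for x using g[of x] by (auto simp: abs_le_square_iff[symmetric])
  then have "integrable M (\<lambda>x. (g x)\<^sup>2)" by (intro integrable_const_bound[where B="K\<^sup>2"]) auto
  then show ?thesis by (simp add: L2_fun_def)
qed

lemma integrable_mult_L2:
  assumes "g \<in> L2_fun M" "h \<in> L2_fun M"
  shows "integrable M (\<lambda>x. g x * h x)"
proof -
  note [measurable] = L2_funD(1)[OF assms(1)] L2_funD(1)[OF assms(2)]
  have "integrable M (\<lambda>x. (g x)\<^sup>2 + (h x)\<^sup>2)"
    using L2_funD(2)[OF assms(1)] L2_funD(2)[OF assms(2)] by simp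
  then show ?thesis
  proof (rule Bochner_Integration.integrable_bound)
    show "AE x in M. norm (g x * h x) \<le> norm ((g x)\<^sup>2 + (h x)\<^sup>2)"
    proof (intro AE_I2)
      fix x
      have "0 \<le> (\<bar>g x\<bar> - \<bar>h x\<bar>)\<^sup>2" "0 \<le> \<bar>g x\<bar> * \<bar>h x\<bar>" by simp_all
      then have "\<bar>g x\<bar> * \<bar>h x\<bar> \<le> \<bar>g x\<bar>\<^sup>2 + \<bar>h x\<bar>\<^sup>2"
        unfolding power2_diff by linarith
      then show "norm (g x * h x) \<le> norm ((g x)\<^sup>2 + (h x)\<^sup>2)"
        by (simp add: abs_mult)
    qed
  qed simp
qed

lemma inner_product_on_L2_L2_inner: "inner_product_on_L2 M (L2_inner M)"
proof
  fix g g' h assume *: "g \<in> L2_fun M" "g' \<in> L2_fun M" "h \<in> L2_fun M" "AE x in M. g x = g' x"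
  note [measurable] = *(1-3)[THEN L2_funD(1)]
  show "L2_inner M g h = L2_inner M g' h"
    unfolding L2_inner_def using *(4) by (intro integral_cong_AE) auto
next
  fix g h show "L2_inner M g h = L2_inner M h g" by (simp add: L2_inner_def mult.commute)
next
  fix g g' h assume *: "g \<in> L2_fun M" "g' \<in> L2_fun M" "h \<in> L2_fun M"
  show "L2_inner M (\<lambda>x. g x + g' x) h = L2_inner M g h + L2_inner M g' h"
    unfolding L2_inner_def
    using integrable_mult_L2[OF *(1,3)] integrable_mult_L2[OF *(2,3)]
    by (simp add: distrib_right)
next
  fix r g h show "L2_inner M (\<lambda>x. r * g x) h = r * L2_inner M g h"
    by (simp add: L2_inner_def mult.assoc)
next
  fix g show "0 \<le> L2_inner M g g" by (simp add: L2_inner_def)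
next
  fix g assume *: "g \<in> L2_fun M" "L2_inner M g g = 0"
  then show "AE x in M. g x = 0"
    using integral_nonneg_eq_0_iff_AE[of M "\<lambda>x. (g x)\<^sup>2"] L2_funD(2)[OF *(1)]
    by (simp add: L2_inner_def power2_eq_square)
qed

context inner_product_on_L2
begin

lemma ip_add2:
  "\<lbrakk>g \<in> L2_fun M; h \<in> L2_fun M; h' \<in> L2_fun M\<rbrakk> \<Longrightarrow> ip g (\<lambda>x. h x + h' x) = ip g h + ip g h'"
  using ip_add[of h h' g] by (simp add: ip_commute L2_fun_add)

lemma ip_scale2:
  "\<lbrakk>g \<in> L2_fun M; h \<in> L2_fun M\<rbrakk> \<Longrightarrow> ip g (\<lambda>x. r * h x) = r * ip g h"
  using ip_scale[of h g r] by (simp add: ip_commute L2_fun_scale)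

lemma ip_diff:
  assumes "g \<in> L2_fun M" "g' \<in> L2_fun M" "h \<in> L2_fun M"
  shows "ip (\<lambda>x. g x - g' x) h = ip g h - ip g' h"
  using ip_add[OF assms(1) L2_fun_scale[OF assms(2), of "-1"] assms(3)]
    ip_scale[OF assms(2,3), of "-1"] by simp

lemma inner_norm_nonneg: "g \<in> L2_fun M \<Longrightarrow> 0 \<le> inner_norm ip g"
  by (simp add: inner_norm_def ip_nonneg)

lemma inner_norm_square: "g \<in> L2_fun M \<Longrightarrow> (inner_norm ip g)\<^sup>2 = ip g g"
  by (simp add: inner_norm_def ip_nonneg)

lemma ip_add_self:
  assumes "g \<in> L2_fun M" "h \<in> L2_fun M"
  shows "ip (\<lambda>x. g x + h x) (\<lambda>x. g x + h x) = ip g g + 2 * ip g h + ip h h"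
  using assms by (simp add: ip_add ip_add2 L2_fun_add ip_commute[of h g])

lemma inner_norm_scale: "g \<in> L2_fun M \<Longrightarrow> inner_norm ip (\<lambda>x. r * g x) = \<bar>r\<bar> * inner_norm ip g"
  by (simp add: inner_norm_def ip_scale ip_scale2 L2_fun_scale real_sqrt_mult)

lemma Cauchy_Schwarz:
  assumes "g \<in> L2_fun M" "h \<in> L2_fun M"
  shows "\<bar>ip g h\<bar> \<le> inner_norm ip g * inner_norm ip h"
proof -
  have *: "0 \<le> ip g g + 2 * r * ip g h + r\<^sup>2 * ip h h" for r
    using ip_nonneg[OF L2_fun_add[OF assms(1) L2_fun_scale[OF assms(2), of r]]] assms
    by (simp add: ip_add_self L2_fun_scale ip_scale ip_scale2 power2_eq_square mult.assoc)
  have "(ip g h)\<^sup>2 \<le> ip g g * ip h h"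
  proof (cases "ip h h = 0")
    case True
    have "ip g h = 0"
    proof (rule ccontr)
      assume n: "ip g h \<noteq> 0"
      show False using *[of "- (ip g g + 1) / (2 * ip g h)"] True n by (simp add: field_simps)
    qed
    then show ?thesis using True by simp
  next
    case False
    then have p: "0 < ip h h" using ip_nonneg[OF assms(2)] by simp
    show ?thesis using *[of "- ip g h / ip h h"] p
      by (simp add: field_simps power2_eq_square)
  qed
  then have "sqrt ((ip g h)\<^sup>2) \<le> sqrt (ip g g * ip h h)" by (rule real_sqrt_le_mono)
  then show ?thesis by (simp add: inner_norm_def real_sqrt_mult)
qed

lemma inner_norm_triangle:
  assumes "g \<in> L2_fun M" "h \<in> L2_fun M"
  shows "inner_norm ip (\<lambda>x. g x + h x) \<le> inner_norm ip g + inner_norm ip h"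
proof (rule power2_le_imp_le)
  show "(inner_norm ip (\<lambda>x. g x + h x))\<^sup>2 \<le> (inner_norm ip g + inner_norm ip h)\<^sup>2"
    using Cauchy_Schwarz[OF assms] assms
    by (simp add: inner_norm_square ip_add_self L2_fun_add power2_sum)
  show "0 \<le> inner_norm ip g + inner_norm ip h" using assms by (simp add: inner_norm_nonneg)
qed

lemma inner_norm_triangle_diff:
  assumes "g \<in> L2_fun M" "h \<in> L2_fun M"
  shows "inner_norm ip (\<lambda>x. g x - h x) \<le> inner_norm ip g + inner_norm ip h"
  using inner_norm_triangle[OF assms(1) L2_fun_scale[OF assms(2), of "-1"]]
    inner_norm_scale[OF assms(2), of "-1"] by simp

end

text \<open>Consecutive differences with a geometric bound are summable almost everywhere, because on a
  probability space the first moment is bounded by the \<open>L\<^sup>2\<close> norm; Fatou's lemma then upgrades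
  pointwise convergence to convergence in norm.\<close>

lemma (in prob_space) L2_complete:
  assumes g: "\<And>n. g n \<in> L2_fun M"
    and close: "\<And>n. L2_norm M (\<lambda>x. g (Suc n) x - g n x) \<le> K * (1/2) ^ n"
  obtains l where "l \<in> L2_fun M" "(\<lambda>n. L2_norm M (\<lambda>x. g n x - l x)) \<longlonglongrightarrow> 0"
proof -
  interpret L2: inner_product_on_L2 M "L2_inner M" by (rule inner_product_on_L2_L2_inner)
  note [measurable] = g[THEN L2_funD(1)]
  define d where "d n x = g (Suc n) x - g n x" for n x
  have d: "d n \<in> L2_fun M" for n unfolding d_def by (intro L2_fun_diff g)
  note [measurable] = d[THEN L2_funD(1)]
  have K: "0 \<le> K" using close[of 0] L2.inner_norm_nonneg[OF d[of 0]] by (simp add: d_def[abs_def])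
  have one: "(\<lambda>_. 1) \<in> L2_fun M" by (rule L2_fun_bounded[where K=1]) auto
  have d1: "(\<integral>\<^sup>+x. ennreal \<bar>d n x\<bar> \<partial>M) \<le> ennreal (K * (1/2)^n)" for n
  proof -
    have a: "(\<lambda>x. \<bar>d n x\<bar>) \<in> L2_fun M" using d[of n] by (auto simp: L2_fun_def)
    have "(\<integral>x. \<bar>d n x\<bar> \<partial>M) \<le> L2_norm M (\<lambda>x. \<bar>d n x\<bar>) * L2_norm M (\<lambda>_. 1)"
      using L2.Cauchy_Schwarz[OF a one] by (simp add: L2_inner_def)
    also have "\<dots> = L2_norm M (d n)" by (simp add: inner_norm_def L2_inner_def prob_space)
    also have "\<dots> \<le> K * (1/2)^n" using close[of n] by (simp add: d_def[abs_def])
    finally have "(\<integral>x. \<bar>d n x\<bar> \<partial>M) \<le> K * (1/2)^n" .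
    moreover have "integrable M (\<lambda>x. \<bar>d n x\<bar>)" using integrable_mult_L2[OF a one] by simp
    ultimately show ?thesis by (simp add: nn_integral_eq_integral ennreal_leI)
  qed
  have "(\<integral>\<^sup>+x. (\<Sum>n. ennreal \<bar>d n x\<bar>) \<partial>M) = (\<Sum>n. \<integral>\<^sup>+x. ennreal \<bar>d n x\<bar> \<partial>M)"
    by (rule nn_integral_suminf) simp
  also have "\<dots> \<le> (\<Sum>n. ennreal (K * (1/2)^n))" by (intro suminf_le d1) auto
  also have "\<dots> < \<infinity>"
    using K by (subst suminf_ennreal2) (auto intro!: summable_mult summable_geometric)
  finally have "(\<integral>\<^sup>+x. (\<Sum>n. ennreal \<bar>d n x\<bar>) \<partial>M) \<noteq> \<infinity>" by simp
  then have "AE x in M. (\<Sum>n. ennreal \<bar>d n x\<bar>) \<noteq> \<infinity>"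
    by (intro nn_integral_noteq_infinite) auto
  then have conv: "AE x in M. convergent (\<lambda>n. g n x)"
  proof eventually_elim
    case (elim x)
    then have "summable (\<lambda>n. \<bar>d n x\<bar>)"
      by (intro summable_suminf_not_top) auto
    then have "summable (\<lambda>n. d n x)" by (rule summable_rabs_cancel)
    then have "convergent (\<lambda>n. \<Sum>i<n. d i x)" by (simp add: summable_iff_convergent)
    then have "convergent (\<lambda>n. g 0 x + (\<Sum>i<n. d i x))"
      by (intro convergent_add) (auto simp: convergent_const)
    moreover have "g 0 x + (\<Sum>i<n. d i x) = g n x" for n
      by (induction n) (auto simp: d_def)
    ultimately show ?case by simp
  qed
  define l where "l x = lim (\<lambda>n. g n x)" for x
  have [measurable]: "l \<in> borel_measurable M" unfolding l_def by measurable
  have tail: "L2_norm M (\<lambda>x. g (n + m) x - g n x) \<le> 2 * K * (1/2)^n * (1 - (1/2)^m)" for n m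
  proof (induction m)
    case 0 then show ?case by (simp add: inner_norm_def L2_inner_def)
  next
    case (Suc m)
    have "L2_norm M (\<lambda>x. g (n + Suc m) x - g n x)
      = L2_norm M (\<lambda>x. (g (n + m) x - g n x) + (g (Suc (n + m)) x - g (n + m) x))" by simp
    also have "\<dots> \<le> 2 * K * (1/2)^n * (1 - (1/2)^m) + K * (1/2)^(n+m)"
      using L2.inner_norm_triangle[OF L2_fun_diff[OF g g] L2_fun_diff[OF g g]] Suc.IH close[of "n+m"]
      by (meson add_mono order_trans)
    also have "\<dots> = 2 * K * (1/2)^n * (1 - (1/2)^Suc m)"
      by (simp add: algebra_simps power_add)
    finally show ?case .
  qed
  have fatou: "(\<integral>\<^sup>+x. ennreal ((g n x - l x)\<^sup>2) \<partial>M) \<le> ennreal ((2 * K * (1/2)^n)\<^sup>2)" for n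
  proof -
    have "(\<integral>\<^sup>+x. ennreal ((g n x - l x)\<^sup>2) \<partial>M)
       = (\<integral>\<^sup>+x. liminf (\<lambda>m. ennreal ((g (n + m) x - g n x)\<^sup>2)) \<partial>M)"
    proof (rule nn_integral_cong_AE)
      show "AE x in M. ennreal ((g n x - l x)\<^sup>2) = liminf (\<lambda>m. ennreal ((g (n + m) x - g n x)\<^sup>2))"
        using conv
      proof eventually_elim
        case (elim x)
        then have "(\<lambda>m. g m x) \<longlonglongrightarrow> l x" by (simp add: l_def convergent_LIMSEQ_iff)
        then have "(\<lambda>m. g (n + m) x) \<longlonglongrightarrow> l x"
          using LIMSEQ_ignore_initial_segment[of "\<lambda>m. g m x" "l x" n] by (simp add: add.commute)
        then have "(\<lambda>m. ennreal ((g (n + m) x - g n x)\<^sup>2)) \<longlonglongrightarrow> ennreal ((l x - g n x)\<^sup>2)"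
          by (intro tendsto_intros tendsto_ennrealI)
        then have "liminf (\<lambda>m. ennreal ((g (n + m) x - g n x)\<^sup>2)) = ennreal ((l x - g n x)\<^sup>2)"
          by (intro lim_imp_Liminf) auto
        then show ?case by (simp add: power2_commute)
      qed
    qed
    also have "\<dots> \<le> liminf (\<lambda>m. \<integral>\<^sup>+x. ennreal ((g (n + m) x - g n x)\<^sup>2) \<partial>M)"
      by (rule nn_integral_liminf) simp
    also have "\<dots> \<le> ennreal ((2 * K * (1/2)^n)\<^sup>2)"
    proof (rule Liminf_le, simp, intro always_eventually allI)
      fix m
      have D: "(\<lambda>x. g (n + m) x - g n x) \<in> L2_fun M" by (intro L2_fun_diff g)
      have "L2_norm M (\<lambda>x. g (n + m) x - g n x) \<le> 2 * K * (1/2)^n"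
      proof (rule order_trans[OF tail])
        show "2 * K * (1/2)^n * (1 - (1/2)^m) \<le> 2 * K * (1/2)^n"
          using K by (intro mult_right_le_one_le) (auto simp: power_le_one)
      qed
      then have "(L2_norm M (\<lambda>x. g (n + m) x - g n x))\<^sup>2 \<le> (2 * K * (1/2)^n)\<^sup>2"
        by (intro power_mono L2.inner_norm_nonneg D)
      then have "(\<integral>x. (g (n + m) x - g n x)\<^sup>2 \<partial>M) \<le> (2 * K * (1/2)^n)\<^sup>2"
        by (subst (asm) L2.inner_norm_square[OF D]) (simp add: L2_inner_def power2_eq_square)
      then show "(\<integral>\<^sup>+x. ennreal ((g (n + m) x - g n x)\<^sup>2) \<partial>M) \<le> ennreal ((2 * K * (1/2)^n)\<^sup>2)"
        by (subst nn_integral_eq_integral) (auto intro: ennreal_leI L2_funD(2)[OF D])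
    qed
    finally show ?thesis .
  qed
  have diff: "(\<lambda>x. g n x - l x) \<in> L2_fun M" for n
  proof -
    have "(\<integral>\<^sup>+x. ennreal ((g n x - l x)\<^sup>2) \<partial>M) < \<infinity>" using fatou[of n] by (simp add: order_le_less_trans)
    then show ?thesis unfolding L2_fun_def by (auto intro!: integrableI_nonneg)
  qed
  have l: "l \<in> L2_fun M" using L2_fun_diff[OF g diff, of 0 0] by simp
  have "L2_norm M (\<lambda>x. g n x - l x) \<le> 2 * K * (1/2)^n" for n
  proof (rule power2_le_imp_le)
    have "ennreal (\<integral>x. (g n x - l x)\<^sup>2 \<partial>M) \<le> ennreal ((2 * K * (1/2)^n)\<^sup>2)"
      using fatou[of n] L2_funD(2)[OF diff[of n]] by (subst (asm) nn_integral_eq_integral) auto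
    then have "(\<integral>x. (g n x - l x)\<^sup>2 \<partial>M) \<le> (2 * K * (1/2)^n)\<^sup>2"
      by (simp only: ennreal_le_iff zero_le_power2)
    moreover have "(L2_norm M (\<lambda>x. g n x - l x))\<^sup>2 = (\<integral>x. (g n x - l x)\<^sup>2 \<partial>M)"
      by (subst L2.inner_norm_square[OF diff]) (simp add: L2_inner_def power2_eq_square)
    ultimately show "(L2_norm M (\<lambda>x. g n x - l x))\<^sup>2 \<le> (2 * K * (1/2)^n)\<^sup>2" by simp
  qed (simp add: K)
  moreover have "(\<lambda>n. 2 * K * (1/2)^n) \<longlonglongrightarrow> 0" by (intro tendsto_mult_right_zero LIMSEQ_power_zero) auto
  ultimately have "(\<lambda>n. L2_norm M (\<lambda>x. g n x - l x)) \<longlonglongrightarrow> 0"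
    using L2.inner_norm_nonneg[OF diff]
    by (intro Lim_null_comparison[of "\<lambda>n. L2_norm M (\<lambda>x. g n x - l x)"]) auto
  with l show thesis by (rule that)
qed

locale equivalent_inner_product = prob_space M + inner_product_on_L2 M ip
  for M :: "'a measure" and ip +
  fixes c C :: real
  assumes c_pos: "0 < c" and c_le_C: "c \<le> C"
    and equivalent: "\<And>g. g \<in> L2_fun M \<Longrightarrow>
      c * L2_norm M g \<le> inner_norm ip g \<and> inner_norm ip g \<le> C * L2_norm M g"
begin

sublocale L2: inner_product_on_L2 M "L2_inner M" by (rule inner_product_on_L2_L2_inner)

lemma L2_norm_le: "g \<in> L2_fun M \<Longrightarrow> L2_norm M g \<le> inner_norm ip g / c"
  using equivalent[of g] c_pos by (simp add: pos_le_divide_eq mult.commute)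

lemma inner_norm_le: "g \<in> L2_fun M \<Longrightarrow> inner_norm ip g \<le> C * L2_norm M g"
  using equivalent by blast

text \<open>The functional is represented by the minimiser of \<open>ip g g - 2 * \<phi> g\<close>: a minimising sequence is
  Cauchy by the parallelogram law, and the first variation at the minimum is the desired identity.\<close>

lemma Riesz_representation_L2:
  assumes add: "\<And>g h. g \<in> L2_fun M \<Longrightarrow> h \<in> L2_fun M \<Longrightarrow> \<phi> (\<lambda>x. g x + h x) = \<phi> g + \<phi> h"
    and scale: "\<And>r g. g \<in> L2_fun M \<Longrightarrow> \<phi> (\<lambda>x. r * g x) = r * \<phi> g"
    and bound: "\<And>g. g \<in> L2_fun M \<Longrightarrow> \<bar>\<phi> g\<bar> \<le> B * inner_norm ip g"
  obtains k where "k \<in> L2_fun M" "\<And>g. g \<in> L2_fun M \<Longrightarrow> \<phi> g = ip g k"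
proof -
  define J where "J g = ip g g - 2 * \<phi> g" for g
  have diff: "\<phi> (\<lambda>x. g x - h x) = \<phi> g - \<phi> h" if "g \<in> L2_fun M" "h \<in> L2_fun M" for g h
    using add[OF that(1) L2_fun_scale[OF that(2), of "-1"]] scale[OF that(2), of "-1"] by simp
  have J_expand: "J (\<lambda>x. g x + h x) = J g + 2 * (ip g h - \<phi> h) + ip h h"
    if "g \<in> L2_fun M" "h \<in> L2_fun M" for g h
    using that by (simp add: J_def ip_add_self add algebra_simps)
  have J_lower: "- B\<^sup>2 \<le> J g" if "g \<in> L2_fun M" for g
  proof -
    have "- B\<^sup>2 \<le> (inner_norm ip g)\<^sup>2 - 2 * (B * inner_norm ip g)"
      using zero_le_power2[of "inner_norm ip g - B"] by (simp add: power2_diff algebra_simps)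
    also have "\<dots> \<le> J g" using bound[OF that] by (simp add: J_def inner_norm_square[OF that])
    finally show ?thesis .
  qed
  define m where "m = (INF g\<in>L2_fun M. J g)"
  have bdd: "bdd_below (J ` L2_fun M)" using J_lower by (auto intro!: bdd_belowI)
  have m: "m \<le> J g" if "g \<in> L2_fun M" for g
    unfolding m_def using bdd that by (rule cINF_lower)
  have zero: "(\<lambda>_. 0) \<in> L2_fun M" by (rule L2_fun_bounded[where K=0]) auto
  have "\<exists>g\<in>L2_fun M. J g < m + (1/4)^n" for n
    unfolding m_def using zero bdd by (subst cINF_less_iff[symmetric]) auto
  then obtain g where g: "\<And>n. g n \<in> L2_fun M" and Jg: "\<And>n. J (g n) < m + (1/4)^n"
    by metis
  have para: "inner_norm ip (\<lambda>x. g (Suc n) x - g n x) \<le> 2 * (1/2)^n" for n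
  proof (rule power2_le_imp_le)
    define h where "h x = (1/2) * (g (Suc n) x - g n x)" for x
    define a where "a x = g n x + h x" for x
    have h: "h \<in> L2_fun M" unfolding h_def by (intro L2_fun_scale L2_fun_diff g)
    have a: "a \<in> L2_fun M" unfolding a_def by (intro L2_fun_add g h)
    have s: "g (Suc n) = (\<lambda>x. a x + h x)" "g n = (\<lambda>x. a x + (-1) * h x)"
      by (auto simp: a_def h_def field_simps)
    have "J (g (Suc n)) + J (g n) = 2 * J a + 2 * ip h h"
      unfolding s using J_expand[OF a h] J_expand[OF a L2_fun_scale[OF h, of "-1"]] a h
      by (simp add: ip_scale2 ip_scale scale[OF h, of "-1", simplified] L2_fun_scale[OF h, of "-1", simplified]
          ip_scale2[OF a h, of "-1", simplified] ip_scale2[OF _ h, of _ "-1", simplified] ip_scale[OF h, of _ "-1", simplified])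
    moreover have "(1/4::real)^Suc n \<le> (1/4)^n" by (rule power_decreasing) auto
    ultimately have "ip h h \<le> (1/4)^n" using Jg[of n] Jg[of "Suc n"] m[OF a] by linarith
    moreover have "ip (\<lambda>x. g (Suc n) x - g n x) (\<lambda>x. g (Suc n) x - g n x) = 4 * ip h h"
    proof -
      have "(\<lambda>x. g (Suc n) x - g n x) = (\<lambda>x. 2 * h x)" by (auto simp: h_def)
      then show ?thesis using h by (simp add: ip_scale ip_scale2 L2_fun_scale)
    qed
    moreover have "(2 * (1/2::real)^n)\<^sup>2 = 4 * (1/4)^n"
    proof -
      have "((1/2::real)^n)\<^sup>2 = ((1/2)\<^sup>2)^n" by (metis mult.commute power_mult)
      also have "(1/2::real)\<^sup>2 = 1/4" by (simp add: power2_eq_square)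
      finally show ?thesis by (simp add: power_mult_distrib)
    qed
    ultimately show "(inner_norm ip (\<lambda>x. g (Suc n) x - g n x))\<^sup>2 \<le> (2 * (1/2)^n)\<^sup>2"
      by (simp only: inner_norm_square[OF L2_fun_diff[OF g g]])
  qed simp
  have "L2_norm M (\<lambda>x. g (Suc n) x - g n x) \<le> (2 / c) * (1/2)^n" for n
  proof -
    have "L2_norm M (\<lambda>x. g (Suc n) x - g n x) \<le> inner_norm ip (\<lambda>x. g (Suc n) x - g n x) / c"
      by (intro L2_norm_le L2_fun_diff g)
    also have "\<dots> \<le> 2 * (1/2)^n / c" using para[of n] c_pos by (intro divide_right_mono) auto
    finally have "L2_norm M (\<lambda>x. g (Suc n) x - g n x) \<le> 2 * (1/2)^n / c" .
    then show ?thesis by simp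
  qed
  from L2_complete[of g, OF g this]
  obtain k where k: "k \<in> L2_fun M" and lim: "(\<lambda>n. L2_norm M (\<lambda>x. g n x - k x)) \<longlonglongrightarrow> 0"
    by blast
  define e where "e n x = g n x - k x" for n x
  have e: "e n \<in> L2_fun M" for n unfolding e_def by (intro L2_fun_diff g k)
  have lim': "(\<lambda>n. inner_norm ip (e n)) \<longlonglongrightarrow> 0"
  proof (rule tendsto_sandwich[OF _ _ tendsto_const])
    show "\<forall>\<^sub>F n in sequentially. inner_norm ip (e n) \<le> C * L2_norm M (\<lambda>x. g n x - k x)"
      using inner_norm_le[OF e] by (simp add: e_def[abs_def])
    show "(\<lambda>n. C * L2_norm M (\<lambda>x. g n x - k x)) \<longlonglongrightarrow> 0"
      using lim by (intro tendsto_mult_right_zero)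
  qed (use inner_norm_nonneg[OF e] in auto)
  have to0: "(\<lambda>n. ip k (e n) - \<phi> (e n)) \<longlonglongrightarrow> 0"
  proof (rule Lim_null_comparison)
    show "\<forall>\<^sub>F n in sequentially. norm (ip k (e n) - \<phi> (e n)) \<le> (inner_norm ip k + B) * inner_norm ip (e n)"
      using Cauchy_Schwarz[OF k e] bound[OF e]
      by (intro always_eventually allI) (smt (verit) distrib_right real_norm_def)
    show "(\<lambda>n. (inner_norm ip k + B) * inner_norm ip (e n)) \<longlonglongrightarrow> 0"
      using lim' by (intro tendsto_mult_right_zero)
  qed
  have Jk: "J k \<le> m"
  proof (rule LIMSEQ_le)
    show "(\<lambda>n. J k + 2 * (ip k (e n) - \<phi> (e n))) \<longlonglongrightarrow> J k"
      using tendsto_add[OF tendsto_const tendsto_mult_right_zero[OF to0, of 2], of "J k"] by simp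
    show "(\<lambda>n. m + (1/4)^n) \<longlonglongrightarrow> m"
      using tendsto_add[OF tendsto_const LIMSEQ_power_zero[of "1/4::real"], of m] by simp
    have "J k + 2 * (ip k (e n) - \<phi> (e n)) \<le> m + (1/4)^n" for n
      using J_expand[OF k e, of n] Jg[of n] ip_nonneg[OF e, of n] by (simp add: e_def[abs_def])
    then show "\<exists>N. \<forall>n\<ge>N. J k + 2 * (ip k (e n) - \<phi> (e n)) \<le> m + (1/4)^n" by blast
  qed
  have "\<phi> h = ip h k" if h: "h \<in> L2_fun M" for h
  proof -
    define d where "d = ip k h - \<phi> h"
    have *: "0 \<le> 2 * r * d + r\<^sup>2 * ip h h" for r
      using m[OF L2_fun_add[OF k L2_fun_scale[OF h, of r]]] Jk J_expand[OF k L2_fun_scale[OF h, of r]] h k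
      by (simp add: d_def ip_scale ip_scale2 L2_fun_scale scale power2_eq_square algebra_simps)
    \<comment> \<open>\<open>r\<close> minimises the quadratic with \<open>s\<close> in place of \<open>ip h h\<close>, which may vanish.\<close>
    define s where "s = ip h h + 1"
    define r where "r = - d / s"
    have s: "0 < s" using ip_nonneg[OF h] by (simp add: s_def)
    have rs: "r * s = - d" using s by (simp add: r_def)
    have "0 \<le> 2 * r * d + r\<^sup>2 * s"
      using *[of r] mult_left_mono[of "ip h h" s "r\<^sup>2"] by (simp add: s_def)
    also have "r\<^sup>2 * s = - (r * d)" by (simp add: power2_eq_square mult.assoc rs)
    finally have "d\<^sup>2 / s \<le> 0" by (simp add: r_def power2_eq_square)
    then have "d = 0" using s by (simp add: divide_le_0_iff)
    then show ?thesis using ip_commute[OF h k] by (simp add: d_def)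
  qed
  with k show thesis by (rule that)
qed

lemma inner_norm_mult_op_le:
  assumes [measurable]: "h \<in> borel_measurable M" and h: "\<And>x. \<bar>h x\<bar> \<le> K"
    and g: "g \<in> L2_fun M"
  shows "inner_norm ip (mult_op h g) \<le> C * K / c * inner_norm ip g"
proof -
  have K: "0 \<le> K" using h[of undefined] by linarith
  have hg: "mult_op h g \<in> L2_fun M"
    unfolding mult_op_def by (rule L2_fun_mult_bounded[OF \<open>h \<in> borel_measurable M\<close> h g])
  have "(\<integral>x. (h x * g x)\<^sup>2 \<partial>M) \<le> (\<integral>x. K\<^sup>2 * (g x)\<^sup>2 \<partial>M)"
  proof (rule integral_mono)
    fix x
    have "(h x)\<^sup>2 * (g x)\<^sup>2 \<le> K\<^sup>2 * (g x)\<^sup>2"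
      using h[of x] by (intro mult_right_mono) (auto simp: abs_le_square_iff[symmetric])
    then show "(h x * g x)\<^sup>2 \<le> K\<^sup>2 * (g x)\<^sup>2" by (simp add: power_mult_distrib)
  qed (use L2_funD(2)[OF hg] L2_funD(2)[OF g] in \<open>auto simp: mult_op_def\<close>)
  then have "L2_norm M (mult_op h g) \<le> sqrt (K\<^sup>2 * (\<integral>x. (g x)\<^sup>2 \<partial>M))"
    by (simp add: inner_norm_def L2_inner_def mult_op_def power2_eq_square)
  also have "\<dots> = K * L2_norm M g"
    using K by (simp add: inner_norm_def L2_inner_def real_sqrt_mult power2_eq_square[of "g _"])
  finally have "L2_norm M (mult_op h g) \<le> K * L2_norm M g" .
  moreover have "L2_norm M g \<le> inner_norm ip g / c" by (rule L2_norm_le[OF g])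
  ultimately have "L2_norm M (mult_op h g) \<le> K * (inner_norm ip g / c)"
    using K by (meson mult_left_mono order_trans)
  then have "C * L2_norm M (mult_op h g) \<le> C * (K * (inner_norm ip g / c))"
    using c_pos c_le_C by (intro mult_left_mono) auto
  with inner_norm_le[OF hg] show ?thesis by (simp add: mult_ac)
qed

text \<open>The adjoint is picked by a choice operator, so its defining property is available only once some
  adjoint has been exhibited; Riesz representation provides its values one at a time.\<close>

lemma adjoint_mult_op:
  assumes [measurable]: "h \<in> borel_measurable M" and h: "\<And>x. \<bar>h x\<bar> \<le> K"
    and k: "k \<in> L2_fun M"
  shows "adjoint_on_L2 M ip (mult_op h) k \<in> L2_fun M"
    and "g \<in> L2_fun M \<Longrightarrow> ip (mult_op h g) k = ip g (adjoint_on_L2 M ip (mult_op h) k)"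
proof -
  note mult = L2_fun_mult_bounded[OF \<open>h \<in> borel_measurable M\<close> h]
  have "\<exists>S'. \<forall>k\<in>L2_fun M. S' k \<in> L2_fun M \<and> (\<forall>g\<in>L2_fun M. ip (mult_op h g) k = ip g (S' k))"
  proof (rule bchoice, rule ballI)
    fix k assume k: "k \<in> L2_fun M"
    show "\<exists>k'. k' \<in> L2_fun M \<and> (\<forall>g\<in>L2_fun M. ip (mult_op h g) k = ip g k')"
    proof (rule Riesz_representation_L2[where \<phi>="\<lambda>g. ip (mult_op h g) k" and B="C * K / c * inner_norm ip k"])
      fix g assume g: "g \<in> L2_fun M"
      show "\<bar>ip (mult_op h g) k\<bar> \<le> C * K / c * inner_norm ip k * inner_norm ip g"
      proof -
        have "\<bar>ip (mult_op h g) k\<bar> \<le> inner_norm ip (mult_op h g) * inner_norm ip k"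
          unfolding mult_op_def using mult[OF g] k by (rule Cauchy_Schwarz)
        also have "\<dots> \<le> (C * K / c * inner_norm ip g) * inner_norm ip k"
          using inner_norm_mult_op_le[OF \<open>h \<in> borel_measurable M\<close> h g]
          by (intro mult_right_mono inner_norm_nonneg k)
        finally show ?thesis by (simp add: mult_ac)
      qed
      fix r show "ip (mult_op h (\<lambda>x. r * g x)) k = r * ip (mult_op h g) k"
        using ip_scale[OF mult[OF g] k, of r] by (simp add: mult_op_def mult_ac)
    next
      fix g g' assume g: "g \<in> L2_fun M" "g' \<in> L2_fun M"
      show "ip (mult_op h (\<lambda>x. g x + g' x)) k = ip (mult_op h g) k + ip (mult_op h g') k"
        using ip_add[OF mult[OF g(1)] mult[OF g(2)] k] by (simp add: mult_op_def distrib_left)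
    qed blast+
  qed
  then obtain S' where "\<forall>k\<in>L2_fun M. S' k \<in> L2_fun M \<and> (\<forall>g\<in>L2_fun M. ip (mult_op h g) k = ip g (S' k))" ..
  then have "(\<forall>k\<in>L2_fun M. S' k \<in> L2_fun M) \<and>
      (\<forall>g\<in>L2_fun M. \<forall>k\<in>L2_fun M. ip (mult_op h g) k = ip g (S' k))" by blast
  from someI[of "\<lambda>S'. (\<forall>k\<in>L2_fun M. S' k \<in> L2_fun M) \<and>
      (\<forall>g\<in>L2_fun M. \<forall>k\<in>L2_fun M. ip (mult_op h g) k = ip g (S' k))", OF this]
  show "adjoint_on_L2 M ip (mult_op h) k \<in> L2_fun M"
    and "g \<in> L2_fun M \<Longrightarrow> ip (mult_op h g) k = ip g (adjoint_on_L2 M ip (mult_op h) k)"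
    unfolding adjoint_on_L2_def using k by blast+
qed

end

section \<open>Comparison by right derivatives\<close>

lemma has_real_derivative_at_right_iff:
  "(f has_real_derivative D) (at_right t) \<longleftrightarrow> ((\<lambda>h. (f (t + h) - f t) / h) \<longlongrightarrow> D) (at_right 0)"
proof -
  have "(f has_real_derivative D) (at_right t) \<longleftrightarrow> ((\<lambda>y. (f y - f t) / (y - t)) \<longlongrightarrow> D) (at_right t)"
    by (rule has_field_derivative_iff)
  also have "\<dots> \<longleftrightarrow> ((\<lambda>h. (f (t + h) - f t) / h) \<longlongrightarrow> D) (at_right 0)"
    by (subst at_right_to_0) (simp add: filterlim_filtermap add.commute)
  finally show ?thesis .
qed

text \<open>Only right derivatives are available for the energies below, since a semigroup moves forward in
  time. With slack \<open>\<epsilon> > 0\<close> the inequality propagates to the right by the derivative bound and to limits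
  from the left by continuity, so the set of times up to which it holds is all of \<open>{0..T}\<close>.\<close>

lemma right_derivative_nonpos_imp_le:
  fixes \<psi> :: "real \<Rightarrow> real"
  assumes T: "0 \<le> T" and cont: "continuous_on {0..T} \<psi>"
    and deriv: "\<And>t. 0 \<le> t \<Longrightarrow> t < T \<Longrightarrow>
      \<exists>d\<le>0. (\<psi> has_real_derivative d) (at_right t)"
  shows "\<psi> T \<le> \<psi> 0"
proof (rule field_le_epsilon)
  fix e :: real assume "0 < e"
  define \<epsilon> where "\<epsilon> = e / (T + 1)"
  have \<epsilon>: "0 < \<epsilon>" "\<epsilon> * T \<le> e" using T \<open>0 < e\<close> by (auto simp: \<epsilon>_def field_simps)
  define G where "G = {t\<in>{0..T}. \<forall>s\<in>{0..t}. \<psi> s \<le> \<psi> 0 + \<epsilon> * s}"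
  have G0: "0 \<in> G" using T by (auto simp: G_def)
  have bdd: "bdd_above G" by (auto simp: G_def intro!: bdd_aboveI)
  define r where "r = Sup G"
  have r: "0 \<le> r" "r \<le> T"
    using G0 bdd by (auto simp: r_def G_def intro!: cSup_upper cSup_least)
  have below: "\<psi> s \<le> \<psi> 0 + \<epsilon> * s" if s: "0 \<le> s" "s < r" for s
  proof -
    obtain t where "t \<in> G" "s < t" using s(2) G0 bdd less_cSup_iff[of G s] unfolding r_def by blast
    then show ?thesis using s by (auto simp: G_def)
  qed
  have at_r: "\<psi> r \<le> \<psi> 0 + \<epsilon> * r"
  proof (cases "r = 0")
    case False
    define s where "s n = r - r / real (Suc n)" for n
    have s: "0 \<le> s n" "s n < r" for n using False r by (auto simp: s_def field_simps)
    have "s \<longlonglongrightarrow> r - 0" unfolding s_def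
      by (intro tendsto_diff tendsto_const LIMSEQ_Suc[OF lim_const_over_n])
    then have lim: "s \<longlonglongrightarrow> r" by simp
    have "(\<lambda>n. \<psi> (s n)) \<longlonglongrightarrow> \<psi> r"
      using cont lim r s by (intro continuous_on_tendsto_compose[OF cont lim]) (auto intro!: always_eventually order_trans[OF less_imp_le[OF s(2)]])
    moreover have "(\<lambda>n. \<psi> 0 + \<epsilon> * s n) \<longlonglongrightarrow> \<psi> 0 + \<epsilon> * r" by (intro tendsto_intros lim)
    ultimately show ?thesis using below s by (intro LIMSEQ_le[of "\<lambda>n. \<psi> (s n)"]) auto
  qed simp
  have "r = T"
  proof (rule ccontr)
    assume "r \<noteq> T"
    with r have "r < T" by simp
    from deriv[OF r(1) this] obtain d where d: "d \<le> 0" "((\<lambda>h. (\<psi> (r + h) - \<psi> r) / h) \<longlongrightarrow> d) (at_right 0)"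
      unfolding has_real_derivative_at_right_iff by blast
    have "\<forall>\<^sub>F h in at_right 0. (\<psi> (r + h) - \<psi> r) / h < \<epsilon>"
      using d \<epsilon> by (intro order_tendstoD(2)[OF d(2)]) auto
    then obtain b where b: "0 < b" "\<And>h. 0 < h \<Longrightarrow> h < b \<Longrightarrow> (\<psi> (r + h) - \<psi> r) / h < \<epsilon>"
      by (auto simp: eventually_at_right_field)
    define t where "t = r + min (b/2) (T - r)"
    have t: "r < t" "t \<le> T" using b(1) \<open>r < T\<close> by (auto simp: t_def)
    have "\<psi> s \<le> \<psi> 0 + \<epsilon> * s" if "s \<in> {0..t}" for s
    proof (cases "s \<le> r")
      case True then show ?thesis using below[of s] at_r that by (cases "s = r") auto
    next
      case False
      then have "(\<psi> (r + (s - r)) - \<psi> r) / (s - r) < \<epsilon>"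
        using that b(1) by (intro b(2)) (auto simp: t_def)
      then have "\<psi> s - \<psi> r < \<epsilon> * (s - r)" using False by (simp add: divide_less_eq)
      then show ?thesis using at_r by (simp add: algebra_simps)
    qed
    then have "t \<in> G" using t r by (auto simp: G_def)
    then have "t \<le> r" unfolding r_def using bdd by (rule cSup_upper)
    then show False using t by simp
  qed
  then show "\<psi> T \<le> \<psi> 0 + e" using at_r \<epsilon> by simp
qed

lemma exponential_growth_bound:
  fixes \<phi> :: "real \<Rightarrow> real"
  assumes T: "0 \<le> T" and cont: "continuous_on {0..T} \<phi>"
    and deriv: "\<And>t. 0 \<le> t \<Longrightarrow> t < T \<Longrightarrow> \<exists>d\<le>2 * \<kappa> * \<phi> t. (\<phi> has_real_derivative d) (at_right t)"
  shows "\<phi> T \<le> exp (2 * \<kappa> * T) * \<phi> 0"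
proof -
  define \<psi> where "\<psi> t = \<phi> t * exp (- (2 * \<kappa> * t))" for t
  have "\<psi> T \<le> \<psi> 0"
  proof (rule right_derivative_nonpos_imp_le[OF T])
    show "continuous_on {0..T} \<psi>" unfolding \<psi>_def by (intro continuous_intros cont)
    fix t assume "0 \<le> t" "t < T"
    from deriv[OF this] obtain d where d: "d \<le> 2 * \<kappa> * \<phi> t" "(\<phi> has_real_derivative d) (at_right t)" by blast
    have "(\<psi> has_real_derivative (d - 2 * \<kappa> * \<phi> t) * exp (- (2 * \<kappa> * t))) (at_right t)"
      unfolding \<psi>_def by (auto intro!: derivative_eq_intros d(2) simp: algebra_simps)
    moreover have "(d - 2 * \<kappa> * \<phi> t) * exp (- (2 * \<kappa> * t)) \<le> 0"
      using d(1) by (intro mult_nonpos_nonneg) auto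
    ultimately show "\<exists>d\<le>0. (\<psi> has_real_derivative d) (at_right t)" by blast
  qed
  then show ?thesis by (simp add: \<psi>_def exp_minus field_simps)
qed

text \<open>The square root is not differentiable where the energy vanishes, as it does at time \<open>0\<close> in the
  application; adding \<open>\<delta>\<^sup>2\<close> under the root costs only an error that disappears with \<open>\<delta>\<close>.\<close>

lemma damped_forcing_bound:
  fixes \<phi> :: "real \<Rightarrow> real"
  assumes T: "0 \<le> T" and cont: "continuous_on {0..T} \<phi>" and nonneg: "\<And>t. 0 \<le> t \<Longrightarrow> 0 \<le> \<phi> t"
    and start: "\<phi> 0 = 0" and \<alpha>: "0 < \<alpha>" and F: "0 \<le> F"
    and deriv: "\<And>t. 0 \<le> t \<Longrightarrow> t < T \<Longrightarrow>
      \<exists>d. d \<le> 2 * (F * sqrt (\<phi> t) - \<phi> t / \<alpha>) \<and> (\<phi> has_real_derivative d) (at_right t)"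
  shows "sqrt (\<phi> T) \<le> \<alpha> * (1 - exp (- T / \<alpha>)) * F"
proof -
  have bound: "sqrt (\<phi> T) * exp (T / \<alpha>) \<le> \<delta> + \<alpha> * (exp (T / \<alpha>) - 1) * (F + \<delta> / \<alpha>)" if \<delta>: "0 < \<delta>" for \<delta>
  proof -
    define r where "r t = sqrt (\<phi> t + \<delta>\<^sup>2)" for t
    define \<psi> where "\<psi> t = r t * exp (t / \<alpha>) - \<alpha> * exp (t / \<alpha>) * (F + \<delta> / \<alpha>)" for t
    have "\<psi> T \<le> \<psi> 0"
    proof (rule right_derivative_nonpos_imp_le[OF T])
      show "continuous_on {0..T} \<psi>" unfolding \<psi>_def r_def using \<alpha> by (intro continuous_intros cont) auto
      fix t assume t: "0 \<le> t" "t < T"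
      from deriv[OF this] obtain d where d: "d \<le> 2 * (F * sqrt (\<phi> t) - \<phi> t / \<alpha>)" "(\<phi> has_real_derivative d) (at_right t)" by blast
      have pos: "0 < \<phi> t + \<delta>\<^sup>2" using nonneg[OF t(1)] \<delta> by (intro add_nonneg_pos) auto
      have r: "0 < r t" "(r t)\<^sup>2 = \<phi> t + \<delta>\<^sup>2" using pos by (auto simp: r_def)
      have "(r has_real_derivative d / (2 * r t)) (at_right t)"
        unfolding r_def using pos by (auto intro!: derivative_eq_intros d(2) simp: field_simps)
      then have D: "(\<psi> has_real_derivative (d / (2 * r t) + r t / \<alpha> - (F + \<delta> / \<alpha>)) * exp (t / \<alpha>)) (at_right t)"
        unfolding \<psi>_def using \<alpha> by (auto intro!: derivative_eq_intros simp: field_simps)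
      have "d / (2 * r t) + r t / \<alpha> \<le> F + \<delta> / \<alpha>"
      proof -
        have sr: "sqrt (\<phi> t) \<le> r t" unfolding r_def by (intro real_sqrt_le_mono) simp
        have "\<delta> = sqrt (\<delta>\<^sup>2)" using \<delta> by simp
        also have "\<dots> \<le> r t" unfolding r_def using nonneg[OF t(1)] by (intro real_sqrt_le_mono) simp
        finally have dr: "\<delta> \<le> r t" .
        have "d / (2 * r t) \<le> (2 * (F * sqrt (\<phi> t) - \<phi> t / \<alpha>)) / (2 * r t)"
          using d(1) r(1) by (intro divide_right_mono) auto
        also have "\<dots> = F * (sqrt (\<phi> t) / r t) - (\<phi> t / r t) / \<alpha>"
          by (simp add: diff_divide_distrib mult.commute)
        also have "\<phi> t / r t = r t - \<delta> * (\<delta> / r t)"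
          using r by (simp add: field_simps power2_eq_square)
        also have "F * (sqrt (\<phi> t) / r t) \<le> F * 1"
          using F sr r(1) by (intro mult_left_mono) auto
        also have "F * 1 - (r t - \<delta> * (\<delta> / r t)) / \<alpha> \<le> F - (r t - \<delta> * 1) / \<alpha>"
        proof -
          have "\<delta> * (\<delta> / r t) \<le> \<delta> * 1" using dr \<delta> r(1) by (intro mult_left_mono) auto
          then show ?thesis using \<alpha> by (simp add: divide_right_mono)
        qed
        finally show ?thesis by (simp add: diff_divide_distrib)
      qed
      then have "(d / (2 * r t) + r t / \<alpha> - (F + \<delta> / \<alpha>)) * exp (t / \<alpha>) \<le> 0"
        by (intro mult_nonpos_nonneg) auto
      with D show "\<exists>d\<le>0. (\<psi> has_real_derivative d) (at_right t)" by blast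
    qed
    moreover have "\<psi> 0 = \<delta> - \<alpha> * (F + \<delta> / \<alpha>)" using \<delta> by (simp add: \<psi>_def r_def start)
    moreover have "sqrt (\<phi> T) * exp (T / \<alpha>) \<le> r T * exp (T / \<alpha>)"
      unfolding r_def by (intro mult_right_mono real_sqrt_le_mono) auto
    moreover have "\<alpha> * (exp (T / \<alpha>) - 1) * (F + \<delta> / \<alpha>)
        = \<alpha> * exp (T / \<alpha>) * (F + \<delta> / \<alpha>) - \<alpha> * (F + \<delta> / \<alpha>)"
      by (simp only: left_diff_distrib right_diff_distrib mult_1_right)
    ultimately show ?thesis unfolding \<psi>_def by linarith
  qed
  have "sqrt (\<phi> T) * exp (T / \<alpha>) \<le> \<alpha> * (exp (T / \<alpha>) - 1) * F"
  proof (rule tendsto_lowerbound)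
    have "((\<lambda>\<delta>. \<delta> + \<alpha> * (exp (T / \<alpha>) - 1) * (F + \<delta> / \<alpha>)) \<longlongrightarrow> 0 + \<alpha> * (exp (T / \<alpha>) - 1) * (F + 0 / \<alpha>)) (at_right 0)"
      using \<alpha> by (intro tendsto_intros) auto
    then show "((\<lambda>\<delta>. \<delta> + \<alpha> * (exp (T / \<alpha>) - 1) * (F + \<delta> / \<alpha>)) \<longlongrightarrow> \<alpha> * (exp (T / \<alpha>) - 1) * F) (at_right 0)" by simp
    show "\<forall>\<^sub>F \<delta> in at_right 0. sqrt (\<phi> T) * exp (T / \<alpha>) \<le> \<delta> + \<alpha> * (exp (T / \<alpha>) - 1) * (F + \<delta> / \<alpha>)"
      unfolding eventually_at_right_field using bound by (intro exI[of _ 1]) auto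
  qed simp
  then have "sqrt (\<phi> T) \<le> \<alpha> * (exp (T / \<alpha>) - 1) * F / exp (T / \<alpha>)"
    by (simp add: pos_le_divide_eq)
  also have "\<dots> = \<alpha> * (1 - exp (- T / \<alpha>)) * F"
    by (simp add: exp_minus field_simps)
  finally show ?thesis .
qed

section \<open>Time integrals of cadlag processes\<close>

definition time_integral ::
  "(real \<Rightarrow> 'w \<Rightarrow> 'a) \<Rightarrow> ('a \<Rightarrow> real) \<Rightarrow> real \<Rightarrow> real \<Rightarrow> 'w \<Rightarrow> real" where
  "time_integral Y k a b \<omega> = (LINT s:{a..b}|lborel. k (Y s \<omega>))"

lemma time_average_eq: "time_average Y f T \<omega> = (1 / T) * time_integral Y f 0 T \<omega>"
  by (simp add: time_average_def time_integral_def)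

lemma cadlag_on_subset:
  assumes w: "cadlag_on I w" and "J \<subseteq> I" and eq: "\<And>t. t \<in> J \<Longrightarrow> w' t = w t"
  shows "cadlag_on J w'"
  unfolding cadlag_on_def
proof (intro ballI conjI)
  fix t assume t: "t \<in> J"
  have "(w \<longlongrightarrow> w t) (at t within I \<inter> {t..})"
    using w t \<open>J \<subseteq> I\<close> by (auto simp: cadlag_on_def continuous_within)
  then have "(w \<longlongrightarrow> w t) (at t within J \<inter> {t..})"
    by (rule tendsto_within_subset) (use \<open>J \<subseteq> I\<close> in auto)
  then have "(w' \<longlongrightarrow> w t) (at t within J \<inter> {t..})"
    by (rule Lim_transform_eventually) (auto simp: eventually_at_filter eq)
  then show "continuous (at t within J \<inter> {t..}) w'"
    using eq[OF t] by (simp add: continuous_within)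
  obtain l where "(w \<longlongrightarrow> l) (at t within I \<inter> {..<t})"
    using w t \<open>J \<subseteq> I\<close> by (auto simp: cadlag_on_def)
  then have "(w \<longlongrightarrow> l) (at t within J \<inter> {..<t})"
    by (rule tendsto_within_subset) (use \<open>J \<subseteq> I\<close> in auto)
  then have "(w' \<longlongrightarrow> l) (at t within J \<inter> {..<t})"
    by (rule Lim_transform_eventually) (auto simp: eventually_at_filter eq)
  then show "\<exists>l. (w' \<longlongrightarrow> l) (at t within J \<inter> {..<t})" ..
qed

locale cadlag_on_measurable_space =
  fixes N :: "'v measure" and I :: "real set" and Y :: "real \<Rightarrow> 'v \<Rightarrow> 'a::polish_space"
  assumes Y_measurable: "\<And>t. t \<in> I \<Longrightarrow> Y t \<in> N \<rightarrow>\<^sub>M borel"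
    and Y_cadlag: "\<And>\<omega>. \<omega> \<in> space N \<Longrightarrow> cadlag_on I (\<lambda>t. Y t \<omega>)"
begin

lemma Y_right_limit:
  assumes "\<omega> \<in> space N" "t \<in> I" "s \<longlonglongrightarrow> t" "\<And>n. s n \<in> I" "\<And>n. t \<le> s n"
  shows "(\<lambda>n. Y (s n) \<omega>) \<longlonglongrightarrow> Y t \<omega>"
proof -
  have "continuous (at t within I \<inter> {t..}) (\<lambda>t. Y t \<omega>)"
    using Y_cadlag[OF assms(1)] assms(2) by (auto simp: cadlag_on_def)
  then show ?thesis
    using assms unfolding continuous_within_sequentially by (auto simp: o_def)
qed

text \<open>Approximating time from the right by a grid makes the process a countable gluing of random
  variables, and right continuity passes joint measurability to the limit.\<close>

lemma jointly_measurable: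
  assumes "a \<le> b" "{a..b} \<subseteq> I"
  shows "(\<lambda>(\<omega>, s). Y (max a (min b s)) \<omega>) \<in> N \<Otimes>\<^sub>M borel \<rightarrow>\<^sub>M borel"
proof (rule borel_measurable_LIMSEQ_metric)
  define r where "r n s = (\<lceil>real (Suc n) * max a (min b s)\<rceil>)" for n s
  define q where "q n i = max a (min b (real_of_int i / real (Suc n)))" for n and i :: int
  define F where "F n = (\<lambda>p. Y (q n (r n (snd p))) (fst p))" for n and p :: "'v \<times> real"
  have I: "max a (min b s) \<in> I" for s using assms by auto
  have q: "q n i \<in> I" for n i unfolding q_def by (rule I)
  show "F n \<in> N \<Otimes>\<^sub>M borel \<rightarrow>\<^sub>M borel" for n
    unfolding F_def
  proof (rule measurable_compose_countable)
    show "(\<lambda>p. Y (q n i) (fst p)) \<in> N \<Otimes>\<^sub>M borel \<rightarrow>\<^sub>M borel" for i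
      by (rule measurable_compose[OF measurable_fst Y_measurable[OF q]])
    show "(\<lambda>p. r n (snd p)) \<in> N \<Otimes>\<^sub>M borel \<rightarrow>\<^sub>M count_space UNIV"
      unfolding r_def by measurable
  qed
  fix p assume "p \<in> space (N \<Otimes>\<^sub>M (borel :: real measure))"
  then obtain \<omega> s where p: "p = (\<omega>, s)" "\<omega> \<in> space N" by (auto simp: space_pair_measure)
  define t where "t = max a (min b s)"
  have t: "a \<le> t" "t \<le> b" using assms by (auto simp: t_def)
  have up: "t \<le> real_of_int (r n s) / real (Suc n)" for n
  proof -
    have "real (Suc n) * t \<le> real_of_int (r n s)" unfolding r_def t_def by (rule le_of_int_ceiling)
    then show ?thesis by (simp add: pos_le_divide_eq mult.commute)
  qed
  have down: "real_of_int (r n s) / real (Suc n) \<le> t + 1 / real (Suc n)" for n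
  proof -
    have "real_of_int (r n s) \<le> real (Suc n) * t + 1" unfolding r_def t_def by linarith
    then have "real_of_int (r n s) / real (Suc n) \<le> (real (Suc n) * t + 1) / real (Suc n)"
      by (rule divide_right_mono) simp
    then show ?thesis by (simp add: add_divide_distrib)
  qed
  have "(\<lambda>n. q n (r n s)) \<longlonglongrightarrow> t"
  proof (rule tendsto_sandwich[OF _ _ tendsto_const])
    show "\<forall>\<^sub>F n in sequentially. t \<le> q n (r n s)"
      using up t by (auto simp: q_def le_max_iff_disj intro!: always_eventually)
    show "\<forall>\<^sub>F n in sequentially. q n (r n s) \<le> t + 1 / real (Suc n)"
      using down t by (auto simp: q_def intro!: always_eventually simp: min_le_iff_disj add_increasing2)
    show "(\<lambda>n. t + 1 / real (Suc n)) \<longlonglongrightarrow> t"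
      using tendsto_add[OF tendsto_const LIMSEQ_Suc[OF lim_const_over_n], of t 1] by simp
  qed
  then have "(\<lambda>n. Y (q n (r n s)) \<omega>) \<longlonglongrightarrow> Y t \<omega>"
    using p(2) I[of s] q up t by (intro Y_right_limit) (auto simp: t_def[symmetric] q_def le_max_iff_disj)
  then show "(\<lambda>n. F n p) \<longlonglongrightarrow> (case p of (\<omega>, s) \<Rightarrow> Y (max a (min b s)) \<omega>)"
    by (simp add: F_def p t_def)
qed

lemma time_integral_eq:
  "time_integral Y k a b \<omega> = (\<integral>s. indicator {a..b} s * k (Y (max a (min b s)) \<omega>) \<partial>lborel)"
  unfolding time_integral_def set_lebesgue_integral_def
  by (intro Bochner_Integration.integral_cong) (auto simp: indicator_def)

lemma measurable_jointly_observed: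
  assumes [measurable]: "k \<in> borel_measurable borel" and ab: "a \<le> b" "{a..b} \<subseteq> I"
  shows "(\<lambda>(\<omega>, s). k (Y (max a (min b s)) \<omega>)) \<in> borel_measurable (N \<Otimes>\<^sub>M borel)"
  using measurable_compose[OF jointly_measurable[OF ab] assms(1)] by (simp add: case_prod_beta')

lemma time_integral_measurable:
  assumes [measurable]: "k \<in> borel_measurable borel" and I: "{a..b} \<subseteq> I"
  shows "time_integral Y k a b \<in> borel_measurable N"
proof (cases "a \<le> b")
  case True
  note [measurable] = measurable_jointly_observed[OF assms(1) True I]
  have "(\<lambda>\<omega>. \<integral>s. indicator {a..b} s * k (Y (max a (min b s)) \<omega>) \<partial>lborel) \<in> borel_measurable N"
    by measurable
  then show ?thesis by (simp add: time_integral_eq[abs_def])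
next
  case False
  then show ?thesis by (simp add: time_integral_def[abs_def] set_lebesgue_integral_def)
qed

lemma set_integrable_observed:
  fixes K :: real
  assumes k: "k \<in> borel_measurable borel" "\<And>x. \<bar>k x\<bar> \<le> K" and I: "{a..b} \<subseteq> I" and "\<omega> \<in> space N"
  shows "set_integrable lborel {a..b} (\<lambda>s. k (Y s \<omega>))"
proof (cases "a \<le> b")
  case True
  have "(\<lambda>s. k (Y (max a (min b s)) \<omega>)) \<in> borel_measurable borel"
    using measurable_Pair2[OF measurable_jointly_observed[OF k(1) True I] assms(4)] by simp
  then have "set_integrable lborel {a..b} (\<lambda>s. k (Y (max a (min b s)) \<omega>))"
    unfolding set_integrable_def
    using k(2) True by (intro integrableI_bounded_set_indicator[where B=K]) auto
  then show ?thesis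
    by (rule set_integrable_cong[THEN iffD1, rotated 3]) auto
qed (simp add: set_integrable_def)

lemma time_integral_bound:
  fixes K :: real
  assumes k: "k \<in> borel_measurable borel" "\<And>x. \<bar>k x\<bar> \<le> K" and "a \<le> b" "{a..b} \<subseteq> I"
    and "\<omega> \<in> space N"
  shows "\<bar>time_integral Y k a b \<omega>\<bar> \<le> K * (b - a)"
proof -
  have "\<bar>time_integral Y k a b \<omega>\<bar> \<le> (LINT s:{a..b}|lborel. \<bar>k (Y s \<omega>)\<bar>)"
    unfolding time_integral_def
    using set_integral_norm_bound[OF set_integrable_observed[OF k assms(4,5)]] by simp
  also have "\<dots> \<le> (LINT s:{a..b}|lborel. K)"
  proof (rule set_integral_mono)
    show "set_integrable lborel {a..b} (\<lambda>s. \<bar>k (Y s \<omega>)\<bar>)"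
      using set_integrable_norm[OF set_integrable_observed[OF k assms(4,5)]] by simp
    show "set_integrable lborel {a..b} (\<lambda>s. K)"
      unfolding set_integrable_def by (intro integrableI_bounded_set_indicator[where B="\<bar>K\<bar>"]) (use assms(3) in auto)
  qed (use k(2) in auto)
  also have "\<dots> = K * (b - a)"
    using assms(3) by (simp add: set_lebesgue_integral_def mult.commute)
  finally show ?thesis .
qed

lemma time_integral_split:
  fixes K :: real
  assumes k: "k \<in> borel_measurable borel" "\<And>x. \<bar>k x\<bar> \<le> K" and "a \<le> r" "r \<le> b" "{a..b} \<subseteq> I"
    and "\<omega> \<in> space N"
  shows "time_integral Y k a b \<omega> = time_integral Y k a r \<omega> + time_integral Y k r b \<omega>"
proof -
  have 1: "set_integrable lborel {a..r} (\<lambda>s. k (Y s \<omega>))" "set_integrable lborel {r<..b} (\<lambda>s. k (Y s \<omega>))"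
    using set_integrable_observed[OF k assms(5,6)] assms(3,4)
    by (auto intro: set_integrable_subset)
  have "{a..r} \<inter> {r<..b} = {}" by auto
  note un = set_integral_Un[OF this 1]
  have "{a..b} = {a..r} \<union> {r<..b}" using assms by auto
  then have "time_integral Y k a b \<omega> = time_integral Y k a r \<omega> + (LINT s:{r<..b}|lborel. k (Y s \<omega>))"
    unfolding time_integral_def by (simp add: un)
  also have "(LINT s:{r<..b}|lborel. k (Y s \<omega>)) = time_integral Y k r b \<omega>"
    unfolding time_integral_def set_lebesgue_integral_def
  proof (rule integral_discrete_difference[where X="{r}"])
    show "\<And>x. x \<in> space lborel \<Longrightarrow> x \<notin> {r} \<Longrightarrow>
      indicat_real {r<..b} x *\<^sub>R k (Y x \<omega>) = indicat_real {r..b} x *\<^sub>R k (Y x \<omega>)"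
      by (auto simp: indicator_def)
  qed auto
  finally show ?thesis .
qed

lemma path_measurable:
  assumes "{0..T} \<subseteq> I"
  shows "(\<lambda>\<omega>. restrict (\<lambda>t. Y t \<omega>) {0..T}) \<in> N \<rightarrow>\<^sub>M cadlag_paths T"
  unfolding cadlag_paths_def
proof (rule measurable_restrict_space2)
  show "(\<lambda>\<omega>. restrict (\<lambda>t. Y t \<omega>) {0..T}) \<in> space N \<rightarrow> {w. cadlag_on {0..T} w}"
    using cadlag_on_subset[OF Y_cadlag assms] by auto
  show "(\<lambda>\<omega>. restrict (\<lambda>t. Y t \<omega>) {0..T}) \<in> N \<rightarrow>\<^sub>M PiM {0..T} (\<lambda>_. borel)"
    using assms by (intro measurable_restrict Y_measurable) auto
qed

end

text \<open>The coordinate process on path space is itself a cadlag process, so time integrals are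
  measurable functionals of the path.\<close>

lemma coordinate_process:
  "cadlag_on_measurable_space (cadlag_paths T) {0..T} (\<lambda>t w. w t :: 'a::polish_space)"
proof
  show "(\<lambda>w. w t) \<in> cadlag_paths T \<rightarrow>\<^sub>M borel" if "t \<in> {0..T}" for t
    unfolding cadlag_paths_def using that
    by (intro measurable_restrict_space1 measurable_component_singleton)
  show "cadlag_on {0..T} w" if "w \<in> space (cadlag_paths T)" for w :: "real \<Rightarrow> 'a"
    using that by (auto simp: cadlag_paths_def space_restrict_space)
qed

lemma time_integral_restrict:
  "time_integral (\<lambda>t w. w t) k 0 T (restrict (\<lambda>t. Y t \<omega>) {0..T}) = time_integral Y k 0 T \<omega>"
  unfolding time_integral_def by (intro set_lebesgue_integral_cong) auto

section \<open>The Markov property on path space\<close>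

context cadlag_markov_family
begin

lemma P_measurable [measurable]: "P \<in> borel \<rightarrow>\<^sub>M prob_algebra M" by (rule kernel)

lemma P_subprob [measurable]: "P \<in> borel \<rightarrow>\<^sub>M subprob_algebra M"
  by (rule measurable_prob_algebraD[OF kernel])

lemma prob_space_P: "prob_space (P x)"
  and sets_P [simp, measurable_cong]: "sets (P x) = sets M"
  using measurable_space[OF kernel, of x] by (auto simp: space_prob_algebra)

lemma space_P [simp]: "space (P x) = space M"
  by (rule sets_eq_imp_space_eq) simp

lemma space_nonempty: "space M \<noteq> {}"
  using prob_space.not_empty[OF prob_space_P] by simp

sublocale X: cadlag_on_measurable_space M "{0..}" X
  by standard (auto intro: measurable_X cadlag_X)

lemma measurable_X_P [measurable]: "0 \<le> t \<Longrightarrow> X t \<in> P x \<rightarrow>\<^sub>M borel"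
  using measurable_X by (simp cong: measurable_cong_sets)

lemma natural_filtration_sets:
  "sets (natural_filtration M X s) = sigma_sets (space M)
     (\<Union>u\<in>{0..s}. {X u -` B \<inter> space M | B. B \<in> sets borel})"
  unfolding natural_filtration_def by (rule sets_measure_of) auto

lemma natural_filtration_I:
  "\<lbrakk>0 \<le> u; u \<le> s; B \<in> sets borel\<rbrakk> \<Longrightarrow> X u -` B \<inter> space M \<in> sets (natural_filtration M X s)"
  unfolding natural_filtration_sets by (intro sigma_sets.Basic UN_I[of u]) auto

lemma natural_filtration_mono:
  "s \<le> t \<Longrightarrow> sets (natural_filtration M X s) \<subseteq> sets (natural_filtration M X t)"
  unfolding natural_filtration_sets by (intro sigma_sets_mono') fastforce

lemma space_natural_filtration [simp]: "space (natural_filtration M X s) = space M"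
  unfolding natural_filtration_def by (rule space_measure_of) auto

lemma natural_filtration_le: "sets (natural_filtration M X s) \<subseteq> sets M"
  unfolding natural_filtration_sets
proof (rule sets.sigma_sets_subset, safe)
  fix u B assume "u \<in> {0..s}" "B \<in> sets (borel :: 'a measure)"
  then show "X u -` B \<inter> space M \<in> sets M" by (intro measurable_sets[OF measurable_X]) auto
qed

text \<open>The defining property speaks of indicators; a monotone class argument extends it.\<close>

lemma markov_nn_integral:
  assumes A: "A \<in> sets (natural_filtration M X s)" and s: "0 \<le> s" and t: "0 \<le> t"
    and \<phi>: "\<phi> \<in> borel_measurable borel"
  shows "(\<integral>\<^sup>+\<omega>. indicator A \<omega> * \<phi> (X (s + t) \<omega>) \<partial>P x) =
    (\<integral>\<^sup>+\<omega>. indicator A \<omega> * (\<integral>\<^sup>+\<omega>'. \<phi> (X t \<omega>') \<partial>P (X s \<omega>)) \<partial>P x)"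
  using \<phi>
proof (induction \<phi> rule: borel_measurable_induct)
  note [measurable] = measurable_X[OF s] measurable_X[OF t] measurable_X[OF add_nonneg_nonneg[OF s t]]
  have A'[measurable]: "A \<in> sets M" using A natural_filtration_le by auto
  note Pc = measurable_compose[OF measurable_X[OF s] P_subprob]
  have inner[measurable]: "(\<lambda>\<omega>. \<integral>\<^sup>+\<omega>'. \<phi> (X t \<omega>') \<partial>P (X s \<omega>)) \<in> borel_measurable M"
    if [measurable]: "\<phi> \<in> borel_measurable borel" for \<phi> :: "'a \<Rightarrow> ennreal"
    by (rule measurable_compose[OF Pc nn_integral_measurable_subprob_algebra]) measurable
  {
    case (cong f g) then show ?case by simp
  next
    case (set B)
    interpret prob_space "P x" by (rule prob_space_P)
    interpret S: finite_measure_subalgebra "P x" "natural_filtration M X s"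
      by standard (use natural_filtration_le in \<open>auto simp: subalgebra_def\<close>)
    define E where "E = {\<omega> \<in> space M. X (s + t) \<omega> \<in> B}"
    define q where "q \<omega> = measure (P (X s \<omega>)) {\<omega>' \<in> space M. X t \<omega>' \<in> B}" for \<omega>
    have [measurable]: "E \<in> sets M" "B \<in> sets borel" unfolding E_def using set by measurable
    have Et: "{\<omega>' \<in> space M. X t \<omega>' \<in> B} \<in> sets M" by measurable
    have q[measurable]: "q \<in> borel_measurable M"
      unfolding q_def by (rule measurable_compose[OF Pc measurable_measure_subprob_algebra[OF Et]])
    have q1: "0 \<le> q \<omega>" "q \<omega> \<le> 1" for \<omega>
      unfolding q_def using prob_space.prob_le_1[OF prob_space_P] by auto
    have eq: "(\<integral>\<omega>\<in>A. indicator E \<omega> \<partial>P x) = (\<integral>\<omega>\<in>A. q \<omega> \<partial>P x)"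
    proof -
      have "(\<integral>\<omega>\<in>A. indicator E \<omega> \<partial>P x)
          = (\<integral>\<omega>\<in>A. real_cond_exp (P x) (natural_filtration M X s) (indicator E) \<omega> \<partial>P x)"
        using A by (intro S.real_cond_exp_intA) (auto intro!: integrable_const_bound[where B=1])
      also have "\<dots> = (\<integral>\<omega>\<in>A. q \<omega> \<partial>P x)"
        unfolding set_lebesgue_integral_def
        using markov[OF s t set, of x] unfolding E_def[symmetric] q_def[symmetric]
        by (intro integral_cong_AE) (auto elim: eventually_mono)
      finally show ?thesis .
    qed
    have "(\<integral>\<^sup>+\<omega>. indicator A \<omega> * indicator B (X (s + t) \<omega>) \<partial>P x)
        = (\<integral>\<^sup>+\<omega>. ennreal (indicator A \<omega> * indicator E \<omega>) \<partial>P x)"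
      by (intro nn_integral_cong) (auto simp: E_def indicator_def)
    also have "\<dots> = ennreal (\<integral>\<omega>\<in>A. indicator E \<omega> \<partial>P x)"
      unfolding set_lebesgue_integral_def real_scaleR_def
      by (intro nn_integral_eq_integral integrable_const_bound[where B=1]) (auto simp: indicator_def)
    also have "\<dots> = (\<integral>\<^sup>+\<omega>. ennreal (indicator A \<omega> * q \<omega>) \<partial>P x)"
      using q1 unfolding eq unfolding set_lebesgue_integral_def real_scaleR_def
      by (intro nn_integral_eq_integral[symmetric] integrable_const_bound[where B=1])
         (auto simp: indicator_def)
    also have "\<dots> = (\<integral>\<^sup>+\<omega>. indicator A \<omega> * (\<integral>\<^sup>+\<omega>'. indicator B (X t \<omega>') \<partial>P (X s \<omega>)) \<partial>P x)"
    proof (intro nn_integral_cong)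
      fix \<omega>
      have "(\<integral>\<^sup>+\<omega>'. indicator B (X t \<omega>') \<partial>P (X s \<omega>))
          = (\<integral>\<^sup>+\<omega>'. indicator {\<omega>' \<in> space M. X t \<omega>' \<in> B} \<omega>' \<partial>P (X s \<omega>))"
        by (intro nn_integral_cong) (auto simp: indicator_def)
      also have "\<dots> = ennreal (q \<omega>)"
        using finite_measure.emeasure_eq_measure[OF prob_space.finite_measure[OF prob_space_P]] Et
        by (simp add: q_def)
      finally show "ennreal (indicator A \<omega> * q \<omega>) = indicator A \<omega> * (\<integral>\<^sup>+\<omega>'. indicator B (X t \<omega>') \<partial>P (X s \<omega>))"
        by (auto simp: indicator_def)
    qed
    finally show ?case .
  next
    case (mult u c)
    note [measurable] = mult(2)
    have "(\<integral>\<^sup>+\<omega>. indicator A \<omega> * (c * u (X (s + t) \<omega>)) \<partial>P x) = c * (\<integral>\<^sup>+\<omega>. indicator A \<omega> * u (X (s + t) \<omega>) \<partial>P x)"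
      by (subst nn_integral_cmult[symmetric]) (auto simp: mult_ac)
    also have "\<dots> = (\<integral>\<^sup>+\<omega>. c * (indicator A \<omega> * (\<integral>\<^sup>+\<omega>'. u (X t \<omega>') \<partial>P (X s \<omega>))) \<partial>P x)"
      unfolding mult.IH by (subst nn_integral_cmult) auto
    finally show ?case by (simp add: nn_integral_cmult mult_ac)
  next
    case (add u v)
    note [measurable] = add(1,3)
    show ?case
      using add.IH by (simp add: nn_integral_add distrib_left)
  next
    case (seq U)
    note [measurable] = seq(1)
    have inc: "incseq (\<lambda>i. c * U i y)" for c :: ennreal and y
      using seq(3) by (auto simp: incseq_def le_fun_def intro: mult_left_mono)
    have "(\<integral>\<^sup>+\<omega>. indicator A \<omega> * (SUP i. U i) (X (s + t) \<omega>) \<partial>P x)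
        = (\<integral>\<^sup>+\<omega>. (SUP i. indicator A \<omega> * U i (X (s + t) \<omega>)) \<partial>P x)"
      by (simp add: SUP_mult_left_ennreal image_comp)
    also have "\<dots> = (SUP i. \<integral>\<^sup>+\<omega>. indicator A \<omega> * U i (X (s + t) \<omega>) \<partial>P x)"
      using seq(3) by (intro nn_integral_monotone_convergence_SUP)
        (auto simp: incseq_def le_fun_def intro!: mult_left_mono)
    also have "\<dots> = (SUP i. \<integral>\<^sup>+\<omega>. indicator A \<omega> * (\<integral>\<^sup>+\<omega>'. U i (X t \<omega>') \<partial>P (X s \<omega>)) \<partial>P x)"
      using seq.IH by simp
    also have "\<dots> = (\<integral>\<^sup>+\<omega>. (SUP i. indicator A \<omega> * (\<integral>\<^sup>+\<omega>'. U i (X t \<omega>') \<partial>P (X s \<omega>))) \<partial>P x)"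
      using seq(3) by (intro nn_integral_monotone_convergence_SUP[symmetric])
        (auto simp: incseq_def le_fun_def intro!: mult_left_mono nn_integral_mono)
    also have "\<dots> = (\<integral>\<^sup>+\<omega>. indicator A \<omega> * (\<integral>\<^sup>+\<omega>'. (SUP i. U i) (X t \<omega>') \<partial>P (X s \<omega>)) \<partial>P x)"
    proof (intro nn_integral_cong)
      fix \<omega>
      have "(\<integral>\<^sup>+\<omega>'. (SUP i. U i) (X t \<omega>') \<partial>P (X s \<omega>)) = (SUP i. \<integral>\<^sup>+\<omega>'. U i (X t \<omega>') \<partial>P (X s \<omega>))"
        using seq(3) by (subst nn_integral_monotone_convergence_SUP[symmetric])
          (auto simp: incseq_def le_fun_def image_comp)
      then show "(SUP i. indicator A \<omega> * (\<integral>\<^sup>+\<omega>'. U i (X t \<omega>') \<partial>P (X s \<omega>)))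
          = indicator A \<omega> * (\<integral>\<^sup>+\<omega>'. (SUP i. U i) (X t \<omega>') \<partial>P (X s \<omega>))"
        by (simp add: SUP_mult_left_ennreal)
    qed
    finally show ?case .
  }
qed

text \<open>The transition kernels of the finite dimensional distributions, iterated along a list of pairs
  \<open>(t, B)\<close> ordered by time. Carrying the current time \<open>s\<close> as an argument lets an induction
  over the list use the Markov property one time gap after the other.\<close>

primrec visit_prob :: "(real \<times> 'a set) list \<Rightarrow> real \<Rightarrow> 'a \<Rightarrow> ennreal" where
  "visit_prob [] s x = 1"
| "visit_prob (p # l) s x = (\<integral>\<^sup>+\<omega>. indicator (snd p) (X (fst p - s) \<omega>) *
     visit_prob l (fst p) (X (fst p - s) \<omega>) \<partial>P x)"

lemma visit_prob_measurable:
  "\<lbrakk>sorted (s # map fst l); \<And>p. p \<in> set l \<Longrightarrow> snd p \<in> sets borel\<rbrakk> \<Longrightarrow> visit_prob l s \<in> borel_measurable borel"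
proof (induction l arbitrary: s)
  case Nil
  then show ?case by simp
next
  case (Cons p l)
  have [measurable]: "visit_prob l (fst p) \<in> borel_measurable borel" "snd p \<in> sets borel"
    using Cons by auto
  have [measurable]: "X (fst p - s) \<in> M \<rightarrow>\<^sub>M borel" using Cons by (intro measurable_X) auto
  have "(\<lambda>x. \<integral>\<^sup>+\<omega>. indicator (snd p) (X (fst p - s) \<omega>) * visit_prob l (fst p) (X (fst p - s) \<omega>) \<partial>P x)
      \<in> borel_measurable borel"
    by (rule measurable_compose[OF P_subprob nn_integral_measurable_subprob_algebra]) measurable
  then show ?case by simp
qed

text \<open>The event \<open>A\<close> of the past has to be arbitrary: the induction merges the first visit into it and
  moves on to the time of that visit.\<close>

lemma nn_integral_visits:
  "\<lbrakk>sorted (s # map fst l); \<And>p. p \<in> set l \<Longrightarrow> snd p \<in> sets borel; 0 \<le> s; 0 \<le> h;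
     A \<in> sets (natural_filtration M X (h + s))\<rbrakk> \<Longrightarrow>
   (\<integral>\<^sup>+\<omega>. indicator A \<omega> * prod_list (map (\<lambda>p. indicator (snd p) (X (h + fst p) \<omega>)) l) \<partial>P x)
     = (\<integral>\<^sup>+\<omega>. indicator A \<omega> * visit_prob l s (X (h + s) \<omega>) \<partial>P x)"
proof (induction l arbitrary: s A)
  case Nil
  then show ?case by simp
next
  case (Cons p l)
  define t B where "t = fst p" and "B = snd p"
  have t: "s \<le> t" "0 \<le> t" and B: "B \<in> sets borel" and srt: "sorted (t # map fst l)"
    using Cons.prems by (auto simp: t_def B_def)
  define A' where "A' = A \<inter> (X (h + t) -` B \<inter> space M)"
  have A': "A' \<in> sets (natural_filtration M X (h + t))"
    unfolding A'_def using Cons.prems(4,5) t B natural_filtration_mono[of "h + s" "h + t"]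
    by (intro sets.Int natural_filtration_I) auto
  have ind: "indicator A \<omega> * (indicator B (X (h + t) \<omega>) * z) = indicator A' \<omega> * z"
    if "\<omega> \<in> space M" for \<omega> and z :: ennreal
    using that by (auto simp: A'_def indicator_def)
  have "visit_prob l t \<in> borel_measurable borel"
    using srt Cons.prems(2) by (intro visit_prob_measurable) auto
  then have m: "(\<lambda>y. indicator B y * visit_prob l t y) \<in> borel_measurable borel" using B by simp
  have "(\<integral>\<^sup>+\<omega>. indicator A \<omega> * prod_list (map (\<lambda>p. indicator (snd p) (X (h + fst p) \<omega>)) (p # l)) \<partial>P x)
      = (\<integral>\<^sup>+\<omega>. indicator A' \<omega> * prod_list (map (\<lambda>p. indicator (snd p) (X (h + fst p) \<omega>)) l) \<partial>P x)"
    by (intro nn_integral_cong) (simp add: ind flip: t_def B_def)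
  also have "\<dots> = (\<integral>\<^sup>+\<omega>. indicator A' \<omega> * visit_prob l t (X (h + t) \<omega>) \<partial>P x)"
    using srt Cons.prems t A' by (intro Cons.IH) auto
  also have "\<dots> = (\<integral>\<^sup>+\<omega>. indicator A \<omega> * (indicator B (X ((h + s) + (t - s)) \<omega>) * visit_prob l t (X ((h + s) + (t - s)) \<omega>)) \<partial>P x)"
    by (intro nn_integral_cong) (simp add: ind)
  also have "\<dots> = (\<integral>\<^sup>+\<omega>. indicator A \<omega> * (\<integral>\<^sup>+\<omega>'. indicator B (X (t - s) \<omega>') * visit_prob l t (X (t - s) \<omega>') \<partial>P (X (h + s) \<omega>)) \<partial>P x)"
    using Cons.prems t by (intro markov_nn_integral[OF _ _ _ m]) auto
  finally show ?case by (simp add: t_def B_def)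
qed

lemma finite_dimensional_shift:
  assumes J: "finite J" "J \<subseteq> {0..}" and B: "\<And>j. j \<in> J \<Longrightarrow> B j \<in> sets borel" and h: "0 \<le> h"
  shows "(\<integral>\<^sup>+\<omega>. (\<Prod>j\<in>J. indicator (B j) (X (h + j) \<omega>)) \<partial>P x)
    = (\<integral>\<^sup>+\<omega>. (\<integral>\<^sup>+\<omega>'. (\<Prod>j\<in>J. indicator (B j) (X j \<omega>')) \<partial>P (X h \<omega>)) \<partial>P x)"
proof -
  define l where "l = map (\<lambda>j. (j, B j)) (sorted_list_of_set J)"
  have srt: "sorted (0 # map fst l)" and Bl: "\<And>p. p \<in> set l \<Longrightarrow> snd p \<in> sets borel"
    using J B by (auto simp: l_def o_def)
  have prod: "(\<Prod>j\<in>J. indicator (B j) (X (h + j) \<omega>) :: ennreal) =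
      prod_list (map (\<lambda>p. indicator (snd p) (X (h + fst p) \<omega>)) l)" for h \<omega>
    using J(1) prod.distinct_set_conv_list[of "sorted_list_of_set J" "\<lambda>j. indicator (B j) (X (h + j) \<omega>) :: ennreal"]
    by (simp add: l_def o_def)
  have visits: "(\<integral>\<^sup>+\<omega>. (\<Prod>j\<in>J. indicator (B j) (X (h + j) \<omega>)) \<partial>P x)
      = (\<integral>\<^sup>+\<omega>. visit_prob l 0 (X h \<omega>) \<partial>P x)" if "0 \<le> h" for h x
  proof -
    have "space M \<in> sets (natural_filtration M X (h + 0))"
      using sets.top[of "natural_filtration M X (h + 0)"] by simp
    from nn_integral_visits[OF srt Bl _ that this, of x]
    have "(\<integral>\<^sup>+\<omega>. indicator (space M) \<omega> * (\<Prod>j\<in>J. indicator (B j) (X (h + j) \<omega>)) \<partial>P x)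
      = (\<integral>\<^sup>+\<omega>. indicator (space M) \<omega> * visit_prob l 0 (X h \<omega>) \<partial>P x)" by (simp add: prod)
    then show ?thesis by (simp cong: nn_integral_cong_simp)
  qed
  have "(\<integral>\<^sup>+\<omega>'. (\<Prod>j\<in>J. indicator (B j) (X j \<omega>')) \<partial>P y) = visit_prob l 0 y" for y
  proof -
    have "(\<integral>\<^sup>+\<omega>'. (\<Prod>j\<in>J. indicator (B j) (X j \<omega>')) \<partial>P y) = (\<integral>\<^sup>+\<omega>. visit_prob l 0 (X 0 \<omega>) \<partial>P y)"
      using visits[of 0 y] by simp
    also have "\<dots> = (\<integral>\<^sup>+\<omega>. visit_prob l 0 y \<partial>P y)"
      using start[of y] by (intro nn_integral_cong_AE) (auto elim: eventually_mono)
    also have "\<dots> = visit_prob l 0 y" using prob_space.emeasure_space_1[OF prob_space_P, of y] by simp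
    finally show ?thesis .
  qed
  then show ?thesis using visits[OF h] by simp
qed

lemma path_law_measurable:
  "(\<lambda>y. path_law T (P y) X) \<in> borel \<rightarrow>\<^sub>M subprob_algebra (cadlag_paths T)"
proof -
  have "(\<lambda>y. distr (P y) (cadlag_paths T) (\<lambda>\<omega>. restrict (\<lambda>t. X t \<omega>) {0..T}))
      \<in> borel \<rightarrow>\<^sub>M subprob_algebra (cadlag_paths T)"
    by (rule measurable_compose[OF P_subprob measurable_distr[OF X.path_measurable]]) auto
  then show ?thesis by (simp add: path_law_def)
qed

lemma shifted_path_measurable:
  assumes "0 \<le> h"
  shows "(\<lambda>\<omega>. restrict (\<lambda>t. X (h + t) \<omega>) {0..T}) \<in> M \<rightarrow>\<^sub>M cadlag_paths T"
proof -
  have "cadlag_on_measurable_space M {0..} (\<lambda>t. X (h + t))"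
  proof
    show "X (h + t) \<in> M \<rightarrow>\<^sub>M borel" if "t \<in> {0..}" for t
      using that assms by (intro measurable_X) auto
    fix \<omega> assume \<omega>: "\<omega> \<in> space M"
    show "cadlag_on {0..} (\<lambda>t. X (h + t) \<omega>)"
      unfolding cadlag_on_def
    proof (intro ballI conjI)
      fix t :: real assume t: "t \<in> {0..}"
      have c: "cadlag_on {0..} (\<lambda>t. X t \<omega>)" by (rule cadlag_X[OF \<omega>])
      have "((\<lambda>t. X t \<omega>) \<longlongrightarrow> X (h + t) \<omega>) (at (h + t) within {0..} \<inter> {h + t..})"
        using c t assms by (auto simp: cadlag_on_def continuous_within)
      moreover have "filterlim (\<lambda>t. h + t) (at (h + t) within {0..} \<inter> {h + t..}) (at t within {0..} \<inter> {t..})"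
        unfolding filterlim_at using assms
        by (auto simp: eventually_at_filter intro!: tendsto_intros always_eventually)
      ultimately have "((\<lambda>t. X (h + t) \<omega>) \<longlongrightarrow> X (h + t) \<omega>) (at t within {0..} \<inter> {t..})"
        by (rule filterlim_compose)
      then show "continuous (at t within {0..} \<inter> {t..}) (\<lambda>t. X (h + t) \<omega>)"
        by (simp add: continuous_within)
      obtain l where "((\<lambda>t. X t \<omega>) \<longlongrightarrow> l) (at (h + t) within {0..} \<inter> {..<h + t})"
        using bspec[OF c[unfolded cadlag_on_def], of "h + t"] t assms by auto
      moreover have "filterlim (\<lambda>t. h + t) (at (h + t) within {0..} \<inter> {..<h + t}) (at t within {0..} \<inter> {..<t})"
        unfolding filterlim_at using assms
        by (auto simp: eventually_at_filter intro!: tendsto_intros always_eventually)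
      ultimately show "\<exists>l. ((\<lambda>t. X (h + t) \<omega>) \<longlongrightarrow> l) (at t within {0..} \<inter> {..<t})"
        using filterlim_compose by blast
    qed
  qed
  then interpret shift: cadlag_on_measurable_space M "{0..}" "\<lambda>t. X (h + t)" .
  show ?thesis by (rule shift.path_measurable) auto
qed

text \<open>The Markov property for whole path segments: both sides are laws on path space with the
  same finite dimensional distributions.\<close>

lemma path_law_shift:
  assumes h: "0 \<le> h"
  shows "path_law T (P x) (\<lambda>t. X (h + t)) = P x \<bind> (\<lambda>\<omega>. path_law T (P (X h \<omega>)) X)"
    (is "?L = ?R")
proof (rule measure_eqI)
  let ?S = "\<lambda>\<omega>. restrict (\<lambda>t. X (h + t) \<omega>) {0..T}" and ?Q = "\<lambda>\<omega>. restrict (\<lambda>t. X t \<omega>) {0..T}"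
  let ?PM = "PiM {0..T} (\<lambda>_. borel) :: (real \<Rightarrow> 'a) measure"
  interpret prob_space "P x" by (rule prob_space_P)
  have S: "?S \<in> P x \<rightarrow>\<^sub>M cadlag_paths T" using shifted_path_measurable[OF h] by (simp cong: measurable_cong_sets)
  have Q: "?Q \<in> P y \<rightarrow>\<^sub>M cadlag_paths T" for y using X.path_measurable[of T] by (simp cong: measurable_cong_sets)
  have incl: "(\<lambda>w. w) \<in> cadlag_paths T \<rightarrow>\<^sub>M ?PM"
    unfolding cadlag_paths_def by (rule measurable_restrict_space1) simp
  note S' = measurable_compose[OF S incl] and Q' = measurable_compose[OF Q incl]
  have Xh: "X h \<in> P x \<rightarrow>\<^sub>M borel" using h by simp
  have K: "(\<lambda>\<omega>. path_law T (P (X h \<omega>)) X) \<in> P x \<rightarrow>\<^sub>M subprob_algebra (cadlag_paths T)"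
    by (rule measurable_compose[OF Xh path_law_measurable])
  have K': "(\<lambda>\<omega>. distr (P (X h \<omega>)) ?PM ?Q) \<in> P x \<rightarrow>\<^sub>M subprob_algebra ?PM"
    using measurable_compose[OF measurable_compose[OF Xh P_subprob] measurable_distr[of ?Q M ?PM]] Q'
    by (simp cong: measurable_cong_sets)
  show "sets ?L = sets ?R"
    using sets_bind_measurable[OF K] not_empty by (simp add: path_law_def)
  have eq: "distr (P x) ?PM ?S = P x \<bind> (\<lambda>\<omega>. distr (P (X h \<omega>)) ?PM ?Q)" (is "?L' = ?R'")
  proof (rule measure_eqI_PiM_infinite)
    show "sets ?R' = sets ?PM" using sets_bind_measurable[OF K'] not_empty by simp
    show "finite_measure ?L'" by (rule prob_space.finite_measure[OF prob_space_distr[OF S']])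
    fix A :: "real \<Rightarrow> 'a set" and J assume J: "finite J" "J \<subseteq> {0..T}" and A: "\<And>i. i \<in> J \<Longrightarrow> A i \<in> sets borel"
    let ?E = "prod_emb {0..T} (\<lambda>_. borel) J (Pi\<^sub>E J A)"
    have E: "?E \<in> sets ?PM" using J A by (intro sets_PiM_I) auto
    have "emeasure ?L' ?E = (\<integral>\<^sup>+\<omega>. indicator ?E (?S \<omega>) \<partial>P x)"
      using S' E by (subst nn_integral_distr[OF S', symmetric]) auto
    also have "\<dots> = (\<integral>\<^sup>+\<omega>. (\<Prod>j\<in>J. indicator (A j) (X (h + j) \<omega>)) \<partial>P x)"
      using J by (intro nn_integral_cong)
        (auto simp: prod_emb_def indicator_def PiE_iff space_PiM extensional_def subset_eq intro!: prod.neutral[symmetric] prod_zero[symmetric])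
    also have "\<dots> = (\<integral>\<^sup>+\<omega>. (\<integral>\<^sup>+\<omega>'. (\<Prod>j\<in>J. indicator (A j) (X j \<omega>')) \<partial>P (X h \<omega>)) \<partial>P x)"
      using J A h by (intro finite_dimensional_shift) auto
    also have "\<dots> = (\<integral>\<^sup>+\<omega>. (\<integral>\<^sup>+\<omega>'. indicator ?E (?Q \<omega>') \<partial>P (X h \<omega>)) \<partial>P x)"
      using J by (intro nn_integral_cong)
        (auto simp: prod_emb_def indicator_def PiE_iff space_PiM extensional_def subset_eq intro!: prod.neutral prod_zero)
    also have "\<dots> = (\<integral>\<^sup>+\<omega>. emeasure (distr (P (X h \<omega>)) ?PM ?Q) ?E \<partial>P x)"
      using E by (intro nn_integral_cong, subst nn_integral_distr[OF Q', symmetric]) auto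
    also have "\<dots> = emeasure ?R' ?E"
      using E not_empty by (subst emeasure_bind[OF _ K']) auto
    finally show "emeasure ?L' ?E = emeasure ?R' ?E" .
  qed simp
  (* Sets of cadlag paths are traces of sets in the product space, and the paths lie in the
     trace, so equality of the laws on the product space is enough. *)
  fix D assume "D \<in> sets ?L"
  then have D: "D \<in> sets (cadlag_paths T)" by (simp add: path_law_def)
  then obtain D' where D': "D' \<in> sets ?PM" "D = {w. cadlag_on {0..T} w} \<inter> D'"
    by (auto simp: cadlag_paths_def sets_restrict_space)
  have into: "?S \<omega> \<in> {w. cadlag_on {0..T} w}" "?Q \<omega> \<in> {w. cadlag_on {0..T} w}" if "\<omega> \<in> space M" for \<omega>
    using measurable_space[OF S, of \<omega>] measurable_space[OF Q, of \<omega>] that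
    by (auto simp: cadlag_paths_def space_restrict_space)
  have "emeasure ?L D = emeasure (distr (P x) ?PM ?S) D'"
    using D D' S S' into unfolding path_law_def
    by (subst (1 2) emeasure_distr) (auto intro!: arg_cong[where f="emeasure (P x)"])
  also have "\<dots> = (\<integral>\<^sup>+\<omega>. emeasure (distr (P (X h \<omega>)) ?PM ?Q) D' \<partial>P x)"
    unfolding eq using D' not_empty by (subst emeasure_bind[OF _ K']) auto
  also have "\<dots> = (\<integral>\<^sup>+\<omega>. emeasure (path_law T (P (X h \<omega>)) X) D \<partial>P x)"
  proof (intro nn_integral_cong)
    fix \<omega>
    show "emeasure (distr (P (X h \<omega>)) ?PM ?Q) D' = emeasure (path_law T (P (X h \<omega>)) X) D"
      using D D' Q Q' into unfolding path_law_def
      by (subst (1 2) emeasure_distr) (auto intro!: arg_cong[where f="emeasure (P (X h \<omega>))"])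
  qed
  also have "\<dots> = emeasure ?R D"
    using D not_empty by (subst emeasure_bind[OF _ K]) auto
  finally show "emeasure ?L D = emeasure ?R D" .
qed

end

section \<open>Laws with a prescribed initial distribution\<close>

locale markov_initial_law = cadlag_markov_family M X P + start: prob_space \<mu>
  for M :: "'w measure" and X :: "real \<Rightarrow> 'w \<Rightarrow> 'a::polish_space" and P and \<mu> :: "'a measure" +
  assumes sets_\<mu> [simp, measurable_cong]: "sets \<mu> = sets borel"
begin

abbreviation "Q \<equiv> initial_law P \<mu>"

lemma space_\<mu> [simp]: "space \<mu> = UNIV"
  using sets_eq_imp_space_eq[OF sets_\<mu>] by simp

lemma P_subprob_\<mu>: "P \<in> \<mu> \<rightarrow>\<^sub>M subprob_algebra M"
  using P_subprob by (simp cong: measurable_cong_sets)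

lemma sets_Q [simp, measurable_cong]: "sets Q = sets M"
  unfolding initial_law_def using sets_bind_measurable[OF P_subprob_\<mu>] by simp

lemma space_Q [simp]: "space Q = space M"
  by (rule sets_eq_imp_space_eq) simp

sublocale Q: prob_space Q
proof
  show "emeasure Q (space Q) = 1"
    using emeasure_bind[OF _ P_subprob_\<mu>, of "space M"] prob_space.emeasure_space_1[OF prob_space_P]
      start.emeasure_space_1
    by (simp add: initial_law_def[symmetric])
qed

lemma Q_space_M [simp]: "emeasure Q (space M) = 1" "measure Q (space M) = 1"
  using Q.emeasure_space_1 Q.prob_space by simp_all

lemma measurable_X_Q [measurable]: "0 \<le> t \<Longrightarrow> X t \<in> Q \<rightarrow>\<^sub>M borel"
  using measurable_X by (simp cong: measurable_cong_sets)

lemma measurable_expectation [measurable]: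
  fixes F :: "'w \<Rightarrow> real"
  shows "F \<in> borel_measurable M \<Longrightarrow> (\<lambda>x. \<integral>\<omega>. F \<omega> \<partial>P x) \<in> borel_measurable borel"
  by (rule measurable_compose[OF P_subprob integral_measurable_subprob_algebra])

lemma integrable_P:
  fixes F :: "'w \<Rightarrow> real"
  assumes "F \<in> borel_measurable M" "\<And>\<omega>. \<omega> \<in> space M \<Longrightarrow> \<bar>F \<omega>\<bar> \<le> B"
  shows "integrable (P x) F"
proof -
  interpret prob_space "P x" by (rule prob_space_P)
  show ?thesis using assms by (intro integrable_const_bound[where B=B]) auto
qed

lemma abs_expectation_le:
  fixes F :: "'w \<Rightarrow> real"
  assumes "F \<in> borel_measurable M" "\<And>\<omega>. \<omega> \<in> space M \<Longrightarrow> \<bar>F \<omega>\<bar> \<le> B"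
  shows "\<bar>\<integral>\<omega>. F \<omega> \<partial>P x\<bar> \<le> B"
proof -
  interpret prob_space "P x" by (rule prob_space_P)
  have "\<bar>\<integral>\<omega>. F \<omega> \<partial>P x\<bar> \<le> (\<integral>\<omega>. \<bar>F \<omega>\<bar> \<partial>P x)" by (rule integral_abs_bound)
  also have "\<dots> \<le> B"
    using assms integrable_P[OF assms] by (intro integral_le_const) auto
  finally show ?thesis .
qed

lemma integrable_Q:
  fixes F :: "'w \<Rightarrow> real"
  assumes "F \<in> borel_measurable M" "\<And>\<omega>. \<omega> \<in> space M \<Longrightarrow> \<bar>F \<omega>\<bar> \<le> B"
  shows "integrable Q F"
  using assms by (intro Q.integrable_const_bound[where B=B]) auto

lemma integral_Q:
  fixes F :: "'w \<Rightarrow> real"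
  assumes "F \<in> borel_measurable M" "\<And>\<omega>. \<omega> \<in> space M \<Longrightarrow> \<bar>F \<omega>\<bar> \<le> B"
  shows "(\<integral>\<omega>. F \<omega> \<partial>Q) = (\<integral>x. (\<integral>\<omega>. F \<omega> \<partial>P x) \<partial>\<mu>)"
  unfolding initial_law_def
  by (rule integral_bind[OF assms P_subprob_\<mu> start.finite_measure, where B'=1])
     (use prob_space.emeasure_space_1[OF prob_space_P] in auto)

text \<open>Convergence in mean of path functionals passes to their expectations as functions of the starting
  point.\<close>

lemma expectation_le_Q:
  fixes F :: "'w \<Rightarrow> real"
  assumes F: "F \<in> borel_measurable M" "\<And>\<omega>. \<omega> \<in> space M \<Longrightarrow> \<bar>F \<omega>\<bar> \<le> B"
  shows "(\<integral>x. \<bar>\<integral>\<omega>. F \<omega> \<partial>P x\<bar> \<partial>\<mu>) \<le> (\<integral>\<omega>. \<bar>F \<omega>\<bar> \<partial>Q)"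
proof -
  have "(\<integral>x. \<bar>\<integral>\<omega>. F \<omega> \<partial>P x\<bar> \<partial>\<mu>) \<le> (\<integral>x. (\<integral>\<omega>. \<bar>F \<omega>\<bar> \<partial>P x) \<partial>\<mu>)"
  proof (rule integral_mono)
    show "integrable \<mu> (\<lambda>x. \<bar>\<integral>\<omega>. F \<omega> \<partial>P x\<bar>)"
      using abs_expectation_le[OF F] F(1) by (intro start.integrable_const_bound[where B=B]) auto
    show "integrable \<mu> (\<lambda>x. \<integral>\<omega>. \<bar>F \<omega>\<bar> \<partial>P x)"
      using abs_expectation_le[of "\<lambda>\<omega>. \<bar>F \<omega>\<bar>" B] F by (intro start.integrable_const_bound[where B=B]) auto
  qed (rule integral_abs_bound)
  also have "\<dots> = (\<integral>\<omega>. \<bar>F \<omega>\<bar> \<partial>Q)" using F by (intro integral_Q[symmetric, where B=B]) auto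
  finally show ?thesis .
qed

end

section \<open>Stationarity\<close>

locale stationary_markov = markov_initial_law M X P \<mu>
  for M :: "'w measure" and X :: "real \<Rightarrow> 'w \<Rightarrow> 'a::polish_space" and P and \<mu> :: "'a measure" +
  assumes invariant: "invariant_measure X P \<mu>"
begin

lemma distr_X: "0 \<le> t \<Longrightarrow> distr Q borel (X t) = \<mu>"
  using invariant by (simp add: invariant_measure_def)

lemma integral_X:
  fixes g :: "'a \<Rightarrow> real"
  assumes "0 \<le> t" "g \<in> borel_measurable borel"
  shows "(\<integral>\<omega>. g (X t \<omega>) \<partial>Q) = (\<integral>x. g x \<partial>\<mu>)"
  using integral_distr[OF measurable_X_Q[OF assms(1)] assms(2)] by (simp add: distr_X assms(1))

lemma integrable_X:
  fixes g :: "'a \<Rightarrow> real"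
  assumes "0 \<le> t" "g \<in> borel_measurable borel"
  shows "integrable Q (\<lambda>\<omega>. g (X t \<omega>)) \<longleftrightarrow> integrable \<mu> g"
  using integrable_distr_eq[OF measurable_X_Q[OF assms(1)] assms(2)] by (simp add: distr_X assms(1))

lemma borel_measurable_\<mu>: "g \<in> borel_measurable \<mu> \<longleftrightarrow> g \<in> borel_measurable borel"
  by (simp cong: measurable_cong_sets)

text \<open>By stationarity replacing \<open>k\<close> by \<open>k'\<close> costs the same at all times, so the property survives
  \<open>L\<^sup>1\<close> limits.\<close>

lemma L1_right_continuous_approx:
  fixes k :: "'a \<Rightarrow> real"
  assumes t: "0 \<le> t" and s: "\<And>n. 0 \<le> s n"
    and k: "integrable \<mu> k"
    and approx: "\<And>\<epsilon>. 0 < \<epsilon> \<Longrightarrow> \<exists>k'. integrable \<mu> k' \<and> (\<integral>x. \<bar>k x - k' x\<bar> \<partial>\<mu>) \<le> \<epsilon> \<and>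
      (\<lambda>n. \<integral>\<omega>. \<bar>k' (X (s n) \<omega>) - k' (X t \<omega>)\<bar> \<partial>Q) \<longlonglongrightarrow> 0"
  shows "(\<lambda>n. \<integral>\<omega>. \<bar>k (X (s n) \<omega>) - k (X t \<omega>)\<bar> \<partial>Q) \<longlonglongrightarrow> 0"
proof (rule LIMSEQ_I)
  fix r :: real assume "0 < r"
  then obtain k' where k': "integrable \<mu> k'" and le: "(\<integral>x. \<bar>k x - k' x\<bar> \<partial>\<mu>) \<le> r / 4"
    and lim: "(\<lambda>n. \<integral>\<omega>. \<bar>k' (X (s n) \<omega>) - k' (X t \<omega>)\<bar> \<partial>Q) \<longlonglongrightarrow> 0"
    using approx[of "r / 4"] by auto
  have [measurable]: "k \<in> borel_measurable borel" "k' \<in> borel_measurable borel"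
    using k k' by (auto simp: borel_measurable_\<mu>[symmetric])
  obtain n0 where n0: "\<And>n. n \<ge> n0 \<Longrightarrow> (\<integral>\<omega>. \<bar>k' (X (s n) \<omega>) - k' (X t \<omega>)\<bar> \<partial>Q) < r / 2"
    using LIMSEQ_D[OF lim, of "r / 2"] \<open>0 < r\<close> by auto
  have i: "integrable Q (\<lambda>\<omega>. k (X u \<omega>))" "integrable Q (\<lambda>\<omega>. k' (X u \<omega>))" if "0 \<le> u" for u
    using k k' that by (auto simp: integrable_X)
  have "(\<integral>\<omega>. \<bar>k (X (s n) \<omega>) - k (X t \<omega>)\<bar> \<partial>Q) < r" if "n \<ge> n0" for n
  proof -
    have "(\<integral>\<omega>. \<bar>k (X (s n) \<omega>) - k (X t \<omega>)\<bar> \<partial>Q)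
      \<le> (\<integral>\<omega>. \<bar>k (X (s n) \<omega>) - k' (X (s n) \<omega>)\<bar> + \<bar>k' (X (s n) \<omega>) - k' (X t \<omega>)\<bar> + \<bar>k (X t \<omega>) - k' (X t \<omega>)\<bar> \<partial>Q)"
      by (intro integral_mono) (auto intro!: Bochner_Integration.integrable_add integrable_abs
          Bochner_Integration.integrable_diff i s t)
    also have "\<dots> = (\<integral>\<omega>. \<bar>k (X (s n) \<omega>) - k' (X (s n) \<omega>)\<bar> \<partial>Q) + (\<integral>\<omega>. \<bar>k' (X (s n) \<omega>) - k' (X t \<omega>)\<bar> \<partial>Q)
        + (\<integral>\<omega>. \<bar>k (X t \<omega>) - k' (X t \<omega>)\<bar> \<partial>Q)"
      by (simp add: i s t)
    also have "\<dots> < r / 4 + r / 2 + r / 4"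
      using n0[OF that] le integral_X[OF s, of "\<lambda>x. \<bar>k x - k' x\<bar>" n] integral_X[OF t, of "\<lambda>x. \<bar>k x - k' x\<bar>"]
      by simp
    finally show ?thesis by simp
  qed
  then show "\<exists>n0. \<forall>n\<ge>n0. norm ((\<integral>\<omega>. \<bar>k (X (s n) \<omega>) - k (X t \<omega>)\<bar> \<partial>Q) - 0) < r" by auto
qed

text \<open>For an open set, right continuity of paths gives convergence of \<open>Q (X t \<in> U \<and> X (s n) \<in> U)\<close>
  to \<open>Q (X t \<in> U)\<close>; by stationarity the two marginal probabilities agree, which also controls the
  paths that enter \<open>U\<close> from outside. Outer regularity and linearity do the rest.\<close>

lemma L1_right_continuous_sequence:
  fixes k :: "'a \<Rightarrow> real"
  assumes k: "integrable \<mu> k" and t: "0 \<le> t" and s: "\<And>n. t \<le> s n" "s \<longlonglongrightarrow> t"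
  shows "(\<lambda>n. \<integral>\<omega>. \<bar>k (X (s n) \<omega>) - k (X t \<omega>)\<bar> \<partial>Q) \<longlonglongrightarrow> 0"
proof -
  have s0: "0 \<le> s n" for n using s(1)[of n] t by linarith
  note [measurable] = measurable_X_Q[OF t] measurable_X_Q[OF s0]
  have opn: "(\<lambda>n. \<integral>\<omega>. \<bar>indicator U (X (s n) \<omega>) - indicator U (X t \<omega>) :: real\<bar> \<partial>Q) \<longlonglongrightarrow> 0"
    if U: "open U" for U
  proof -
    have [measurable]: "U \<in> sets borel" using U by simp
    define I where "I x = (indicator U x :: real)" for x
    have [measurable]: "I \<in> borel_measurable borel" unfolding I_def by measurable
    have I1: "\<bar>I x\<bar> \<le> 1" for x by (simp add: I_def)
    have int: "integrable Q (\<lambda>\<omega>. I (X u \<omega>))" "integrable Q (\<lambda>\<omega>. I (X u \<omega>) * I (X t \<omega>))" if "0 \<le> u" for u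
      using measurable_X_Q[OF that] I1 
      by (auto intro!: Q.integrable_const_bound[where B=1] simp: I_def indicator_def)
    have "(\<lambda>n. \<integral>\<omega>. I (X (s n) \<omega>) * I (X t \<omega>) \<partial>Q) \<longlonglongrightarrow> (\<integral>\<omega>. I (X t \<omega>) \<partial>Q)"
    proof (rule integral_dominated_convergence[where w="\<lambda>_. 1"])
      show "AE \<omega> in Q. (\<lambda>n. I (X (s n) \<omega>) * I (X t \<omega>)) \<longlonglongrightarrow> I (X t \<omega>)"
      proof (rule AE_I2)
        fix \<omega> assume "\<omega> \<in> space Q"
        then have lim: "(\<lambda>n. X (s n) \<omega>) \<longlonglongrightarrow> X t \<omega>"
          using s t s0 by (intro X.Y_right_limit) auto
        show "(\<lambda>n. I (X (s n) \<omega>) * I (X t \<omega>)) \<longlonglongrightarrow> I (X t \<omega>)"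
        proof (cases "X t \<omega> \<in> U")
          case True
          then have "\<forall>\<^sub>F n in sequentially. X (s n) \<omega> \<in> U" using topological_tendstoD[OF lim U] by simp
          then have "\<forall>\<^sub>F n in sequentially. I (X t \<omega>) = I (X (s n) \<omega>) * I (X t \<omega>)"
            by eventually_elim (use True in \<open>simp add: I_def\<close>)
          then show ?thesis by (rule Lim_transform_eventually[OF tendsto_const])
        qed (simp add: I_def)
      qed
      show "AE \<omega> in Q. norm (I (X (s n) \<omega>) * I (X t \<omega>)) \<le> 1" for n by (auto simp: I_def indicator_def)
    qed auto
    then have "(\<lambda>n. 2 * (\<integral>x. I x \<partial>\<mu>) - 2 * (\<integral>\<omega>. I (X (s n) \<omega>) * I (X t \<omega>) \<partial>Q))
        \<longlonglongrightarrow> 2 * (\<integral>x. I x \<partial>\<mu>) - 2 * (\<integral>x. I x \<partial>\<mu>)"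
      using t by (intro tendsto_intros) (simp add: integral_X)
    moreover have "(\<integral>\<omega>. \<bar>I (X (s n) \<omega>) - I (X t \<omega>)\<bar> \<partial>Q)
        = 2 * (\<integral>x. I x \<partial>\<mu>) - 2 * (\<integral>\<omega>. I (X (s n) \<omega>) * I (X t \<omega>) \<partial>Q)" for n
    proof -
      have "(\<integral>\<omega>. \<bar>I (X (s n) \<omega>) - I (X t \<omega>)\<bar> \<partial>Q)
          = (\<integral>\<omega>. I (X (s n) \<omega>) + I (X t \<omega>) - 2 * (I (X (s n) \<omega>) * I (X t \<omega>)) \<partial>Q)"
        by (intro Bochner_Integration.integral_cong) (auto simp: I_def indicator_def)
      also have "\<dots> = (\<integral>\<omega>. I (X (s n) \<omega>) \<partial>Q) + (\<integral>\<omega>. I (X t \<omega>) \<partial>Q) - 2 * (\<integral>\<omega>. I (X (s n) \<omega>) * I (X t \<omega>) \<partial>Q)"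
        using int s0 t by simp
      finally show ?thesis using s0 t by (simp add: integral_X)
    qed
    ultimately show ?thesis by (simp add: I_def)
  qed
  show ?thesis
    using k
  proof (induction k rule: integrable_induct)
    case (base A c)
    have A: "A \<in> sets borel" using base by simp
    have [measurable]: "A \<in> sets \<mu>" using base by simp
    have ind: "(\<lambda>n. \<integral>\<omega>. \<bar>indicator A (X (s n) \<omega>) - indicator A (X t \<omega>) :: real\<bar> \<partial>Q) \<longlonglongrightarrow> 0"
    proof (rule L1_right_continuous_approx[OF t s0])
      show "integrable \<mu> (indicator A :: 'a \<Rightarrow> real)"
        by (intro start.integrable_const_bound[where B=1]) (auto simp: indicator_def)
      fix \<epsilon> :: real assume \<epsilon>: "0 < \<epsilon>"
      have "emeasure \<mu> A = (INF U \<in> {U. A \<subseteq> U \<and> open U}. emeasure \<mu> U)"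
        by (rule outer_regular[OF sets_\<mu> _ A]) (use start.emeasure_space_1 in simp)
      moreover have "emeasure \<mu> A < ennreal (measure \<mu> A + \<epsilon>)"
        unfolding start.emeasure_eq_measure using \<epsilon> by (intro ennreal_lessI) (auto intro: add_nonneg_pos)
      ultimately have "(INF U \<in> {U. A \<subseteq> U \<and> open U}. emeasure \<mu> U) < ennreal (measure \<mu> A + \<epsilon>)"
        by simp
      then obtain U where U: "A \<subseteq> U" "open U" "emeasure \<mu> U < ennreal (measure \<mu> A + \<epsilon>)"
        by (auto simp: INF_less_iff)
      have [measurable]: "U \<in> sets \<mu>" using U by simp
      have "measure \<mu> U \<le> measure \<mu> A + \<epsilon>"
        using U(3) unfolding start.emeasure_eq_measure by (subst (asm) ennreal_less_iff) auto
      moreover have "(\<integral>x. \<bar>indicator A x - indicator U x :: real\<bar> \<partial>\<mu>) = (\<integral>x. indicator (U - A) x \<partial>\<mu>)"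
        using U(1) by (intro Bochner_Integration.integral_cong) (auto simp: indicator_def)
      moreover have "\<dots> = measure \<mu> U - measure \<mu> A"
        using start.finite_measure_Diff[of U A] U(1) \<open>A \<in> sets \<mu>\<close> \<open>U \<in> sets \<mu>\<close> by simp
      ultimately have "(\<integral>x. \<bar>indicator A x - indicator U x :: real\<bar> \<partial>\<mu>) \<le> \<epsilon>" by linarith
      moreover have "integrable \<mu> (indicator U :: 'a \<Rightarrow> real)"
        by (intro start.integrable_const_bound[where B=1]) (auto simp: indicator_def)
      ultimately show "\<exists>k'. integrable \<mu> k' \<and> (\<integral>x. \<bar>indicator A x - k' x\<bar> \<partial>\<mu>) \<le> \<epsilon> \<and>
          (\<lambda>n. \<integral>\<omega>. \<bar>k' (X (s n) \<omega>) - k' (X t \<omega>) :: real\<bar> \<partial>Q) \<longlonglongrightarrow> 0"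
        using opn[OF U(2)] by blast
    qed
    have "(\<integral>\<omega>. \<bar>indicat_real A (X (s n) \<omega>) *\<^sub>R c - indicat_real A (X t \<omega>) *\<^sub>R c\<bar> \<partial>Q)
        = \<bar>c\<bar> * (\<integral>\<omega>. \<bar>indicator A (X (s n) \<omega>) - indicator A (X t \<omega>)\<bar> \<partial>Q)" for n
      by (subst integral_mult_right_zero[symmetric])
         (auto intro!: Bochner_Integration.integral_cong simp: algebra_simps simp flip: abs_mult)
    then show ?case using tendsto_mult_right_zero[OF ind, of "\<bar>c\<bar>"] by simp
  next
    case (add f g)
    have [measurable]: "f \<in> borel_measurable borel" "g \<in> borel_measurable borel"
      using add by (auto simp: borel_measurable_\<mu>[symmetric])
    have i: "integrable Q (\<lambda>\<omega>. f (X u \<omega>))" "integrable Q (\<lambda>\<omega>. g (X u \<omega>))" if "0 \<le> u" for u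
      using add that by (auto simp: integrable_X)
    show ?case
    proof (rule Lim_null_comparison[OF always_eventually[OF allI]])
      fix n
      have "(\<integral>\<omega>. \<bar>f (X (s n) \<omega>) + g (X (s n) \<omega>) - (f (X t \<omega>) + g (X t \<omega>))\<bar> \<partial>Q)
        \<le> (\<integral>\<omega>. \<bar>f (X (s n) \<omega>) - f (X t \<omega>)\<bar> + \<bar>g (X (s n) \<omega>) - g (X t \<omega>)\<bar> \<partial>Q)"
        by (intro integral_mono) (auto intro!: Bochner_Integration.integrable_add integrable_abs
          Bochner_Integration.integrable_diff i s0 t)
      also have "\<dots> = (\<integral>\<omega>. \<bar>f (X (s n) \<omega>) - f (X t \<omega>)\<bar> \<partial>Q) + (\<integral>\<omega>. \<bar>g (X (s n) \<omega>) - g (X t \<omega>)\<bar> \<partial>Q)"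
        by (simp add: i s0 t)
      finally show "norm (\<integral>\<omega>. \<bar>f (X (s n) \<omega>) + g (X (s n) \<omega>) - (f (X t \<omega>) + g (X t \<omega>))\<bar> \<partial>Q) \<le>
        (\<integral>\<omega>. \<bar>f (X (s n) \<omega>) - f (X t \<omega>)\<bar> \<partial>Q) + (\<integral>\<omega>. \<bar>g (X (s n) \<omega>) - g (X t \<omega>)\<bar> \<partial>Q)" by simp
    qed (use tendsto_add[OF add.IH] in simp)
  next
    case (lim f S)
    show ?case
    proof (rule L1_right_continuous_approx[OF t s0 \<open>integrable \<mu> f\<close>])
      fix \<epsilon> :: real assume "0 < \<epsilon>"
      have [measurable]: "f \<in> borel_measurable \<mu>" "S i \<in> borel_measurable \<mu>" for i
        using lim.hyps(1,4) by auto
      have "(\<lambda>i. \<integral>x. \<bar>f x - S i x\<bar> \<partial>\<mu>) \<longlonglongrightarrow> (\<integral>x. 0 \<partial>\<mu>)"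
      proof (rule integral_dominated_convergence[where w="\<lambda>x. 3 * \<bar>f x\<bar>"])
        show "AE x in \<mu>. (\<lambda>i. \<bar>f x - S i x\<bar>) \<longlonglongrightarrow> 0"
        proof (rule AE_I2)
          fix x assume "x \<in> space \<mu>"
          from tendsto_rabs[OF tendsto_diff[OF tendsto_const lim.hyps(2)[OF this], of "f x"]]
          show "(\<lambda>i. \<bar>f x - S i x\<bar>) \<longlonglongrightarrow> 0" by simp
        qed
        show "AE x in \<mu>. norm \<bar>f x - S i x\<bar> \<le> 3 * \<bar>f x\<bar>" for i
          using lim.hyps(3)[of _ i] by (intro AE_I2) (smt (verit) real_norm_def)
      qed (use lim.hyps(4) in auto)
      then obtain i where "(\<integral>x. \<bar>f x - S i x\<bar> \<partial>\<mu>) < \<epsilon>"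
        using LIMSEQ_D[of _ 0 \<epsilon>] \<open>0 < \<epsilon>\<close> by fastforce
      then show "\<exists>k'. integrable \<mu> k' \<and> (\<integral>x. \<bar>f x - k' x\<bar> \<partial>\<mu>) \<le> \<epsilon> \<and>
          (\<lambda>n. \<integral>\<omega>. \<bar>k' (X (s n) \<omega>) - k' (X t \<omega>)\<bar> \<partial>Q) \<longlonglongrightarrow> 0"
        using lim.hyps(1) lim.IH by (intro exI[of _ "S i"]) auto
    qed
  qed
qed

lemma L1_right_continuous:
  fixes k :: "'a \<Rightarrow> real"
  assumes k: "integrable \<mu> k" and t: "0 \<le> t" and \<epsilon>: "0 < \<epsilon>"
  obtains \<delta> where "0 < \<delta>" "\<And>s. t \<le> s \<Longrightarrow> s < t + \<delta> \<Longrightarrow> (\<integral>\<omega>. \<bar>k (X s \<omega>) - k (X t \<omega>)\<bar> \<partial>Q) < \<epsilon>"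
proof (rule ccontr)
  assume *: "\<not> thesis"
  have "\<exists>s. t \<le> s \<and> s < t + 1 / real (Suc n) \<and> \<epsilon> \<le> (\<integral>\<omega>. \<bar>k (X s \<omega>) - k (X t \<omega>)\<bar> \<partial>Q)" for n
  proof (rule ccontr)
    assume "\<not> ?thesis"
    then have "(\<integral>\<omega>. \<bar>k (X s \<omega>) - k (X t \<omega>)\<bar> \<partial>Q) < \<epsilon>" if "t \<le> s" "s < t + 1 / real (Suc n)" for s
      using that by (auto simp: not_le[symmetric])
    then have thesis by (intro that[of "1 / real (Suc n)"]) auto
    with * show False ..
  qed
  then obtain s where s: "\<And>n. t \<le> s n" "\<And>n. s n < t + 1 / real (Suc n)"
    "\<And>n. \<epsilon> \<le> (\<integral>\<omega>. \<bar>k (X (s n) \<omega>) - k (X t \<omega>)\<bar> \<partial>Q)" by metis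
  have "(\<lambda>n. t + 1 / real (Suc n)) \<longlonglongrightarrow> t"
    using tendsto_add[OF tendsto_const LIMSEQ_Suc[OF lim_const_over_n], of t 1] by simp
  then have "s \<longlonglongrightarrow> t"
    by (rule tendsto_sandwich[OF _ _ tendsto_const, rotated 2]) (use s in \<open>auto intro: always_eventually less_imp_le\<close>)
  from L1_right_continuous_sequence[OF k t s(1) this]
  have "(\<lambda>n. \<integral>\<omega>. \<bar>k (X (s n) \<omega>) - k (X t \<omega>)\<bar> \<partial>Q) \<longlonglongrightarrow> 0" .
  then have "\<epsilon> \<le> 0" by (rule LIMSEQ_le_const) (use s(3) in auto)
  then show False using \<epsilon> by simp
qed

end

section \<open>Differentiating functionals of time integrals\<close>

text \<open>The functions \<open>G\<close> of a time integral that are used below are \<open>exp\<close>, for exponential moments, and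
  the identity, for means. Time integrals of bounded functions over bounded windows stay in a bounded
  interval, so a local condition suffices.\<close>

locale locally_quadratic_expansion =
  fixes G G' :: "real \<Rightarrow> real"
  assumes G_measurable [measurable]: "G \<in> borel_measurable borel"
    and G'_measurable [measurable]: "G' \<in> borel_measurable borel"
    and expansion: "\<And>R. \<exists>L\<ge>0. \<forall>x y. \<bar>x\<bar> \<le> R \<longrightarrow> \<bar>y\<bar> \<le> R \<longrightarrow>
      \<bar>G y - G x - G' x * (y - x)\<bar> \<le> L * (y - x)\<^sup>2 \<and> \<bar>G' x\<bar> \<le> L"
begin

lemma Lipschitz_on_bounded: "\<exists>L\<ge>0. \<forall>x y. \<bar>x\<bar> \<le> R \<longrightarrow> \<bar>y\<bar> \<le> R \<longrightarrow> \<bar>G y - G x\<bar> \<le> L * \<bar>y - x\<bar>"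
proof -
  obtain L where L: "0 \<le> L" "\<And>x y. \<bar>x\<bar> \<le> R \<Longrightarrow> \<bar>y\<bar> \<le> R \<Longrightarrow>
      \<bar>G y - G x - G' x * (y - x)\<bar> \<le> L * (y - x)\<^sup>2 \<and> \<bar>G' x\<bar> \<le> L"
    using expansion[of R] by blast
  have "\<bar>G y - G x\<bar> \<le> (L * (2 * \<bar>R\<bar>) + L) * \<bar>y - x\<bar>" if "\<bar>x\<bar> \<le> R" "\<bar>y\<bar> \<le> R" for x y
  proof -
    have "\<bar>G y - G x\<bar> \<le> L * (y - x)\<^sup>2 + \<bar>G' x\<bar> * \<bar>y - x\<bar>"
      using L(2)[OF that] abs_mult[of "G' x" "y - x"] by linarith
    also have "L * (y - x)\<^sup>2 = L * \<bar>y - x\<bar> * \<bar>y - x\<bar>"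
      by (simp add: power2_eq_square mult.assoc flip: abs_mult)
    also have "\<dots> \<le> L * (2 * \<bar>R\<bar>) * \<bar>y - x\<bar>"
      using that L(1) by (intro mult_right_mono mult_left_mono) auto
    also have "\<bar>G' x\<bar> * \<bar>y - x\<bar> \<le> L * \<bar>y - x\<bar>" using L(2)[OF that] by (intro mult_right_mono) auto
    finally show ?thesis by (simp add: distrib_right)
  qed
  moreover have "0 \<le> L * (2 * \<bar>R\<bar>) + L" using L(1) by simp
  ultimately show ?thesis by blast
qed

lemma bounded_on_bounded: "\<exists>B. \<forall>x. \<bar>x\<bar> \<le> R \<longrightarrow> \<bar>G x\<bar> \<le> B \<and> \<bar>G' x\<bar> \<le> B"
proof -
  obtain L where L: "0 \<le> L" "\<And>x y. \<bar>x\<bar> \<le> R \<Longrightarrow> \<bar>y\<bar> \<le> R \<Longrightarrow> \<bar>G y - G x\<bar> \<le> L * \<bar>y - x\<bar>"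
    using Lipschitz_on_bounded[of R] by blast
  obtain L' where L': "\<And>x y. \<bar>x\<bar> \<le> R \<Longrightarrow> \<bar>y\<bar> \<le> R \<Longrightarrow> \<bar>G' x\<bar> \<le> L'"
    using expansion[of R] by blast
  have "\<bar>G x\<bar> \<le> max (\<bar>G 0\<bar> + L * R) L' \<and> \<bar>G' x\<bar> \<le> max (\<bar>G 0\<bar> + L * R) L'" if x: "\<bar>x\<bar> \<le> R" for x
  proof -
    have "\<bar>G x - G 0\<bar> \<le> L * \<bar>x\<bar>" using L(2)[of 0 x] x by auto
    moreover have "L * \<bar>x\<bar> \<le> L * R" using x L(1) by (rule mult_left_mono)
    ultimately show ?thesis using L'[OF x x] by linarith
  qed
  then show ?thesis by blast
qed

end

lemma locally_quadratic_expansion_id: "locally_quadratic_expansion (\<lambda>x. x) (\<lambda>_. 1)"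
proof
  show "\<exists>L\<ge>0. \<forall>x y. \<bar>x\<bar> \<le> R \<longrightarrow> \<bar>y\<bar> \<le> R \<longrightarrow>
      \<bar>y - x - 1 * (y - x)\<bar> \<le> L * (y - x)\<^sup>2 \<and> \<bar>1\<bar> \<le> L" for R :: real
    by (rule exI[of _ 1]) simp
qed auto

lemma locally_quadratic_expansion_exp: "locally_quadratic_expansion exp exp"
proof
  fix R :: real
  have "\<bar>exp y - exp x - exp x * (y - x)\<bar> \<le> exp (\<bar>R\<bar>) * (y - x)\<^sup>2 \<and> \<bar>exp x\<bar> \<le> exp \<bar>R\<bar>"
    if "\<bar>x\<bar> \<le> R" "\<bar>y\<bar> \<le> R" for x y :: real
  proof -
    have 1: "1 + (y - x) \<le> exp (y - x)" "1 + (x - y) \<le> exp (x - y)" by (rule exp_ge_add_one_self)+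
    have "exp x * (1 + (y - x)) \<le> exp x * exp (y - x)" using 1(1) by (intro mult_left_mono) auto
    then have low: "0 \<le> exp y - exp x - exp x * (y - x)" by (simp add: algebra_simps flip: exp_add)
    have "exp y * (1 + (x - y)) \<le> exp y * exp (x - y)" using 1(2) by (intro mult_left_mono) auto
    then have "exp y - exp x \<le> exp y * (y - x)" by (simp add: algebra_simps flip: exp_add)
    then have "exp y - exp x - exp x * (y - x) \<le> (exp y - exp x) * (y - x)" by (simp add: algebra_simps)
    also have "\<dots> \<le> \<bar>exp y - exp x\<bar> * \<bar>y - x\<bar>" by (simp flip: abs_mult)
    also have "\<dots> \<le> (exp \<bar>R\<bar> * \<bar>y - x\<bar>) * \<bar>y - x\<bar>"
    proof (rule mult_right_mono)
      have *: "exp v - exp u \<le> exp \<bar>R\<bar> * \<bar>v - u\<bar>" if "u \<le> v" "\<bar>v\<bar> \<le> R" for u v :: real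
      proof -
        have "exp v * (1 + (u - v)) \<le> exp v * exp (u - v)"
          by (intro mult_left_mono exp_ge_add_one_self) auto
        then have "exp v - exp u \<le> exp v * (v - u)" by (simp add: algebra_simps flip: exp_add)
        also have "\<dots> \<le> exp \<bar>R\<bar> * \<bar>v - u\<bar>" using that by (intro mult_mono) auto
        finally show ?thesis .
      qed
      show "\<bar>exp y - exp x\<bar> \<le> exp \<bar>R\<bar> * \<bar>y - x\<bar>"
        using *[of x y] *[of y x] that by (cases "x \<le> y") (auto simp: abs_minus_commute)
    qed auto
    finally show ?thesis using low that by (auto simp: power2_eq_square mult.assoc simp flip: abs_mult)
  qed
  then show "\<exists>L\<ge>0. \<forall>x y. \<bar>x\<bar> \<le> R \<longrightarrow> \<bar>y\<bar> \<le> R \<longrightarrow>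
      \<bar>exp y - exp x - exp x * (y - x)\<bar> \<le> L * (y - x)\<^sup>2 \<and> \<bar>exp x\<bar> \<le> L"
    using exp_ge_zero by blast
qed auto

context stationary_markov
begin

lemma Fubini_time:
  fixes F :: "'w \<Rightarrow> real \<Rightarrow> real"
  assumes [measurable]: "(\<lambda>(\<omega>, s). F \<omega> s) \<in> borel_measurable (M \<Otimes>\<^sub>M borel)"
    and B: "\<And>\<omega> s. \<omega> \<in> space M \<Longrightarrow> \<bar>F \<omega> s\<bar> \<le> B"
  shows "(\<integral>\<omega>. (LINT s:{a..b}|lborel. F \<omega> s) \<partial>Q) = (LINT s:{a..b}|lborel. (\<integral>\<omega>. F \<omega> s \<partial>Q))"
    and "integrable Q (\<lambda>\<omega>. LINT s:{a..b}|lborel. F \<omega> s)"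
    and "set_integrable lborel {a..b} (\<lambda>s. \<integral>\<omega>. F \<omega> s \<partial>Q)"
proof -
  interpret QL: pair_sigma_finite Q lborel
    by (intro pair_sigma_finite.intro Q.sigma_finite_measure_axioms lborel.sigma_finite_measure_axioms)
  have meas: "(\<lambda>(\<omega>, s). F \<omega> s) \<in> borel_measurable (Q \<Otimes>\<^sub>M lborel)" by measurable
  have "integrable (Q \<Otimes>\<^sub>M lborel) (\<lambda>p. indicator (space Q \<times> {a..b}) p *\<^sub>R (case p of (\<omega>, s) \<Rightarrow> F \<omega> s))"
  proof (rule integrableI_bounded_set_indicator[where B=B])
    show "emeasure (Q \<Otimes>\<^sub>M lborel) (space Q \<times> {a..b}) < \<infinity>"
      by (cases "a \<le> b") (auto simp: lborel.emeasure_pair_measure_Times Q.emeasure_space_1)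
    show "AE p in Q \<Otimes>\<^sub>M lborel. p \<in> space Q \<times> {a..b} \<longrightarrow> norm (case p of (\<omega>, s) \<Rightarrow> F \<omega> s) \<le> B"
      using B by auto
  qed (use meas in auto)
  then have i: "integrable (Q \<Otimes>\<^sub>M lborel) (\<lambda>(\<omega>, s). indicator {a..b} s * F \<omega> s)"
    by (rule Bochner_Integration.integrable_cong[THEN iffD1, OF refl, rotated])
       (auto simp: indicator_def space_pair_measure)
  show "(\<integral>\<omega>. (LINT s:{a..b}|lborel. F \<omega> s) \<partial>Q) = (LINT s:{a..b}|lborel. (\<integral>\<omega>. F \<omega> s \<partial>Q))"
    using QL.Fubini_integral[OF i] by (simp add: set_lebesgue_integral_def)
  show "integrable Q (\<lambda>\<omega>. LINT s:{a..b}|lborel. F \<omega> s)"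
    using QL.integrable_fst[OF i] by (simp add: set_lebesgue_integral_def)
  show "set_integrable lborel {a..b} (\<lambda>s. \<integral>\<omega>. F \<omega> s \<partial>Q)"
    using QL.integrable_snd[OF i] by (simp add: set_integrable_def)
qed

lemma mean_time_integral:
  fixes k :: "'a \<Rightarrow> real"
  assumes k: "k \<in> borel_measurable borel" "\<And>x. \<bar>k x\<bar> \<le> K" and T: "0 \<le> T"
  shows "(\<integral>\<omega>. time_integral X k 0 T \<omega> \<partial>Q) = T * (\<integral>x. k x \<partial>\<mu>)"
proof -
  have "(\<integral>\<omega>. time_integral X k 0 T \<omega> \<partial>Q)
      = (\<integral>\<omega>. (LINT s:{0..T}|lborel. k (X (max 0 (min T s)) \<omega>)) \<partial>Q)"
    unfolding time_integral_def
    by (intro Bochner_Integration.integral_cong set_lebesgue_integral_cong) auto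
  also have "\<dots> = (LINT s:{0..T}|lborel. (\<integral>\<omega>. k (X (max 0 (min T s)) \<omega>) \<partial>Q))"
    using k by (intro Fubini_time[where B=K] X.measurable_jointly_observed T) auto
  also have "\<dots> = T * (\<integral>x. k x \<partial>\<mu>)"
    using T k(1) by (simp add: integral_X set_lebesgue_integral_def)
  finally show ?thesis .
qed

text \<open>Lebesgue differentiation at every time instead of almost every time: stationarity has turned
  right continuity of paths into right continuity in mean.\<close>

lemma L1_right_differentiable:
  fixes k :: "'a \<Rightarrow> real"
  assumes k: "k \<in> borel_measurable borel" "\<And>x. \<bar>k x\<bar> \<le> K" and t: "0 \<le> t"
  shows "((\<lambda>h. \<integral>\<omega>. \<bar>time_integral X k t (t + h) \<omega> / h - k (X t \<omega>)\<bar> \<partial>Q) \<longlongrightarrow> 0) (at_right 0)"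
proof (rule tendstoI)
  fix \<epsilon> :: real assume \<epsilon>: "0 < \<epsilon>"
  note [measurable] = k(1) measurable_X[OF t]
  have "integrable \<mu> k" using k by (intro start.integrable_const_bound[where B=K]) auto
  from L1_right_continuous[OF this t, of "\<epsilon> / 2"] \<epsilon> obtain \<delta> where \<delta>: "0 < \<delta>"
    and osc: "\<And>s. t \<le> s \<Longrightarrow> s < t + \<delta> \<Longrightarrow> (\<integral>\<omega>. \<bar>k (X s \<omega>) - k (X t \<omega>)\<bar> \<partial>Q) < \<epsilon> / 2" by auto
  have "(\<integral>\<omega>. \<bar>time_integral X k t (t + h) \<omega> / h - k (X t \<omega>)\<bar> \<partial>Q) < \<epsilon>" if h: "0 < h" "h < \<delta>" for h
  proof -
    define Y where "Y s = X (max t (min (t + h) s))" for s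
    have "(\<lambda>(\<omega>, s). k (Y s \<omega>)) \<in> borel_measurable (M \<Otimes>\<^sub>M borel)"
      unfolding Y_def using h t by (intro X.measurable_jointly_observed k(1)) auto
    then have [measurable]: "(\<lambda>(\<omega>, s). \<bar>k (Y s \<omega>) - k (X t \<omega>)\<bar>) \<in> borel_measurable (M \<Otimes>\<^sub>M borel)"
      by measurable
    have B: "\<bar>\<bar>k (Y s \<omega>) - k (X t \<omega>)\<bar>\<bar> \<le> 2 * K" for s \<omega>
      using k(2)[of "Y s \<omega>"] k(2)[of "X t \<omega>"] by linarith
    note Fub = Fubini_time[of "\<lambda>\<omega> s. \<bar>k (Y s \<omega>) - k (X t \<omega>)\<bar>", OF _ B, where a=t and b="t + h"]
    have si: "set_integrable lborel {t..t + h} (\<lambda>s. k (X s \<omega>))" if "\<omega> \<in> space M" for \<omega>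
      using that t by (intro X.set_integrable_observed[OF k]) auto
    have sc: "set_integrable lborel {t..t + h} (\<lambda>s. c)" for c :: real
      unfolding set_integrable_def using h
      by (intro integrableI_bounded_set_indicator[where B="\<bar>c\<bar>"]) auto
    have sY: "(LINT s:{t..t + h}|lborel. \<bar>k (X s \<omega>) - k (X t \<omega>)\<bar>) = (LINT s:{t..t + h}|lborel. \<bar>k (Y s \<omega>) - k (X t \<omega>)\<bar>)" for \<omega>
      by (intro set_lebesgue_integral_cong) (auto simp: Y_def)
    have pt: "\<bar>time_integral X k t (t + h) \<omega> / h - k (X t \<omega>)\<bar>
        \<le> (LINT s:{t..t + h}|lborel. \<bar>k (Y s \<omega>) - k (X t \<omega>)\<bar>) / h" if \<omega>: "\<omega> \<in> space M" for \<omega>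
    proof -
      have "time_integral X k t (t + h) \<omega> / h - k (X t \<omega>)
          = (LINT s:{t..t + h}|lborel. k (X s \<omega>) - k (X t \<omega>)) / h"
      proof -
        have "(LINT s:{t..t + h}|lborel. k (X t \<omega>)) = h * k (X t \<omega>)"
          using h by (simp add: set_lebesgue_integral_def)
        then show ?thesis
          using set_integral_diff(2)[OF si[OF \<omega>] sc, of "k (X t \<omega>)"] h
          by (simp add: time_integral_def diff_divide_distrib)
      qed
      also have "\<bar>\<dots>\<bar> \<le> (LINT s:{t..t + h}|lborel. \<bar>k (X s \<omega>) - k (X t \<omega>)\<bar>) / h"
        using h set_integral_norm_bound[OF set_integral_diff(1)[OF si[OF \<omega>] sc], of "k (X t \<omega>)"]
        by (simp add: divide_right_mono)
      finally show ?thesis by (simp add: sY)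
    qed
    have "(\<integral>\<omega>. \<bar>time_integral X k t (t + h) \<omega> / h - k (X t \<omega>)\<bar> \<partial>Q)
        \<le> (\<integral>\<omega>. (LINT s:{t..t + h}|lborel. \<bar>k (Y s \<omega>) - k (X t \<omega>)\<bar>) / h \<partial>Q)"
    proof (rule integral_mono)
      have [measurable]: "time_integral X k t (t + h) \<in> borel_measurable M"
        using t by (intro X.time_integral_measurable k) auto
      have [measurable]: "X t \<in> M \<rightarrow>\<^sub>M borel" by (rule measurable_X[OF t])
      show "integrable Q (\<lambda>\<omega>. \<bar>time_integral X k t (t + h) \<omega> / h - k (X t \<omega>)\<bar>)"
      proof (intro integrable_Q[where B="2 * K"])
        fix \<omega> assume \<omega>: "\<omega> \<in> space M"
        have "\<bar>time_integral X k t (t + h) \<omega>\<bar> \<le> K * (t + h - t)"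
          using t h \<omega> by (intro X.time_integral_bound k) auto
        then have "\<bar>time_integral X k t (t + h) \<omega> / h\<bar> \<le> K"
          using h by (simp add: abs_divide pos_divide_le_eq)
        then show "\<bar>\<bar>time_integral X k t (t + h) \<omega> / h - k (X t \<omega>)\<bar>\<bar> \<le> 2 * K"
          using k(2)[of "X t \<omega>"] by linarith
      qed measurable
      show "integrable Q (\<lambda>\<omega>. (LINT s:{t..t + h}|lborel. \<bar>k (Y s \<omega>) - k (X t \<omega>)\<bar>) / h)"
        using Fub(2) by (intro integrable_divide) measurable
    qed (use pt in auto)
    also have "\<dots> = (LINT s:{t..t + h}|lborel. (\<integral>\<omega>. \<bar>k (Y s \<omega>) - k (X t \<omega>)\<bar> \<partial>Q)) / h"
      using Fub(1) by simp
    also have "\<dots> \<le> (LINT s:{t..t + h}|lborel. \<epsilon> / 2) / h"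
    proof (intro divide_right_mono set_integral_mono sc)
      show "set_integrable lborel {t..t + h} (\<lambda>s. \<integral>\<omega>. \<bar>k (Y s \<omega>) - k (X t \<omega>)\<bar> \<partial>Q)"
        by (rule Fub(3)) measurable
      fix s assume "s \<in> {t..t + h}"
      then show "(\<integral>\<omega>. \<bar>k (Y s \<omega>) - k (X t \<omega>)\<bar> \<partial>Q) \<le> \<epsilon> / 2"
        using osc[of s] h by (simp add: Y_def min_absorb2 max_absorb2)
    qed (use h in auto)
    also have "\<dots> = \<epsilon> / 2" using h by (simp add: set_lebesgue_integral_def)
    also have "\<dots> < \<epsilon>" using \<epsilon> by simp
    finally show ?thesis .
  qed
  then show "\<forall>\<^sub>F h in at_right 0. dist (\<integral>\<omega>. \<bar>time_integral X k t (t + h) \<omega> / h - k (X t \<omega>)\<bar> \<partial>Q) 0 < \<epsilon>"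
    unfolding eventually_at_right_field using \<delta> by (intro exI[of _ \<delta>]) auto
qed

lemma L2_fun_expectation:
  fixes F :: "'w \<Rightarrow> real"
  assumes "F \<in> borel_measurable M" "\<And>\<omega>. \<omega> \<in> space M \<Longrightarrow> \<bar>F \<omega>\<bar> \<le> B"
  shows "(\<lambda>x. \<integral>\<omega>. F \<omega> \<partial>P x) \<in> L2_fun \<mu>"
  by (rule start.L2_fun_bounded[OF borel_measurable_\<mu>[THEN iffD2, OF measurable_expectation[OF assms(1)]]
      abs_expectation_le[OF assms]])

text \<open>For uniformly bounded variables convergence in mean is enough, because the square is at most the
  bound times the absolute value.\<close>

lemma L2_norm_expectation_tendsto:
  fixes Z :: "real \<Rightarrow> 'w \<Rightarrow> real"
  assumes Z: "\<And>h. 0 < h \<Longrightarrow> h < 1 \<Longrightarrow> Z h \<in> borel_measurable M"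
    "\<And>h \<omega>. 0 < h \<Longrightarrow> h < 1 \<Longrightarrow> \<omega> \<in> space M \<Longrightarrow> \<bar>Z h \<omega>\<bar> \<le> B"
    and lim: "((\<lambda>h. \<integral>\<omega>. \<bar>Z h \<omega>\<bar> \<partial>Q) \<longlongrightarrow> 0) (at_right 0)"
  shows "((\<lambda>h. L2_norm \<mu> (\<lambda>x. \<integral>\<omega>. Z h \<omega> \<partial>P x)) \<longlongrightarrow> 0) (at_right 0)"
proof (rule Lim_null_comparison)
  have "((\<lambda>h. sqrt (B * (\<integral>\<omega>. \<bar>Z h \<omega>\<bar> \<partial>Q))) \<longlongrightarrow> sqrt (B * 0)) (at_right 0)"
    by (intro tendsto_intros lim)
  then show "((\<lambda>h. sqrt (B * (\<integral>\<omega>. \<bar>Z h \<omega>\<bar> \<partial>Q))) \<longlongrightarrow> 0) (at_right 0)" by simp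
  have "norm (L2_norm \<mu> (\<lambda>x. \<integral>\<omega>. Z h \<omega> \<partial>P x)) \<le> sqrt (B * (\<integral>\<omega>. \<bar>Z h \<omega>\<bar> \<partial>Q))" if h: "0 < h" "h < 1" for h
  proof -
    define e where "e x = (\<integral>\<omega>. Z h \<omega> \<partial>P x)" for x
    have e: "\<bar>e x\<bar> \<le> B" for x unfolding e_def by (rule abs_expectation_le[OF Z[OF h]])
    have B: "0 \<le> B" using e[of undefined] by linarith
    have [measurable]: "e \<in> borel_measurable borel" unfolding e_def using Z(1)[OF h] by measurable
    have "(\<integral>x. e x * e x \<partial>\<mu>) \<le> (\<integral>x. B * \<bar>e x\<bar> \<partial>\<mu>)"
    proof (rule integral_mono)
      have "\<bar>e x\<bar> * \<bar>e x\<bar> \<le> B * \<bar>e x\<bar>" for x using e[of x] by (intro mult_right_mono) auto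
      then show le: "e x * e x \<le> B * \<bar>e x\<bar>" for x by simp
      have "B * \<bar>e x\<bar> \<le> B * B" for x using e[of x] B by (intro mult_left_mono) auto
      then show "integrable \<mu> (\<lambda>x. B * \<bar>e x\<bar>)"
        using B by (intro start.integrable_const_bound[where B="B * B"] AE_I2) (auto simp: abs_mult)
      then show "integrable \<mu> (\<lambda>x. e x * e x)"
        by (rule Bochner_Integration.integrable_bound) (use le B in \<open>auto simp: abs_mult\<close>)
    qed
    also have "\<dots> \<le> B * (\<integral>\<omega>. \<bar>Z h \<omega>\<bar> \<partial>Q)"
      using expectation_le_Q[OF Z[OF h]] B by (simp add: e_def mult_left_mono)
    finally show ?thesis by (simp add: inner_norm_def L2_inner_def e_def)
  qed
  then show "\<forall>\<^sub>F h in at_right 0. norm (L2_norm \<mu> (\<lambda>x. \<integral>\<omega>. Z h \<omega> \<partial>P x)) \<le> sqrt (B * (\<integral>\<omega>. \<bar>Z h \<omega>\<bar> \<partial>Q))"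
    unfolding eventually_at_right_field by (intro exI[of _ 1]) auto
qed

text \<open>Increments of order \<open>h\<close> leave a remainder of order \<open>h\<^sup>2\<close> in the expansion of \<open>G\<close>, so only
  the first order term is left in the limit. The conclusion is stated for expectations as functions of the starting
  point, which is the form of both difference quotients of a mean functional.\<close>

lemma L2_chain_rule:
  fixes x q :: "'w \<Rightarrow> real" and y :: "real \<Rightarrow> 'w \<Rightarrow> real"
  assumes "locally_quadratic_expansion G G'"
    and meas: "x \<in> borel_measurable M" "q \<in> borel_measurable M"
      "\<And>h. 0 < h \<Longrightarrow> h < 1 \<Longrightarrow> y h \<in> borel_measurable M"
    and x: "\<And>\<omega>. \<omega> \<in> space M \<Longrightarrow> \<bar>x \<omega>\<bar> \<le> R"
    and y: "\<And>h \<omega>. 0 < h \<Longrightarrow> h < 1 \<Longrightarrow> \<omega> \<in> space M \<Longrightarrow> \<bar>y h \<omega>\<bar> \<le> R"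
    and yx: "\<And>h \<omega>. 0 < h \<Longrightarrow> h < 1 \<Longrightarrow> \<omega> \<in> space M \<Longrightarrow> \<bar>y h \<omega> - x \<omega>\<bar> \<le> K * h"
    and q: "\<And>\<omega>. \<omega> \<in> space M \<Longrightarrow> \<bar>q \<omega>\<bar> \<le> K"
    and lim: "((\<lambda>h. \<integral>\<omega>. \<bar>(y h \<omega> - x \<omega>) / h - q \<omega>\<bar> \<partial>Q) \<longlongrightarrow> 0) (at_right 0)"
  shows "((\<lambda>h. L2_norm \<mu> (\<lambda>z. ((\<integral>\<omega>. G (y h \<omega>) \<partial>P z) - (\<integral>\<omega>. G (x \<omega>) \<partial>P z)) / h
     - (\<integral>\<omega>. G' (x \<omega>) * q \<omega> \<partial>P z))) \<longlongrightarrow> 0) (at_right 0)"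
proof -
  interpret G: locally_quadratic_expansion G G' by fact
  note [measurable] = meas
  obtain L where L: "0 \<le> L" "\<And>x y. \<bar>x\<bar> \<le> R \<Longrightarrow> \<bar>y\<bar> \<le> R \<Longrightarrow>
      \<bar>G y - G x - G' x * (y - x)\<bar> \<le> L * (y - x)\<^sup>2 \<and> \<bar>G' x\<bar> \<le> L"
    using G.expansion[of R] by blast
  obtain B where B: "\<And>x. \<bar>x\<bar> \<le> R \<Longrightarrow> \<bar>G x\<bar> \<le> B \<and> \<bar>G' x\<bar> \<le> B"
    using G.bounded_on_bounded[of R] by blast
  obtain \<omega>0 where "\<omega>0 \<in> space M" using space_nonempty by blast
  then have K: "0 \<le> K" using q[of \<omega>0] by linarith
  define Z where "Z h \<omega> = (G (y h \<omega>) - G (x \<omega>)) / h - G' (x \<omega>) * q \<omega>" for h \<omega>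
  have Zm: "Z h \<in> borel_measurable M" if "0 < h" "h < 1" for h
    using meas(3)[OF that] unfolding Z_def by measurable
  have Z1: "\<bar>Z h \<omega>\<bar> \<le> L * K\<^sup>2 * h + L * \<bar>(y h \<omega> - x \<omega>) / h - q \<omega>\<bar>"
    if h: "0 < h" "h < 1" and \<omega>: "\<omega> \<in> space M" for h \<omega>
  proof -
    define r where "r = G (y h \<omega>) - G (x \<omega>) - G' (x \<omega>) * (y h \<omega> - x \<omega>)"
    note l = L(2)[OF x[OF \<omega>] y[OF h \<omega>], folded r_def]
    have "Z h \<omega> = r / h + G' (x \<omega>) * ((y h \<omega> - x \<omega>) / h - q \<omega>)"
      using h by (simp add: Z_def r_def field_simps)
    then have "\<bar>Z h \<omega>\<bar> \<le> \<bar>r\<bar> / h + \<bar>G' (x \<omega>)\<bar> * \<bar>(y h \<omega> - x \<omega>) / h - q \<omega>\<bar>"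
      using h abs_triangle_ineq[of "r / h" "G' (x \<omega>) * ((y h \<omega> - x \<omega>) / h - q \<omega>)"]
      by (simp add: abs_mult)
    also have "\<bar>r\<bar> / h \<le> L * (K * h)\<^sup>2 / h"
    proof (rule divide_right_mono)
      have "L * (y h \<omega> - x \<omega>)\<^sup>2 \<le> L * (K * h)\<^sup>2"
        using yx[OF h \<omega>] L(1) by (intro mult_left_mono) (auto simp: abs_le_square_iff[symmetric])
      with l show "\<bar>r\<bar> \<le> L * (K * h)\<^sup>2" by linarith
    qed (use h in auto)
    also have "\<dots> = L * K\<^sup>2 * h" using h by (simp add: power2_eq_square)
    also have "\<bar>G' (x \<omega>)\<bar> * \<bar>(y h \<omega> - x \<omega>) / h - q \<omega>\<bar> \<le> L * \<bar>(y h \<omega> - x \<omega>) / h - q \<omega>\<bar>"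
      using l by (intro mult_right_mono) auto
    finally show ?thesis by simp
  qed
  have D: "\<bar>(y h \<omega> - x \<omega>) / h - q \<omega>\<bar> \<le> 2 * K" if h: "0 < h" "h < 1" and \<omega>: "\<omega> \<in> space M" for h \<omega>
  proof -
    have "\<bar>(y h \<omega> - x \<omega>) / h\<bar> \<le> K" using yx[OF h \<omega>] h by (simp add: abs_divide pos_divide_le_eq)
    then show ?thesis using q[OF \<omega>] by linarith
  qed
  have Z2: "\<bar>Z h \<omega>\<bar> \<le> L * K\<^sup>2 + L * (2 * K)" if h: "0 < h" "h < 1" and \<omega>: "\<omega> \<in> space M" for h \<omega>
  proof -
    have "L * K\<^sup>2 * h \<le> L * K\<^sup>2" using L(1) h by (intro mult_left_le) auto
    moreover have "L * \<bar>(y h \<omega> - x \<omega>) / h - q \<omega>\<bar> \<le> L * (2 * K)"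
      using L(1) D[OF that] by (rule mult_left_mono[rotated])
    ultimately show ?thesis using Z1[OF that] by linarith
  qed
  have "((\<lambda>h. \<integral>\<omega>. \<bar>Z h \<omega>\<bar> \<partial>Q) \<longlongrightarrow> 0) (at_right 0)"
  proof (rule Lim_null_comparison)
    have "((\<lambda>h. L * K\<^sup>2 * h + L * (\<integral>\<omega>. \<bar>(y h \<omega> - x \<omega>) / h - q \<omega>\<bar> \<partial>Q)) \<longlongrightarrow> L * K\<^sup>2 * 0 + L * 0) (at_right 0)"
      by (intro tendsto_intros lim)
    then show "((\<lambda>h. L * K\<^sup>2 * h + L * (\<integral>\<omega>. \<bar>(y h \<omega> - x \<omega>) / h - q \<omega>\<bar> \<partial>Q)) \<longlongrightarrow> 0) (at_right 0)" by simp
    have "norm (\<integral>\<omega>. \<bar>Z h \<omega>\<bar> \<partial>Q) \<le> L * K\<^sup>2 * h + L * (\<integral>\<omega>. \<bar>(y h \<omega> - x \<omega>) / h - q \<omega>\<bar> \<partial>Q)"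
      if h: "0 < h" "h < 1" for h
    proof -
      have i: "integrable Q (\<lambda>\<omega>. \<bar>(y h \<omega> - x \<omega>) / h - q \<omega>\<bar>)"
        using D[OF h] meas(3)[OF h] by (intro integrable_Q[where B="2 * K"]) auto
      have "(\<integral>\<omega>. \<bar>Z h \<omega>\<bar> \<partial>Q) \<le> (\<integral>\<omega>. L * K\<^sup>2 * h + L * \<bar>(y h \<omega> - x \<omega>) / h - q \<omega>\<bar> \<partial>Q)"
        using i Z1[OF h] integrable_Q[OF Zm[OF h] Z2[OF h]] by (intro integral_mono) auto
      then show ?thesis using i by simp
    qed
    then show "\<forall>\<^sub>F h in at_right 0. norm (\<integral>\<omega>. \<bar>Z h \<omega>\<bar> \<partial>Q) \<le>
        L * K\<^sup>2 * h + L * (\<integral>\<omega>. \<bar>(y h \<omega> - x \<omega>) / h - q \<omega>\<bar> \<partial>Q)"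
      unfolding eventually_at_right_field by (intro exI[of _ 1]) auto
  qed
  from L2_norm_expectation_tendsto[OF Zm Z2 this]
  have "((\<lambda>h. L2_norm \<mu> (\<lambda>z. \<integral>\<omega>. Z h \<omega> \<partial>P z)) \<longlongrightarrow> 0) (at_right 0)" by simp
  moreover have "(\<integral>\<omega>. Z h \<omega> \<partial>P z) = ((\<integral>\<omega>. G (y h \<omega>) \<partial>P z) - (\<integral>\<omega>. G (x \<omega>) \<partial>P z)) / h
     - (\<integral>\<omega>. G' (x \<omega>) * q \<omega> \<partial>P z)" if h: "0 < h" "h < 1" for h z
  proof -
    have "integrable (P z) (\<lambda>\<omega>. G (y h \<omega>))" "integrable (P z) (\<lambda>\<omega>. G (x \<omega>))"
      using B x y h meas(3)[OF h] by (auto intro!: integrable_P[where B=B])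
    moreover have "integrable (P z) (\<lambda>\<omega>. G' (x \<omega>) * q \<omega>)"
    proof (rule integrable_P[where B="B * K"])
      fix \<omega> assume \<omega>: "\<omega> \<in> space M"
      show "\<bar>G' (x \<omega>) * q \<omega>\<bar> \<le> B * K"
        unfolding abs_mult using B[OF x[OF \<omega>]] q[OF \<omega>] by (intro mult_mono) auto
    qed measurable
    ultimately show ?thesis unfolding Z_def by simp
  qed
  then have "\<forall>\<^sub>F h in at_right 0. L2_norm \<mu> (\<lambda>z. \<integral>\<omega>. Z h \<omega> \<partial>P z) =
    L2_norm \<mu> (\<lambda>z. ((\<integral>\<omega>. G (y h \<omega>) \<partial>P z) - (\<integral>\<omega>. G (x \<omega>) \<partial>P z)) / h
     - (\<integral>\<omega>. G' (x \<omega>) * q \<omega> \<partial>P z))"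
    unfolding eventually_at_right_field by (intro exI[of _ 1]) auto
  ultimately show ?thesis by (rule Lim_transform_eventually)
qed

end

section \<open>The evolution equation of mean functionals\<close>

locale smooth_time_functional =
  stationary_markov M X P \<mu> + locally_quadratic_expansion G G'
  for M :: "'w measure" and X :: "real \<Rightarrow> 'w \<Rightarrow> 'a::polish_space" and P and \<mu> :: "'a measure"
    and G G' +
  fixes k :: "'a \<Rightarrow> real" and K :: real
  assumes k_measurable [measurable]: "k \<in> borel_measurable borel" and k_bound: "\<And>x. \<bar>k x\<bar> \<le> K"
begin

abbreviation "I \<equiv> time_integral X k"

definition mean_functional :: "real \<Rightarrow> 'a \<Rightarrow> real" where
  "mean_functional t x = (\<integral>\<omega>. G (I 0 t \<omega>) \<partial>P x)"

definition time_derivative :: "real \<Rightarrow> 'a \<Rightarrow> real" where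
  "time_derivative t x = (\<integral>\<omega>. G' (I 0 t \<omega>) * k (X t \<omega>) \<partial>P x)"

definition space_derivative :: "real \<Rightarrow> 'a \<Rightarrow> real" where
  "space_derivative t x = (\<integral>\<omega>. G' (I 0 t \<omega>) * (k (X t \<omega>) - k (X 0 \<omega>)) \<partial>P x)"

lemma K_nonneg: "0 \<le> K"
  using k_bound[of undefined] by linarith

lemma I_measurable [measurable]: "0 \<le> a \<Longrightarrow> I a b \<in> borel_measurable M"
  by (intro X.time_integral_measurable) auto

lemma I_bound: "0 \<le> a \<Longrightarrow> a \<le> b \<Longrightarrow> \<omega> \<in> space M \<Longrightarrow> \<bar>I a b \<omega>\<bar> \<le> K * (b - a)"
  by (intro X.time_integral_bound k_measurable k_bound) auto

lemma I_split: "0 \<le> a \<Longrightarrow> a \<le> r \<Longrightarrow> r \<le> b \<Longrightarrow> \<omega> \<in> space M \<Longrightarrow> I a b \<omega> = I a r \<omega> + I r b \<omega>"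
  by (intro X.time_integral_split[OF k_measurable k_bound]) auto

lemma I_bound_0: "0 \<le> t \<Longrightarrow> t \<le> T \<Longrightarrow> \<omega> \<in> space M \<Longrightarrow> \<bar>I 0 t \<omega>\<bar> \<le> K * T"
  using I_bound[of 0 t \<omega>] mult_left_mono[of t T K] K_nonneg by simp

lemma kX_measurable [measurable]: "0 \<le> t \<Longrightarrow> (\<lambda>\<omega>. k (X t \<omega>)) \<in> borel_measurable M"
  by (rule measurable_compose[OF measurable_X k_measurable])

lemma GI_bound: "\<exists>B. \<forall>t \<omega>. 0 \<le> t \<longrightarrow> t \<le> T \<longrightarrow> \<omega> \<in> space M \<longrightarrow> \<bar>G (I 0 t \<omega>)\<bar> \<le> B \<and> \<bar>G' (I 0 t \<omega>)\<bar> \<le> B"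
  using bounded_on_bounded[of "K * T"] I_bound_0 by meson

lemma mean_functional_bounded: "\<exists>B. \<forall>t x. 0 \<le> t \<longrightarrow> t \<le> T \<longrightarrow> \<bar>mean_functional t x\<bar> \<le> B"
proof -
  obtain B where "\<And>t \<omega>. 0 \<le> t \<Longrightarrow> t \<le> T \<Longrightarrow> \<omega> \<in> space M \<Longrightarrow> \<bar>G (I 0 t \<omega>)\<bar> \<le> B"
    using GI_bound[of T] by blast
  then show ?thesis unfolding mean_functional_def
    by (intro exI[of _ B] allI impI abs_expectation_le) auto
qed

lemma mean_functional_measurable [measurable]: "mean_functional t \<in> borel_measurable borel"
  unfolding mean_functional_def[abs_def] by (intro measurable_expectation) measurable

lemma mean_functional_L2: "0 \<le> t \<Longrightarrow> mean_functional t \<in> L2_fun \<mu>"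
proof -
  assume t: "0 \<le> t"
  then obtain B where "\<And>\<omega>. \<omega> \<in> space M \<Longrightarrow> \<bar>G (I 0 t \<omega>)\<bar> \<le> B" using GI_bound[of t] by blast
  then show ?thesis unfolding mean_functional_def[abs_def] by (intro L2_fun_expectation[where B=B]) auto
qed

lemma derivative_bound:
  assumes t: "0 \<le> t"
  obtains B where "\<And>\<omega>. \<omega> \<in> space M \<Longrightarrow> \<bar>G' (I 0 t \<omega>)\<bar> \<le> B"
    "\<And>\<omega>. \<omega> \<in> space M \<Longrightarrow> \<bar>G' (I 0 t \<omega>) * k (X t \<omega>)\<bar> \<le> B * K"
    "\<And>\<omega>. \<omega> \<in> space M \<Longrightarrow> \<bar>G' (I 0 t \<omega>) * (k (X t \<omega>) - k (X 0 \<omega>))\<bar> \<le> B * (2 * K)"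
proof -
  obtain B where B: "\<And>\<omega>. \<omega> \<in> space M \<Longrightarrow> \<bar>G' (I 0 t \<omega>)\<bar> \<le> B" using GI_bound[of t] t by blast
  show thesis
  proof (rule that[OF B])
    fix \<omega> assume \<omega>: "\<omega> \<in> space M"
    show "\<bar>G' (I 0 t \<omega>) * k (X t \<omega>)\<bar> \<le> B * K"
      unfolding abs_mult using B[OF \<omega>] k_bound by (intro mult_mono) auto
    have "\<bar>k (X t \<omega>) - k (X 0 \<omega>)\<bar> \<le> 2 * K" using k_bound[of "X t \<omega>"] k_bound[of "X 0 \<omega>"] by linarith
    then show "\<bar>G' (I 0 t \<omega>) * (k (X t \<omega>) - k (X 0 \<omega>))\<bar> \<le> B * (2 * K)"
      unfolding abs_mult using B[OF \<omega>] by (intro mult_mono) auto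
  qed
qed

lemma derivatives_L2:
  assumes t: "0 \<le> t"
  shows "time_derivative t \<in> L2_fun \<mu>" "space_derivative t \<in> L2_fun \<mu>"
proof -
  obtain B where "\<And>\<omega>. \<omega> \<in> space M \<Longrightarrow> \<bar>G' (I 0 t \<omega>) * k (X t \<omega>)\<bar> \<le> B * K"
    "\<And>\<omega>. \<omega> \<in> space M \<Longrightarrow> \<bar>G' (I 0 t \<omega>) * (k (X t \<omega>) - k (X 0 \<omega>))\<bar> \<le> B * (2 * K)"
    using derivative_bound[OF t] by metis
  then show "time_derivative t \<in> L2_fun \<mu>" "space_derivative t \<in> L2_fun \<mu>"
    unfolding time_derivative_def[abs_def] space_derivative_def[abs_def] using t
    by (auto intro!: L2_fun_expectation)
qed

text \<open>Once the two derivatives are identified this is the evolution equation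
  \<open>u' = A u + k * E[G' (I 0 t)]\<close>. In time, the integral grows at its right end only; along the
  semigroup, it also shrinks at its left end, by \<open>k (X 0)\<close>, which is \<open>k x\<close> under \<open>P x\<close>.\<close>

lemma time_derivative_eq:
  assumes t: "0 \<le> t"
  shows "time_derivative t x = space_derivative t x + k x * (\<integral>\<omega>. G' (I 0 t \<omega>) \<partial>P x)"
proof -
  obtain B where B: "\<And>\<omega>. \<omega> \<in> space M \<Longrightarrow> \<bar>G' (I 0 t \<omega>)\<bar> \<le> B"
    "\<And>\<omega>. \<omega> \<in> space M \<Longrightarrow> \<bar>G' (I 0 t \<omega>) * k (X t \<omega>)\<bar> \<le> B * K"
    "\<And>\<omega>. \<omega> \<in> space M \<Longrightarrow> \<bar>G' (I 0 t \<omega>) * (k (X t \<omega>) - k (X 0 \<omega>))\<bar> \<le> B * (2 * K)"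
    using derivative_bound[OF t] by metis
  have i: "integrable (P x) (\<lambda>\<omega>. G' (I 0 t \<omega>) * (k (X t \<omega>) - k (X 0 \<omega>)))"
    "integrable (P x) (\<lambda>\<omega>. G' (I 0 t \<omega>))"
    using B t by (auto intro!: integrable_P)
  have "time_derivative t x = (\<integral>\<omega>. G' (I 0 t \<omega>) * (k (X t \<omega>) - k (X 0 \<omega>)) + k x * G' (I 0 t \<omega>) \<partial>P x)"
    unfolding time_derivative_def
  proof (rule integral_cong_AE)
    show "AE \<omega> in P x. G' (I 0 t \<omega>) * k (X t \<omega>) =
        G' (I 0 t \<omega>) * (k (X t \<omega>) - k (X 0 \<omega>)) + k x * G' (I 0 t \<omega>)"
      using start[of x] by eventually_elim (simp add: algebra_simps)
  qed (use t in measurable)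
  then show ?thesis using i by (simp add: space_derivative_def)
qed

lemma mean_functional_time_derivative:
  assumes t: "0 \<le> t"
  shows "((\<lambda>h. L2_norm \<mu> (\<lambda>x. (mean_functional (t + h) x - mean_functional t x) / h - time_derivative t x))
     \<longlongrightarrow> 0) (at_right 0)"
  unfolding mean_functional_def time_derivative_def
proof (rule L2_chain_rule[where R="K * (t + 1)" and K=K])
  show "locally_quadratic_expansion G G'" ..
  have *: "I 0 (t + h) \<omega> - I 0 t \<omega> = I t (t + h) \<omega>" if "0 < h" "\<omega> \<in> space M" for h \<omega>
    using I_split[of 0 t "t + h" \<omega>] t that by simp
  show "\<bar>I 0 t \<omega>\<bar> \<le> K * (t + 1)" if "\<omega> \<in> space M" for \<omega> using t that by (intro I_bound_0) auto
  show "\<bar>I 0 (t + h) \<omega>\<bar> \<le> K * (t + 1)" if "0 < h" "h < 1" "\<omega> \<in> space M" for h \<omega>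
    using t that by (intro I_bound_0) auto
  show "\<bar>I 0 (t + h) \<omega> - I 0 t \<omega>\<bar> \<le> K * h" if "0 < h" "h < 1" "\<omega> \<in> space M" for h \<omega>
    using *[OF that(1,3)] I_bound[of t "t + h" \<omega>] t that by simp
  have "((\<lambda>h. \<integral>\<omega>. \<bar>I t (t + h) \<omega> / h - k (X t \<omega>)\<bar> \<partial>Q) \<longlongrightarrow> 0) (at_right 0)"
    by (rule L1_right_differentiable[OF k_measurable k_bound t])
  then show "((\<lambda>h. \<integral>\<omega>. \<bar>(I 0 (t + h) \<omega> - I 0 t \<omega>) / h - k (X t \<omega>)\<bar> \<partial>Q) \<longlongrightarrow> 0) (at_right 0)"
  proof (rule Lim_transform_eventually)
    show "\<forall>\<^sub>F h in at_right 0. (\<integral>\<omega>. \<bar>I t (t + h) \<omega> / h - k (X t \<omega>)\<bar> \<partial>Q) =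
      (\<integral>\<omega>. \<bar>(I 0 (t + h) \<omega> - I 0 t \<omega>) / h - k (X t \<omega>)\<bar> \<partial>Q)"
      unfolding eventually_at_right_field
      by (intro exI[of _ 1] conjI allI impI Bochner_Integration.integral_cong) (auto simp: *)
  qed
qed (use t k_bound in auto)

text \<open>Markov property: averaging over the state at time \<open>h\<close> shifts the window of the time integral.\<close>

lemma mean_functional_shift:
  assumes h: "0 \<le> h" and t: "0 \<le> t"
  shows "(\<integral>\<omega>. mean_functional t (X h \<omega>) \<partial>P x) = (\<integral>\<omega>. G (I h (h + t) \<omega>) \<partial>P x)"
proof -
  interpret coord: cadlag_on_measurable_space "cadlag_paths t" "{0..t}" "\<lambda>s w. w s :: 'a"
    by (rule coordinate_process)
  define \<Phi> where "\<Phi> w = G (time_integral (\<lambda>s w. w s) k 0 t w)" for w :: "real \<Rightarrow> 'a"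
  obtain B where B: "\<And>x. \<bar>x\<bar> \<le> K * t \<Longrightarrow> \<bar>G x\<bar> \<le> B" using bounded_on_bounded by blast
  have [measurable]: "\<Phi> \<in> borel_measurable (cadlag_paths t)"
    unfolding \<Phi>_def using coord.time_integral_measurable[OF k_measurable, of 0 t] by measurable
  have \<Phi>B: "\<bar>\<Phi> w\<bar> \<le> B" if "w \<in> space (cadlag_paths t)" for w
    unfolding \<Phi>_def using coord.time_integral_bound[OF k_measurable k_bound t _ that] by (intro B) simp
  have S: "(\<lambda>\<omega>. restrict (\<lambda>s. X (h + s) \<omega>) {0..t}) \<in> P x \<rightarrow>\<^sub>M cadlag_paths t"
    using shifted_path_measurable[OF h] by (simp cong: measurable_cong_sets)
  have 0: "(\<lambda>\<omega>. restrict (\<lambda>s. X s \<omega>) {0..t}) \<in> P y \<rightarrow>\<^sub>M cadlag_paths t" for y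
    using X.path_measurable[of t] by (simp cong: measurable_cong_sets)
  have shift: "time_integral (\<lambda>s. X (h + s)) k 0 t \<omega> = I h (h + t) \<omega>" for \<omega>
  proof -
    have "I h (h + t) \<omega> = (\<integral>s. indicator {h..h + t} s *\<^sub>R k (X s \<omega>) \<partial>lborel)"
      by (simp add: time_integral_def set_lebesgue_integral_def)
    also have "\<dots> = (\<integral>s. indicator {h..h + t} (h + s) *\<^sub>R k (X (h + s) \<omega>) \<partial>lborel)"
      using lborel_integral_real_affine[of 1 "\<lambda>s. indicator {h..h + t} s *\<^sub>R k (X s \<omega>)" h] by simp
    also have "\<dots> = time_integral (\<lambda>s. X (h + s)) k 0 t \<omega>"
      unfolding time_integral_def set_lebesgue_integral_def
      by (intro Bochner_Integration.integral_cong) (auto simp: indicator_def)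
    finally show ?thesis ..
  qed
  have K: "(\<lambda>\<omega>. path_law t (P (X h \<omega>)) X) \<in> P x \<rightarrow>\<^sub>M subprob_algebra (cadlag_paths t)"
    using h by (intro measurable_compose[OF _ path_law_measurable]) simp
  have "(\<integral>\<omega>. G (I h (h + t) \<omega>) \<partial>P x) = (\<integral>w. \<Phi> w \<partial>path_law t (P x) (\<lambda>s. X (h + s)))"
    unfolding path_law_def by (subst integral_distr[OF S]) (auto simp: \<Phi>_def time_integral_restrict[of k t "\<lambda>s. X (h + s)"] shift)
  also have "\<dots> = (\<integral>\<omega>. (\<integral>w. \<Phi> w \<partial>path_law t (P (X h \<omega>)) X) \<partial>P x)"
    unfolding path_law_shift[OF h]
  proof (rule integral_bind[OF _ \<Phi>B K, where B'=1])
    show "finite_measure (P x)" by (rule prob_space.finite_measure[OF prob_space_P])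
    show "AE \<omega> in P x. emeasure (path_law t (P (X h \<omega>)) X) (space (path_law t (P (X h \<omega>)) X)) \<le> ennreal 1"
      using prob_space.emeasure_space_1[OF prob_space.prob_space_distr[OF prob_space_P 0]] by (simp add: path_law_def)
  qed auto
  also have "\<dots> = (\<integral>\<omega>. mean_functional t (X h \<omega>) \<partial>P x)"
    unfolding path_law_def mean_functional_def
    by (subst integral_distr[OF 0]) (auto simp: \<Phi>_def time_integral_restrict[of k t X])
  finally show ?thesis ..
qed

text \<open>The semigroup moves the window \<open>{0..t}\<close> to \<open>{h..h + t}\<close>, so the increment of the time
  integral is the gain at the right end minus the loss at the left end.\<close>

lemma mean_functional_has_generator:
  assumes t: "0 \<le> t"
  shows "has_L2_generator \<mu> (transition_semigroup X P) (mean_functional t) (space_derivative t)"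
proof -
  have *: "I h (h + t) \<omega> - I 0 t \<omega> = I t (t + h) \<omega> - I 0 h \<omega>" if "0 < h" "\<omega> \<in> space M" for h \<omega>
    using I_split[of 0 t "t + h" \<omega>] I_split[of 0 h "h + t" \<omega>] t that by (simp add: add.commute)
  have bd: "\<bar>I t (t + h) \<omega>\<bar> \<le> K * h" "\<bar>I 0 h \<omega>\<bar> \<le> K * h" if "0 < h" "\<omega> \<in> space M" for h \<omega>
    using I_bound[of t "t + h" \<omega>] I_bound[of 0 h \<omega>] t that by auto
  have kd: "\<bar>k a - k b\<bar> \<le> 2 * K" for a b using k_bound[of a] k_bound[of b] by linarith
  have "((\<lambda>h. L2_norm \<mu> (\<lambda>x. ((\<integral>\<omega>. G (I h (h + t) \<omega>) \<partial>P x) - (\<integral>\<omega>. G (I 0 t \<omega>) \<partial>P x)) / h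
      - (\<integral>\<omega>. G' (I 0 t \<omega>) * (k (X t \<omega>) - k (X 0 \<omega>)) \<partial>P x))) \<longlongrightarrow> 0) (at_right 0)"
  proof (rule L2_chain_rule[where R="K * (t + 1)" and K="2 * K"])
    show "locally_quadratic_expansion G G'" ..
    show "\<bar>I 0 t \<omega>\<bar> \<le> K * (t + 1)" if "\<omega> \<in> space M" for \<omega> using t that by (intro I_bound_0) auto
    show "\<bar>I h (h + t) \<omega>\<bar> \<le> K * (t + 1)" if "0 < h" "h < 1" "\<omega> \<in> space M" for h \<omega>
      using I_bound[of h "h + t" \<omega>] t that K_nonneg by (simp add: distrib_left)
    show "\<bar>I h (h + t) \<omega> - I 0 t \<omega>\<bar> \<le> 2 * K * h" if "0 < h" "h < 1" "\<omega> \<in> space M" for h \<omega>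
      using *[OF that(1,3)] bd[OF that(1,3)] by simp
    have "((\<lambda>h. (\<integral>\<omega>. \<bar>I t (t + h) \<omega> / h - k (X t \<omega>)\<bar> \<partial>Q) + (\<integral>\<omega>. \<bar>I 0 (0 + h) \<omega> / h - k (X 0 \<omega>)\<bar> \<partial>Q)) \<longlongrightarrow> 0 + 0) (at_right 0)"
      using t by (intro tendsto_add L1_right_differentiable[OF k_measurable k_bound]) auto
    then have lim: "((\<lambda>h. (\<integral>\<omega>. \<bar>I t (t + h) \<omega> / h - k (X t \<omega>)\<bar> \<partial>Q) + (\<integral>\<omega>. \<bar>I 0 h \<omega> / h - k (X 0 \<omega>)\<bar> \<partial>Q)) \<longlongrightarrow> 0) (at_right 0)"
      by simp
    show "((\<lambda>h. \<integral>\<omega>. \<bar>(I h (h + t) \<omega> - I 0 t \<omega>) / h - (k (X t \<omega>) - k (X 0 \<omega>))\<bar> \<partial>Q) \<longlongrightarrow> 0) (at_right 0)"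
    proof (rule Lim_null_comparison[OF _ lim])
      have "norm (\<integral>\<omega>. \<bar>(I h (h + t) \<omega> - I 0 t \<omega>) / h - (k (X t \<omega>) - k (X 0 \<omega>))\<bar> \<partial>Q)
        \<le> (\<integral>\<omega>. \<bar>I t (t + h) \<omega> / h - k (X t \<omega>)\<bar> \<partial>Q) + (\<integral>\<omega>. \<bar>I 0 h \<omega> / h - k (X 0 \<omega>)\<bar> \<partial>Q)"
        if h: "0 < h" for h
      proof -
        have b: "\<bar>I t (t + h) \<omega> / h - k (X t \<omega>)\<bar> \<le> 2 * K" "\<bar>I 0 h \<omega> / h - k (X 0 \<omega>)\<bar> \<le> 2 * K"
          if \<omega>: "\<omega> \<in> space M" for \<omega>
        proof -
          have "\<bar>I t (t + h) \<omega> / h\<bar> \<le> K" "\<bar>I 0 h \<omega> / h\<bar> \<le> K"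
            using bd[OF h \<omega>] h by (auto simp: abs_divide pos_divide_le_eq)
          then show "\<bar>I t (t + h) \<omega> / h - k (X t \<omega>)\<bar> \<le> 2 * K" "\<bar>I 0 h \<omega> / h - k (X 0 \<omega>)\<bar> \<le> 2 * K"
            using k_bound[of "X t \<omega>"] k_bound[of "X 0 \<omega>"] by linarith+
        qed
        have i: "integrable Q (\<lambda>\<omega>. \<bar>I t (t + h) \<omega> / h - k (X t \<omega>)\<bar>)" "integrable Q (\<lambda>\<omega>. \<bar>I 0 h \<omega> / h - k (X 0 \<omega>)\<bar>)"
          using b t by (auto intro!: integrable_Q[where B="2 * K"])
        have pt: "\<bar>(I h (h + t) \<omega> - I 0 t \<omega>) / h - (k (X t \<omega>) - k (X 0 \<omega>))\<bar>
          \<le> \<bar>I t (t + h) \<omega> / h - k (X t \<omega>)\<bar> + \<bar>I 0 h \<omega> / h - k (X 0 \<omega>)\<bar>" if "\<omega> \<in> space M" for \<omega>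
          unfolding *[OF h that] diff_divide_distrib by linarith
        have "integrable Q (\<lambda>\<omega>. \<bar>(I h (h + t) \<omega> - I 0 t \<omega>) / h - (k (X t \<omega>) - k (X 0 \<omega>))\<bar>)"
        proof (rule integrable_Q[where B="4 * K"])
          show "(\<lambda>\<omega>. \<bar>(I h (h + t) \<omega> - I 0 t \<omega>) / h - (k (X t \<omega>) - k (X 0 \<omega>))\<bar>) \<in> borel_measurable M"
          proof -
            note [measurable] = I_measurable[OF less_imp_le[OF h], of "h + t"] I_measurable[OF order_refl, of t]
              kX_measurable[OF t] kX_measurable[OF order_refl]
            show ?thesis by measurable
          qed
          fix \<omega> assume \<omega>: "\<omega> \<in> space M"
          show "\<bar>\<bar>(I h (h + t) \<omega> - I 0 t \<omega>) / h - (k (X t \<omega>) - k (X 0 \<omega>))\<bar>\<bar> \<le> 4 * K"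
            using pt[OF \<omega>] b[OF \<omega>] by simp
        qed
        then have "(\<integral>\<omega>. \<bar>(I h (h + t) \<omega> - I 0 t \<omega>) / h - (k (X t \<omega>) - k (X 0 \<omega>))\<bar> \<partial>Q)
          \<le> (\<integral>\<omega>. \<bar>I t (t + h) \<omega> / h - k (X t \<omega>)\<bar> + \<bar>I 0 h \<omega> / h - k (X 0 \<omega>)\<bar> \<partial>Q)"
          using i pt by (intro integral_mono Bochner_Integration.integrable_add) auto
        then show ?thesis using i by simp
      qed
      then show "\<forall>\<^sub>F h in at_right 0. norm (\<integral>\<omega>. \<bar>(I h (h + t) \<omega> - I 0 t \<omega>) / h - (k (X t \<omega>) - k (X 0 \<omega>))\<bar> \<partial>Q)
        \<le> (\<integral>\<omega>. \<bar>I t (t + h) \<omega> / h - k (X t \<omega>)\<bar> \<partial>Q) + (\<integral>\<omega>. \<bar>I 0 h \<omega> / h - k (X 0 \<omega>)\<bar> \<partial>Q)"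
        unfolding eventually_at_right_field by (intro exI[of _ 1]) auto
    qed
  qed (use t kd in auto)
  then have "((\<lambda>h. L2_norm \<mu> (\<lambda>x. (transition_semigroup X P h (mean_functional t) x - mean_functional t x) / h
      - space_derivative t x)) \<longlongrightarrow> 0) (at_right 0)"
  proof (rule Lim_transform_eventually)
    show "\<forall>\<^sub>F h in at_right 0. L2_norm \<mu> (\<lambda>x. ((\<integral>\<omega>. G (I h (h + t) \<omega>) \<partial>P x) - (\<integral>\<omega>. G (I 0 t \<omega>) \<partial>P x)) / h
        - (\<integral>\<omega>. G' (I 0 t \<omega>) * (k (X t \<omega>) - k (X 0 \<omega>)) \<partial>P x))
      = L2_norm \<mu> (\<lambda>x. (transition_semigroup X P h (mean_functional t) x - mean_functional t x) / h
        - space_derivative t x)"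
      unfolding eventually_at_right_field
      by (intro exI[of _ 1] conjI allI impI)
        (simp_all add: transition_semigroup_def mean_functional_shift t space_derivative_def mean_functional_def[symmetric])
  qed
  then show ?thesis
    using mean_functional_L2[OF t] derivatives_L2(2)[OF t] by (simp add: has_L2_generator_def)
qed

lemma mean_functional_Lipschitz:
  "\<exists>L\<ge>0. \<forall>s t x. 0 \<le> s \<longrightarrow> s \<le> T \<longrightarrow> 0 \<le> t \<longrightarrow> t \<le> T \<longrightarrow>
     \<bar>mean_functional t x - mean_functional s x\<bar> \<le> L * \<bar>t - s\<bar>"
proof -
  obtain L where L: "0 \<le> L" "\<And>x y. \<bar>x\<bar> \<le> K * T \<Longrightarrow> \<bar>y\<bar> \<le> K * T \<Longrightarrow> \<bar>G y - G x\<bar> \<le> L * \<bar>y - x\<bar>"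
    using Lipschitz_on_bounded[of "K * T"] by blast
  obtain B where B: "\<And>t \<omega>. 0 \<le> t \<Longrightarrow> t \<le> T \<Longrightarrow> \<omega> \<in> space M \<Longrightarrow> \<bar>G (I 0 t \<omega>)\<bar> \<le> B"
    using GI_bound[of T] by blast
  have le: "\<bar>mean_functional t x - mean_functional s x\<bar> \<le> L * K * (t - s)" if st: "0 \<le> s" "s \<le> t" "t \<le> T" for s t x
  proof -
    have "mean_functional t x - mean_functional s x = (\<integral>\<omega>. G (I 0 t \<omega>) - G (I 0 s \<omega>) \<partial>P x)"
      unfolding mean_functional_def using st
      by (intro Bochner_Integration.integral_diff[symmetric] integrable_P[where B=B] B) auto
    also have "\<bar>\<dots>\<bar> \<le> L * K * (t - s)"
    proof (rule abs_expectation_le)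
      fix \<omega> assume \<omega>: "\<omega> \<in> space M"
      have "\<bar>G (I 0 t \<omega>) - G (I 0 s \<omega>)\<bar> \<le> L * \<bar>I 0 t \<omega> - I 0 s \<omega>\<bar>"
        using st \<omega> by (intro L(2) I_bound_0) auto
      also have "\<bar>I 0 t \<omega> - I 0 s \<omega>\<bar> \<le> K * (t - s)"
        using I_split[of 0 s t \<omega>] I_bound[of s t \<omega>] st \<omega> by simp
      finally show "\<bar>G (I 0 t \<omega>) - G (I 0 s \<omega>)\<bar> \<le> L * K * (t - s)"
        using L(1) by (simp add: mult_left_mono mult.assoc)
    qed measurable
    finally show ?thesis .
  qed
  have "\<bar>mean_functional t x - mean_functional s x\<bar> \<le> L * K * \<bar>t - s\<bar>"
    if "0 \<le> s" "s \<le> T" "0 \<le> t" "t \<le> T" for s t x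
    using le[of s t x] le[of t s x] that by (cases "s \<le> t") (auto simp: abs_minus_commute)
  then show ?thesis using L(1) K_nonneg by (intro exI[of _ "L * K"]) auto
qed

lemma mean_functional_0: "mean_functional 0 x = G 0"
proof -
  interpret prob_space "P x" by (rule prob_space_P)
  have "mean_functional 0 x = (\<integral>\<omega>. G 0 \<partial>P x)"
    unfolding mean_functional_def
    by (intro Bochner_Integration.integral_cong refl) (use I_bound[of 0 0] in fastforce)
  then show ?thesis using prob_space by simp
qed

end

section \<open>Energy estimates\<close>

context equivalent_inner_product
begin

lemma inner_norm_le_sup:
  assumes g: "g \<in> borel_measurable M" "\<And>x. \<bar>g x\<bar> \<le> B"
  shows "inner_norm ip g \<le> C * B"
proof -
  have B: "0 \<le> B" using g(2)[of undefined] by linarith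
  have g2: "g \<in> L2_fun M" by (rule L2_fun_bounded[OF g])
  have "(g x)\<^sup>2 \<le> B\<^sup>2" for x using g(2)[of x] by (auto simp: abs_le_square_iff[symmetric])
  then have "(\<integral>x. (g x)\<^sup>2 \<partial>M) \<le> B\<^sup>2"
    by (intro integral_le_const L2_funD(2)[OF g2]) auto
  then have "L2_norm M g \<le> sqrt (B\<^sup>2)"
    unfolding inner_norm_def L2_inner_def by (intro real_sqrt_le_mono) (simp add: power2_eq_square)
  then have "L2_norm M g \<le> B" using B by simp
  then have "C * L2_norm M g \<le> C * B" using c_pos c_le_C by (intro mult_left_mono) auto
  with inner_norm_le[OF g2] show ?thesis by linarith
qed

lemma inner_norm_tendsto_0:
  assumes e: "\<forall>\<^sub>F h in F. e h \<in> L2_fun M" and lim: "((\<lambda>h. L2_norm M (e h)) \<longlongrightarrow> 0) F"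
  shows "((\<lambda>h. inner_norm ip (e h)) \<longlongrightarrow> 0) F"
proof (rule Lim_null_comparison)
  show "\<forall>\<^sub>F h in F. norm (inner_norm ip (e h)) \<le> C * L2_norm M (e h)"
    using e by eventually_elim (use inner_norm_le inner_norm_nonneg in auto)
  show "((\<lambda>h. C * L2_norm M (e h)) \<longlongrightarrow> 0) F" using lim by (rule tendsto_mult_right_zero)
qed

lemma energy_right_derivative:
  assumes u: "\<And>t. 0 \<le> t \<Longrightarrow> u t \<in> L2_fun M" and D: "D \<in> L2_fun M" and t: "0 \<le> t"
    and lim: "((\<lambda>h. L2_norm M (\<lambda>x. (u (t + h) x - u t x) / h - D x)) \<longlongrightarrow> 0) (at_right 0)"
  shows "((\<lambda>t. (inner_norm ip (u t))\<^sup>2) has_real_derivative 2 * ip D (u t)) (at_right t)"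
  unfolding has_real_derivative_at_right_iff
proof -
  define e where "e h x = (1 / h) * (u (t + h) x - u t x) - D x" for h x
  have e: "e h \<in> L2_fun M" if "0 < h" for h
    unfolding e_def using t that by (intro L2_fun_diff L2_fun_scale u D) auto
  have ev: "\<forall>\<^sub>F h in at_right 0. e h \<in> L2_fun M"
    unfolding eventually_at_right_field using e by (intro exI[of _ 1]) auto
  have ne: "((\<lambda>h. inner_norm ip (e h)) \<longlongrightarrow> 0) (at_right 0)"
    using lim by (intro inner_norm_tendsto_0 ev) (simp add: e_def[abs_def])
  have h0: "((\<lambda>h. h) \<longlongrightarrow> (0::real)) (at_right 0)" by (rule tendsto_ident_at)
  (* Substituting u (t + h) = u t + h * (D + e h) leaves terms that vanish with e h or with h. *)
  have quot: "((inner_norm ip (u (t + h)))\<^sup>2 - (inner_norm ip (u t))\<^sup>2) / h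
      = 2 * ip D (u t) + (2 * ip (e h) (u t) + h * ip (\<lambda>x. D x + e h x) (\<lambda>x. D x + e h x))" if h: "0 < h" for h
  proof -
    define d where "d x = D x + e h x" for x
    have d: "d \<in> L2_fun M" unfolding d_def by (intro L2_fun_add D e h)
    have uh: "u (t + h) = (\<lambda>x. u t x + h * d x)" using h by (auto simp: d_def e_def field_simps)
    have "ip (u (t + h)) (u (t + h)) = ip (u t) (u t) + 2 * (h * ip (u t) d) + h * (h * ip d d)"
      unfolding uh using u[OF t] d by (simp add: ip_add_self L2_fun_scale ip_scale ip_scale2)
    moreover have "ip (u t) d = ip D (u t) + ip (e h) (u t)"
      using u[OF t] D e[OF h] unfolding d_def
      by (simp add: ip_add2 ip_commute[of "u t"])
    ultimately show ?thesis
      using h t u by (simp add: inner_norm_square d_def[abs_def] field_simps)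
  qed
  have rest: "((\<lambda>h. 2 * ip (e h) (u t) + h * ip (\<lambda>x. D x + e h x) (\<lambda>x. D x + e h x)) \<longlongrightarrow> 0) (at_right 0)"
  proof (rule Lim_null_comparison)
    let ?b = "\<lambda>h. 2 * (inner_norm ip (e h) * inner_norm ip (u t)) + h * (inner_norm ip D + inner_norm ip (e h))\<^sup>2"
    have "(?b \<longlongrightarrow> 2 * (0 * inner_norm ip (u t)) + 0 * (inner_norm ip D + 0)\<^sup>2) (at_right 0)"
      by (intro tendsto_intros ne h0)
    then show "(?b \<longlongrightarrow> 0) (at_right 0)" by simp
    have "norm (2 * ip (e h) (u t) + h * ip (\<lambda>x. D x + e h x) (\<lambda>x. D x + e h x)) \<le> ?b h" if h: "0 < h" for h
    proof -
      have s: "(\<lambda>x. D x + e h x) \<in> L2_fun M" by (intro L2_fun_add D e h)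
      have "\<bar>ip (e h) (u t)\<bar> \<le> inner_norm ip (e h) * inner_norm ip (u t)"
        using e[OF h] u[OF t] by (rule Cauchy_Schwarz)
      moreover have "ip (\<lambda>x. D x + e h x) (\<lambda>x. D x + e h x) \<le> (inner_norm ip D + inner_norm ip (e h))\<^sup>2"
        using power_mono[OF inner_norm_triangle[OF D e[OF h]] inner_norm_nonneg[OF s], of 2]
        by (simp add: inner_norm_square[OF s])
      then have "h * ip (\<lambda>x. D x + e h x) (\<lambda>x. D x + e h x) \<le> h * (inner_norm ip D + inner_norm ip (e h))\<^sup>2"
        using h by (intro mult_left_mono) auto
      moreover have "0 \<le> h * ip (\<lambda>x. D x + e h x) (\<lambda>x. D x + e h x)"
        using h ip_nonneg[OF s] by simp
      ultimately show ?thesis unfolding real_norm_def by linarith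
    qed
    then show "\<forall>\<^sub>F h in at_right 0. norm (2 * ip (e h) (u t) + h * ip (\<lambda>x. D x + e h x) (\<lambda>x. D x + e h x)) \<le> ?b h"
      unfolding eventually_at_right_field by (intro exI[of _ 1]) auto
  qed
  have "((\<lambda>h. 2 * ip D (u t) + (2 * ip (e h) (u t) + h * ip (\<lambda>x. D x + e h x) (\<lambda>x. D x + e h x)))
      \<longlongrightarrow> 2 * ip D (u t) + 0) (at_right 0)"
    by (intro tendsto_add tendsto_const rest)
  then have "((\<lambda>h. 2 * ip D (u t) + (2 * ip (e h) (u t) + h * ip (\<lambda>x. D x + e h x) (\<lambda>x. D x + e h x)))
      \<longlongrightarrow> 2 * ip D (u t)) (at_right 0)" by simp
  then show "((\<lambda>h. ((inner_norm ip (u (t + h)))\<^sup>2 - (inner_norm ip (u t))\<^sup>2) / h) \<longlongrightarrow> 2 * ip D (u t)) (at_right 0)"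
  proof (rule Lim_transform_eventually)
    show "\<forall>\<^sub>F h in at_right 0. 2 * ip D (u t) + (2 * ip (e h) (u t) + h * ip (\<lambda>x. D x + e h x) (\<lambda>x. D x + e h x))
        = ((inner_norm ip (u (t + h)))\<^sup>2 - (inner_norm ip (u t))\<^sup>2) / h"
      unfolding eventually_at_right_field using quot by (intro exI[of _ 1]) auto
  qed
qed

lemma energy_continuous:
  assumes u: "\<And>t. u t \<in> borel_measurable M"
    and B: "\<And>t x. 0 \<le> t \<Longrightarrow> t \<le> T \<Longrightarrow> \<bar>u t x\<bar> \<le> B"
    and Lip: "0 \<le> L" "\<And>s t x. \<lbrakk>0 \<le> s; s \<le> T; 0 \<le> t; t \<le> T\<rbrakk> \<Longrightarrow> \<bar>u t x - u s x\<bar> \<le> L * \<bar>t - s\<bar>"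
  shows "continuous_on {0..T} (\<lambda>t. (inner_norm ip (u t))\<^sup>2)"
proof -
  have "(C * L * (2 * (C * B)))-lipschitz_on {0..T} (\<lambda>t. (inner_norm ip (u t))\<^sup>2)" if "0 \<le> T"
  proof (rule lipschitz_onI)
    have C: "0 \<le> C" using c_pos c_le_C by linarith
    have B0: "0 \<le> B" using B[of 0 undefined] \<open>0 \<le> T\<close> by force
    show "0 \<le> C * L * (2 * (C * B))" using C B0 Lip(1) by simp
    fix t s assume t: "t \<in> {0..T}" and s: "s \<in> {0..T}"
    have L2: "u t \<in> L2_fun M" "u s \<in> L2_fun M" using s t B by (auto intro!: L2_fun_bounded u)
    have d: "(\<lambda>x. u t x - u s x) \<in> L2_fun M" and a: "(\<lambda>x. u t x + u s x) \<in> L2_fun M"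
      using L2 by (auto intro: L2_fun_diff L2_fun_add)
    have n: "inner_norm ip (u t) \<le> C * B" "inner_norm ip (u s) \<le> C * B"
      using s t B by (auto intro!: inner_norm_le_sup u)
    have "(inner_norm ip (u t))\<^sup>2 - (inner_norm ip (u s))\<^sup>2 = ip (\<lambda>x. u t x - u s x) (\<lambda>x. u t x + u s x)"
      using L2 by (simp add: inner_norm_square ip_diff ip_add2 L2_fun_add ip_commute[of "u s" "u t"])
    also have "\<bar>\<dots>\<bar> \<le> inner_norm ip (\<lambda>x. u t x - u s x) * inner_norm ip (\<lambda>x. u t x + u s x)"
      by (rule Cauchy_Schwarz[OF d a])
    also have "\<dots> \<le> (C * (L * \<bar>t - s\<bar>)) * (C * B + C * B)"
    proof (rule mult_mono)
      show "inner_norm ip (\<lambda>x. u t x - u s x) \<le> C * (L * \<bar>t - s\<bar>)"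
        using s t Lip(2) by (intro inner_norm_le_sup borel_measurable_diff u) auto
      show "inner_norm ip (\<lambda>x. u t x + u s x) \<le> C * B + C * B"
        using inner_norm_triangle[OF L2] n by linarith
    qed (use C Lip(1) inner_norm_nonneg[OF a] in auto)
    finally show "dist ((inner_norm ip (u t))\<^sup>2) ((inner_norm ip (u s))\<^sup>2) \<le> C * L * (2 * (C * B)) * dist t s"
      by (simp add: dist_real_def algebra_simps)
  qed
  then show ?thesis by (cases "0 \<le> T") (auto intro: lipschitz_on_continuous_on)
qed

end

section \<open>Consequences of the Poincare inequality\<close>

locale poincare_markov = stationary_markov M X P \<mu> + equivalent_inner_product \<mu> ip c C
  for M :: "'w measure" and X :: "real \<Rightarrow> 'w \<Rightarrow> 'a::polish_space" and P and \<mu> :: "'a measure"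
    and ip and c C :: real +
  fixes \<alpha> :: real
  assumes \<alpha>_pos: "0 < \<alpha>"
    and ip_one: "\<And>g. g \<in> L2_fun \<mu> \<Longrightarrow> ip g (\<lambda>_. 1) = L2_inner \<mu> g (\<lambda>_. 1)"
    and poincare: "\<And>g. \<lbrakk>g \<in> generator_domain \<mu> (transition_semigroup X P); (\<integral>x. g x \<partial>\<mu>) = 0\<rbrakk> \<Longrightarrow>
      (inner_norm ip g)\<^sup>2 \<le> \<alpha> * ip (\<lambda>x. - generator \<mu> (transition_semigroup X P) g x) g"
begin

abbreviation "S \<equiv> transition_semigroup X P"

lemma const_L2: "(\<lambda>_. r) \<in> L2_fun \<mu>"
  by (rule start.L2_fun_bounded[where K="\<bar>r\<bar>"]) auto

lemma ip_one_integral: "g \<in> L2_fun \<mu> \<Longrightarrow> ip g (\<lambda>_. 1) = (\<integral>x. g x \<partial>\<mu>)"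
  by (simp add: ip_one L2_inner_def)

lemma inner_norm_one: "inner_norm ip (\<lambda>_. 1) = 1"
  using ip_one_integral[OF const_L2, of 1] start.prob_space by (simp add: inner_norm_def)

lemma bounded_L2: "g \<in> borel_measurable borel \<Longrightarrow> (\<And>x. \<bar>g x\<bar> \<le> B) \<Longrightarrow> g \<in> L2_fun \<mu>"
  by (rule start.L2_fun_bounded) (simp_all add: borel_measurable_\<mu>)

lemma bounded_integrable:
  fixes g :: "'a \<Rightarrow> real"
  shows "g \<in> borel_measurable borel \<Longrightarrow> (\<And>x. \<bar>g x\<bar> \<le> B) \<Longrightarrow> integrable \<mu> g"
proof -
  assume g: "g \<in> borel_measurable borel" "\<And>x. \<bar>g x\<bar> \<le> B"
  show ?thesis
    by (rule start.integrable_const_bound[of g B, OF AE_I2 borel_measurable_\<mu>[THEN iffD2, OF g(1)]]) (simp add: g(2))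
qed

context
  fixes g :: "'a \<Rightarrow> real" and B :: real
  assumes g: "g \<in> borel_measurable borel" "\<And>x. \<bar>g x\<bar> \<le> B"
begin

lemma g_X_measurable: "0 \<le> t \<Longrightarrow> (\<lambda>\<omega>. g (X t \<omega>)) \<in> borel_measurable M"
  by (rule measurable_compose[OF measurable_X g(1)])

lemma S_measurable: "0 \<le> t \<Longrightarrow> S t g \<in> borel_measurable borel"
  unfolding transition_semigroup_def[abs_def] by (intro measurable_expectation g_X_measurable)

lemma S_bound: "0 \<le> t \<Longrightarrow> \<bar>S t g x\<bar> \<le> B"
  unfolding transition_semigroup_def using g by (intro abs_expectation_le g_X_measurable)

lemma S_integral: "0 \<le> t \<Longrightarrow> (\<integral>x. S t g x \<partial>\<mu>) = (\<integral>x. g x \<partial>\<mu>)"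
proof -
  assume t: "0 \<le> t"
  have "(\<integral>x. (\<integral>\<omega>. g (X t \<omega>) \<partial>P x) \<partial>\<mu>) = (\<integral>\<omega>. g (X t \<omega>) \<partial>Q)"
    by (rule integral_Q[OF g_X_measurable[OF t] g(2), symmetric])
  also have "\<dots> = (\<integral>x. g x \<partial>\<mu>)" by (rule integral_X[OF t g(1)])
  finally show ?thesis by (simp add: transition_semigroup_def)
qed

lemma S_minus_const: "0 \<le> t \<Longrightarrow> S t (\<lambda>x. g x - m) x = S t g x - m"
proof -
  assume t: "0 \<le> t"
  interpret prob_space "P x" by (rule prob_space_P)
  show ?thesis
    unfolding transition_semigroup_def
    using integrable_P[OF g_X_measurable[OF t] g(2), of x] prob_space by simp
qed

lemma difference_quotient_L2: "0 < t \<Longrightarrow> (\<lambda>x. (S t g x - g x) / t) \<in> L2_fun \<mu>"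
proof -
  assume t: "0 < t"
  have "S t g \<in> L2_fun \<mu>" using t by (intro bounded_L2[OF S_measurable S_bound]) auto
  from L2_fun_scale[OF L2_fun_diff[OF this bounded_L2[OF g]], of "1 / t"] show ?thesis by simp
qed

lemma generator_integral:
  assumes a: "has_L2_generator \<mu> S g a"
  shows "(\<integral>x. a x \<partial>\<mu>) = 0"
proof -
  have a2: "a \<in> L2_fun \<mu>" and lim: "((\<lambda>t. L2_norm \<mu> (\<lambda>x. (S t g x - g x) / t - a x)) \<longlongrightarrow> 0) (at_right 0)"
    using a by (auto simp: has_L2_generator_def)
  have int_a: "integrable \<mu> a" using integrable_mult_L2[OF a2 const_L2[of 1]] by simp
  have "\<bar>\<integral>x. a x \<partial>\<mu>\<bar> \<le> L2_norm \<mu> (\<lambda>x. (S t g x - g x) / t - a x)" if t: "0 < t" for t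
  proof -
    have q: "(\<lambda>x. (S t g x - g x) / t - a x) \<in> L2_fun \<mu>"
      by (intro L2_fun_diff difference_quotient_L2 t a2)
    have "integrable \<mu> (S t g)" using t by (intro bounded_integrable[OF S_measurable S_bound]) auto
    then have "(\<integral>x. (S t g x - g x) / t - a x \<partial>\<mu>) = - (\<integral>x. a x \<partial>\<mu>)"
      using int_a bounded_integrable[OF g] S_integral[of t] t by simp
    then show ?thesis
      using L2.Cauchy_Schwarz[OF q const_L2[of 1]] start.prob_space
      by (simp add: L2_inner_def inner_norm_def[of _ "\<lambda>_. 1"])
  qed
  then have "\<bar>\<integral>x. a x \<partial>\<mu>\<bar> \<le> 0"
    by (intro tendsto_lowerbound[OF lim]) (auto simp: eventually_at_right_field intro!: exI[of _ 1])
  then show ?thesis by simp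
qed

text \<open>The generator is a choice among its versions, so the Poincare inequality has to be carried over
  to the version at hand.\<close>

lemma generator_unique:
  assumes a: "has_L2_generator \<mu> S g a" and a': "has_L2_generator \<mu> S g a'"
  shows "AE x in \<mu>. a x = a' x"
proof -
  have a2: "a \<in> L2_fun \<mu>" "a' \<in> L2_fun \<mu>"
    and lim: "((\<lambda>t. L2_norm \<mu> (\<lambda>x. (S t g x - g x) / t - a x)) \<longlongrightarrow> 0) (at_right 0)"
      "((\<lambda>t. L2_norm \<mu> (\<lambda>x. (S t g x - g x) / t - a' x)) \<longlongrightarrow> 0) (at_right 0)"
    using a a' by (auto simp: has_L2_generator_def)
  have d: "(\<lambda>x. a x - a' x) \<in> L2_fun \<mu>" by (intro L2_fun_diff a2)
  have "L2_norm \<mu> (\<lambda>x. a x - a' x) \<le> L2_norm \<mu> (\<lambda>x. (S t g x - g x) / t - a' x)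
      + L2_norm \<mu> (\<lambda>x. (S t g x - g x) / t - a x)" if t: "0 < t" for t
    using L2.inner_norm_triangle_diff[OF L2_fun_diff[OF difference_quotient_L2[OF t] a2(2)]
        L2_fun_diff[OF difference_quotient_L2[OF t] a2(1)]] by simp
  then have "L2_norm \<mu> (\<lambda>x. a x - a' x) \<le> 0 + 0"
    by (intro tendsto_lowerbound[OF tendsto_add[OF lim(2,1)]])
      (auto simp: eventually_at_right_field intro!: exI[of _ 1])
  then have "L2_inner \<mu> (\<lambda>x. a x - a' x) (\<lambda>x. a x - a' x) = 0"
    using L2.inner_norm_nonneg[OF d] by (simp add: inner_norm_def)
  from L2.ip_definite[OF d this] show ?thesis by simp
qed

text \<open>The inequality extends to functions with nonzero mean because constants are orthogonal to the
  range of the generator in both inner products.\<close>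

lemma dirichlet_form_le:
  assumes a: "has_L2_generator \<mu> S g a" and m: "m = (\<integral>x. g x \<partial>\<mu>)"
  shows "ip a g \<le> - (inner_norm ip (\<lambda>x. g x - m))\<^sup>2 / \<alpha>"
proof -
  define g0 where "g0 x = g x - m" for x
  have g0: "g0 \<in> borel_measurable borel" "\<bar>g0 x\<bar> \<le> B + \<bar>m\<bar>" for x
    using g(1) g(2)[of x] by (simp add: g0_def[abs_def]) (unfold g0_def, use g(2)[of x] in linarith)
  have g2: "g \<in> L2_fun \<mu>" and g02: "g0 \<in> L2_fun \<mu>" and a2: "a \<in> L2_fun \<mu>"
    using a bounded_L2[OF g0] by (auto simp: has_L2_generator_def)
  have "((\<lambda>t. L2_norm \<mu> (\<lambda>x. (S t g0 x - g0 x) / t - a x)) \<longlongrightarrow> 0) (at_right 0)"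
  proof (rule Lim_transform_eventually)
    show "((\<lambda>t. L2_norm \<mu> (\<lambda>x. (S t g x - g x) / t - a x)) \<longlongrightarrow> 0) (at_right 0)"
      using a by (simp add: has_L2_generator_def)
    show "\<forall>\<^sub>F t in at_right 0. L2_norm \<mu> (\<lambda>x. (S t g x - g x) / t - a x)
        = L2_norm \<mu> (\<lambda>x. (S t g0 x - g0 x) / t - a x)"
      unfolding eventually_at_right_field g0_def[abs_def]
      by (intro exI[of _ 1]) (auto simp: S_minus_const)
  qed
  then have gen: "has_L2_generator \<mu> S g0 a" using g02 a2 by (simp add: has_L2_generator_def)
  have "has_L2_generator \<mu> S g0 (generator \<mu> S g0)"
    unfolding generator_def by (rule someI[of "has_L2_generator \<mu> S g0", OF gen])
  then have gen': "generator \<mu> S g0 \<in> L2_fun \<mu>" "AE x in \<mu>. generator \<mu> S g0 x = a x"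
    using poincare_markov.generator_unique[OF poincare_markov_axioms g0 _ gen] by (auto simp: has_L2_generator_def)
  have int_g: "integrable \<mu> g" by (rule bounded_integrable[OF g])
  have mean0: "(\<integral>x. g0 x \<partial>\<mu>) = 0" unfolding g0_def using int_g m start.prob_space by simp
  have "(inner_norm ip g0)\<^sup>2 \<le> \<alpha> * ip (\<lambda>x. - generator \<mu> S g0 x) g0"
    using gen mean0 by (intro poincare) (auto simp: generator_domain_def)
  also have "ip (\<lambda>x. - generator \<mu> S g0 x) g0 = - ip a g0"
    using ip_scale[OF gen'(1) g02, of "-1"] ip_cong[OF gen'(1) a2 g02 gen'(2)] by simp
  finally have "ip a g0 \<le> - (inner_norm ip g0)\<^sup>2 / \<alpha>" using \<alpha>_pos by (simp add: field_simps)
  moreover have "ip a g = ip a g0"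
  proof -
    have "g = (\<lambda>x. g0 x + m * 1)" by (simp add: g0_def)
    then have "ip a g = ip a g0 + m * ip a (\<lambda>_. 1)"
      using ip_add2[OF a2 g02 L2_fun_scale[OF const_L2[of 1], of m]] ip_scale2[OF a2 const_L2[of 1], of m] by simp
    also have "ip a (\<lambda>_. 1) = 0" using generator_integral[OF a] ip_one_integral[OF a2] by simp
    finally show ?thesis by simp
  qed
  ultimately show ?thesis by (simp add: g0_def[abs_def])
qed

end

lemma b_const_nonneg: "0 \<le> b_const \<mu> ip \<alpha> h"
  using \<alpha>_pos by (simp add: b_const_def)

lemma v_const_nonneg: "0 \<le> v_const \<mu> ip \<alpha> h"
  using \<alpha>_pos by (simp add: v_const_def)

context
  fixes h :: "'a \<Rightarrow> real" and H :: real
  assumes h: "h \<in> borel_measurable borel" "\<And>x. \<bar>h x\<bar> \<le> H" and h_mean: "(\<integral>x. h x \<partial>\<mu>) = 0"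
begin

lemma h_\<mu>: "h \<in> borel_measurable \<mu>"
  using h(1) by (simp add: borel_measurable_\<mu>)

lemma mult_op_L2: "g \<in> L2_fun \<mu> \<Longrightarrow> mult_op h g \<in> L2_fun \<mu>"
  unfolding mult_op_def by (rule L2_fun_mult_bounded[OF h_\<mu> h(2)])

text \<open>The supremum in \<open>b_const\<close> is an upper bound because multiplication by the bounded function \<open>h\<close> is a
  bounded operator; scaling removes the normalisation.\<close>

lemma b_const_bound:
  assumes g: "g \<in> L2_fun \<mu>"
  shows "\<alpha> * ip (mult_op h g) g \<le> b_const \<mu> ip \<alpha> h * (inner_norm ip g)\<^sup>2"
proof (cases "inner_norm ip g = 0")
  case True
  then show ?thesis using Cauchy_Schwarz[OF mult_op_L2[OF g] g] by simp
next
  case False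
  let ?A = "{g \<in> L2_fun \<mu>. inner_norm ip g = 1}"
  define n where "n = inner_norm ip g"
  define g1 where "g1 x = (1 / n) * g x" for x
  have n: "0 < n" using False inner_norm_nonneg[OF g] by (simp add: n_def)
  have g1: "g1 \<in> ?A"
    using L2_fun_scale[OF g, of "1 / n"] inner_norm_scale[OF g, of "1 / n"] n by (simp add: g1_def[abs_def] n_def)
  have "bdd_above ((\<lambda>g. ip (mult_op h g) g) ` ?A)"
  proof (rule bdd_aboveI2)
    fix k assume k: "k \<in> ?A"
    then have "\<bar>ip (mult_op h k) k\<bar> \<le> inner_norm ip (mult_op h k)"
      using Cauchy_Schwarz[OF mult_op_L2, of k k] by simp
    also have "\<dots> \<le> C * H / c" using inner_norm_mult_op_le[OF h_\<mu> h(2), of k] k by simp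
    finally show "ip (mult_op h k) k \<le> C * H / c" by simp
  qed
  then have "ip (mult_op h g1) g1 \<le> (SUP g \<in> ?A. ip (mult_op h g) g)" using g1 by (intro cSUP_upper)
  then have "\<alpha> * ip (mult_op h g1) g1 \<le> b_const \<mu> ip \<alpha> h"
    unfolding b_const_def using \<alpha>_pos by (intro mult_left_mono) auto
  moreover have "ip (mult_op h g1) g1 = ip (mult_op h g) g / n\<^sup>2"
  proof -
    have "mult_op h g1 = (\<lambda>x. (1 / n) * mult_op h g x)" by (auto simp: mult_op_def g1_def)
    then show ?thesis
      using g mult_op_L2[OF g] unfolding g1_def[abs_def]
      by (simp only: ip_scale ip_scale2 L2_fun_scale) (simp add: power2_eq_square)
  qed
  ultimately show ?thesis using n by (simp add: n_def[symmetric] pos_divide_le_eq)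
qed

text \<open>Split \<open>g\<close> into its mean and the orthogonal rest. The Dirichlet form and the diagonal part of
  the potential act on the rest only; the cross term is where the symmetrised operator
  applied to \<open>1\<close> enters, and completing the square leaves a multiple of the squared mean.\<close>

lemma perturbed_form_le:
  assumes g: "g \<in> borel_measurable borel" "\<And>x. \<bar>g x\<bar> \<le> B" and a: "has_L2_generator \<mu> S g a"
    and l: "0 \<le> l" "l * b_const \<mu> ip \<alpha> h < 1"
  shows "ip (\<lambda>x. a x + l * (h x * g x)) g
    \<le> l\<^sup>2 * v_const \<mu> ip \<alpha> h / (2 * (1 - l * b_const \<mu> ip \<alpha> h)) * (inner_norm ip g)\<^sup>2"
proof -
  define m where "m = (\<integral>x. g x \<partial>\<mu>)"
  define g0 where "g0 x = g x - m" for x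
  let ?adj = "adjoint_on_L2 \<mu> ip (mult_op h) (\<lambda>_. 1)"
  define p where "p x = 1/2 * (mult_op h (\<lambda>_. 1) x + ?adj x)" for x
  define b where "b = b_const \<mu> ip \<alpha> h"
  define n where "n = inner_norm ip p"
  define y where "y = inner_norm ip g0"
  define A where "A = (1 - l * b) / \<alpha>"
  have A: "0 < A" using l \<alpha>_pos by (simp add: A_def b_def)
  note one = const_L2[of 1]
  have g2: "g \<in> L2_fun \<mu>" by (rule bounded_L2[OF g])
  have g02: "g0 \<in> L2_fun \<mu>" unfolding g0_def[abs_def] by (intro L2_fun_diff g2 const_L2)
  have a2: "a \<in> L2_fun \<mu>" using a by (simp add: has_L2_generator_def)
  have h2: "h \<in> L2_fun \<mu>" by (rule bounded_L2[OF h])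
  note adj = adjoint_mult_op[OF h_\<mu> h(2) one]
  have p2: "p \<in> L2_fun \<mu>"
    unfolding p_def[abs_def] by (intro L2_fun_scale L2_fun_add mult_op_L2 one adj(1))
  have v: "v_const \<mu> ip \<alpha> h = 2 * \<alpha> * n\<^sup>2"
    by (simp add: v_const_def n_def p_def[abs_def])
  have mean0: "(\<integral>x. g0 x \<partial>\<mu>) = 0"
    unfolding g0_def m_def using bounded_integrable[OF g] start.prob_space by simp
  have orth: "ip g0 (\<lambda>_. 1) = 0" using ip_one_integral[OF g02] mean0 by simp
  have one_one: "ip (\<lambda>_. 1) (\<lambda>_. 1) = 1" using ip_one_integral[OF one] start.prob_space by simp
  have g_eq: "g = (\<lambda>x. g0 x + m * 1)" by (simp add: g0_def)
  have norm_g: "(inner_norm ip g)\<^sup>2 = y\<^sup>2 + m\<^sup>2"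
    unfolding inner_norm_square[OF g2] y_def inner_norm_square[OF g02]
    unfolding g_eq using orth one_one g02 L2_fun_scale[OF one, of m]
    by (simp only: ip_add_self ip_scale ip_scale2 L2_fun_scale one) (simp add: power2_eq_square)
  have hg0: "mult_op h g0 \<in> L2_fun \<mu>" by (rule mult_op_L2[OF g02])
  have hg: "mult_op h g \<in> L2_fun \<mu>" by (rule mult_op_L2[OF g2])
  have m1: "(\<lambda>x. m * 1) \<in> L2_fun \<mu>" by (rule L2_fun_scale[OF one])
  have "ip (mult_op h g) g = ip (mult_op h g0) g0 + 2 * (m * ip p g0)"
  proof -
    have e1: "mult_op h g = (\<lambda>x. mult_op h g0 x + m * h x)"
      by (auto simp: mult_op_def g_eq algebra_simps)
    have "ip (mult_op h g) g = ip (mult_op h g) g0 + m * ip (mult_op h g) (\<lambda>_. 1)"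
      using ip_add2[OF hg g02 m1] ip_scale2[OF hg one, of m] arg_cong[OF g_eq, of "ip (mult_op h g)"] by simp
    also have "ip (mult_op h g) g0 = ip (mult_op h g0) g0 + m * ip h g0"
      unfolding e1 using ip_add[OF hg0 L2_fun_scale[OF h2] g02, of m] ip_scale[OF h2 g02, of m] by simp
    also have "ip (mult_op h g) (\<lambda>_. 1) = ip (mult_op h g0) (\<lambda>_. 1) + m * ip h (\<lambda>_. 1)"
      unfolding e1 using ip_add[OF hg0 L2_fun_scale[OF h2] one, of m] ip_scale[OF h2 one, of m] by simp
    also have "ip h (\<lambda>_. 1) = 0" using ip_one_integral[OF h2] h_mean by simp
    also have "ip (mult_op h g0) (\<lambda>_. 1) = ip ?adj g0"
      using adj(2)[OF g02] ip_commute[OF g02 adj(1)] by simp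
    finally have "ip (mult_op h g) g = ip (mult_op h g0) g0 + m * (ip h g0 + ip ?adj g0)"
      by (simp add: algebra_simps)
    moreover have "ip p g0 = (ip h g0 + ip ?adj g0) / 2"
    proof -
      have "p = (\<lambda>x. (1/2) * (h x + ?adj x))" by (auto simp: p_def mult_op_def)
      then show ?thesis
        using ip_scale[OF L2_fun_add[OF h2 adj(1)] g02, of "1/2"] ip_add[OF h2 adj(1) g02] by simp
    qed
    ultimately show ?thesis by simp
  qed
  also have "\<dots> \<le> b / \<alpha> * y\<^sup>2 + 2 * (\<bar>m\<bar> * (n * y))"
  proof (intro add_mono mult_left_mono)
    show "ip (mult_op h g0) g0 \<le> b / \<alpha> * y\<^sup>2"
      using b_const_bound[OF g02] \<alpha>_pos by (simp add: b_def y_def field_simps)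
    have "m * ip p g0 \<le> \<bar>m\<bar> * \<bar>ip p g0\<bar>" by (simp flip: abs_mult)
    also have "\<dots> \<le> \<bar>m\<bar> * (n * y)"
      unfolding n_def y_def by (intro mult_left_mono Cauchy_Schwarz p2 g02) auto
    finally show "m * ip p g0 \<le> \<bar>m\<bar> * (n * y)" .
  qed simp
  finally have pot: "ip (mult_op h g) g \<le> b / \<alpha> * y\<^sup>2 + 2 * (\<bar>m\<bar> * (n * y))" .
  have "ip (\<lambda>x. a x + l * (h x * g x)) g = ip a g + l * ip (mult_op h g) g"
    using ip_add[OF a2 L2_fun_scale[OF hg] g2, of l] ip_scale[OF hg g2, of l] by (simp add: mult_op_def)
  also have "\<dots> \<le> - y\<^sup>2 / \<alpha> + l * (b / \<alpha> * y\<^sup>2 + 2 * (\<bar>m\<bar> * (n * y)))"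
    using dirichlet_form_le[OF g a m_def] mult_left_mono[OF pot l(1)] by (simp add: y_def g0_def[abs_def])
  also have "\<dots> = - (A * y\<^sup>2) + 2 * (l * \<bar>m\<bar> * n) * y"
    using \<alpha>_pos by (simp add: A_def field_simps)
  also have "\<dots> \<le> (l * \<bar>m\<bar> * n)\<^sup>2 / A"
  proof -
    have "0 \<le> (A * y - l * \<bar>m\<bar> * n)\<^sup>2 / A" using A by simp
    also have "\<dots> = A * y\<^sup>2 - 2 * (l * \<bar>m\<bar> * n) * y + (l * \<bar>m\<bar> * n)\<^sup>2 / A"
      using A by (simp add: power2_eq_square field_simps)
    finally show ?thesis by simp
  qed
  also have "\<dots> = l\<^sup>2 * v_const \<mu> ip \<alpha> h / (2 * (1 - l * b)) * m\<^sup>2"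
    using \<alpha>_pos A by (simp add: A_def v power_mult_distrib field_simps)
  also have "\<dots> \<le> l\<^sup>2 * v_const \<mu> ip \<alpha> h / (2 * (1 - l * b)) * (inner_norm ip g)\<^sup>2"
    using l v_const_nonneg norm_g by (intro mult_left_mono) (auto simp: b_def)
  finally show ?thesis by (simp add: b_def)
qed

text \<open>Here \<open>G\<close> is \<open>exp\<close>, whose derivative is itself, so the evolution equation becomes linear:
  \<open>u' = (A + l * h) u\<close>. The form bound is then a growth rate for the energy.\<close>

lemma exponential_moment_norm_le:
  assumes T: "0 \<le> T" and l: "0 \<le> l" "l * b_const \<mu> ip \<alpha> h < 1"
  shows "inner_norm ip (\<lambda>x. \<integral>\<omega>. exp (time_integral X (\<lambda>x. l * h x) 0 T \<omega>) \<partial>P x)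
    \<le> exp (l\<^sup>2 * v_const \<mu> ip \<alpha> h / (2 * (1 - l * b_const \<mu> ip \<alpha> h)) * T)"
proof -
  define \<kappa> where "\<kappa> = l\<^sup>2 * v_const \<mu> ip \<alpha> h / (2 * (1 - l * b_const \<mu> ip \<alpha> h))"
  interpret E: locally_quadratic_expansion exp exp by (rule locally_quadratic_expansion_exp)
  interpret F: smooth_time_functional M X P \<mu> exp exp "\<lambda>x. l * h x" "l * H"
    by unfold_locales (use h l in \<open>auto simp: abs_mult intro!: mult_left_mono\<close>)
  define u where "u = F.mean_functional"
  obtain B where B: "\<And>t x. 0 \<le> t \<Longrightarrow> t \<le> T \<Longrightarrow> \<bar>u t x\<bar> \<le> B"
    using F.mean_functional_bounded[of T] unfolding u_def by blast
  obtain L where L: "0 \<le> L" "\<And>s t x. \<lbrakk>0 \<le> s; s \<le> T; 0 \<le> t; t \<le> T\<rbrakk> \<Longrightarrow> \<bar>u t x - u s x\<bar> \<le> L * \<bar>t - s\<bar>"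
    using F.mean_functional_Lipschitz[of T] unfolding u_def by blast
  have um: "u t \<in> borel_measurable borel" for t unfolding u_def by (rule F.mean_functional_measurable)
  have "(inner_norm ip (u T))\<^sup>2 \<le> exp (2 * \<kappa> * T) * (inner_norm ip (u 0))\<^sup>2"
  proof (rule exponential_growth_bound[OF T])
    show "continuous_on {0..T} (\<lambda>t. (inner_norm ip (u t))\<^sup>2)"
      using um by (intro energy_continuous[OF _ B L]) (auto simp: borel_measurable_\<mu>)
    fix t assume t: "0 \<le> t" "t < T"
    have D: "F.time_derivative t = (\<lambda>x. F.space_derivative t x + l * (h x * u t x))"
      using F.time_derivative_eq[OF t(1)] by (auto simp: u_def F.mean_functional_def)
    have "((\<lambda>t. (inner_norm ip (u t))\<^sup>2) has_real_derivative 2 * ip (F.time_derivative t) (u t)) (at_right t)"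
      unfolding u_def
      by (intro energy_right_derivative F.mean_functional_L2 F.derivatives_L2(1) t
          F.mean_functional_time_derivative)
    moreover have "ip (F.time_derivative t) (u t) \<le> \<kappa> * (inner_norm ip (u t))\<^sup>2"
      unfolding D \<kappa>_def
      using F.mean_functional_has_generator[OF t(1)] B t l
      by (intro perturbed_form_le[OF um, where B=B]) (auto simp: u_def)
    ultimately show "\<exists>d\<le>2 * \<kappa> * (inner_norm ip (u t))\<^sup>2.
        ((\<lambda>t. (inner_norm ip (u t))\<^sup>2) has_real_derivative d) (at_right t)"
      by (intro exI[of _ "2 * ip (F.time_derivative t) (u t)"]) auto
  qed
  moreover have "u 0 = (\<lambda>_. 1)" by (auto simp: u_def F.mean_functional_0)
  ultimately have "(inner_norm ip (u T))\<^sup>2 \<le> (exp (\<kappa> * T))\<^sup>2"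
    by (simp add: inner_norm_one power2_eq_square mult_ac flip: exp_add)
  then have "inner_norm ip (u T) \<le> exp (\<kappa> * T)" by (rule power2_le_imp_le) simp
  then show ?thesis by (simp add: u_def F.mean_functional_def[abs_def] \<kappa>_def)
qed

text \<open>Here \<open>G\<close> is the identity and the evolution equation is \<open>w' = A w + h\<close>. All \<open>w t\<close> have mean zero, so the
  Poincare inequality damps them at rate \<open>1 / \<alpha>\<close> against the constant forcing \<open>h\<close>. Treating the
  time integral directly, instead of integrating a decay estimate for the semigroup, stays inside the
  domain of the generator.\<close>

lemma mean_time_integral_norm_le:
  assumes T: "0 \<le> T"
  shows "inner_norm ip (\<lambda>x. \<integral>\<omega>. time_integral X h 0 T \<omega> \<partial>P x)
    \<le> \<alpha> * (1 - exp (- T / \<alpha>)) * inner_norm ip h"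
proof -
  interpret E: locally_quadratic_expansion "\<lambda>x. x" "\<lambda>_. 1" by (rule locally_quadratic_expansion_id)
  interpret F: smooth_time_functional M X P \<mu> "\<lambda>x. x" "\<lambda>_. 1" h H
    by unfold_locales (rule h)+
  define w where "w = F.mean_functional"
  obtain B where B: "\<And>t x. 0 \<le> t \<Longrightarrow> t \<le> T \<Longrightarrow> \<bar>w t x\<bar> \<le> B"
    using F.mean_functional_bounded[of T] unfolding w_def by blast
  obtain L where L: "0 \<le> L" "\<And>s t x. \<lbrakk>0 \<le> s; s \<le> T; 0 \<le> t; t \<le> T\<rbrakk> \<Longrightarrow> \<bar>w t x - w s x\<bar> \<le> L * \<bar>t - s\<bar>"
    using F.mean_functional_Lipschitz[of T] unfolding w_def by blast
  have wm: "w t \<in> borel_measurable borel" for t unfolding w_def by (rule F.mean_functional_measurable)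
  have w2: "w t \<in> L2_fun \<mu>" if "0 \<le> t" for t unfolding w_def by (rule F.mean_functional_L2[OF that])
  have h2: "h \<in> L2_fun \<mu>" by (rule bounded_L2[OF h])
  have "sqrt ((inner_norm ip (w T))\<^sup>2) \<le> \<alpha> * (1 - exp (- T / \<alpha>)) * inner_norm ip h"
  proof (rule damped_forcing_bound[where \<phi>="\<lambda>t. (inner_norm ip (w t))\<^sup>2", OF T])
    show "continuous_on {0..T} (\<lambda>t. (inner_norm ip (w t))\<^sup>2)"
      by (rule energy_continuous[OF borel_measurable_\<mu>[THEN iffD2, OF wm] B L])
    have "w 0 = (\<lambda>_. 0 * 1)" by (auto simp: w_def F.mean_functional_0)
    then show "(inner_norm ip (w 0))\<^sup>2 = 0" using inner_norm_scale[OF const_L2[of 1], of 0] by simp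
    fix t assume t: "0 \<le> t" "t < T"
    define a where "a = F.space_derivative t"
    have a2: "a \<in> L2_fun \<mu>" unfolding a_def by (rule F.derivatives_L2(2)[OF t(1)])
    have D: "F.time_derivative t = (\<lambda>x. a x + h x)"
      using F.time_derivative_eq[OF t(1)] prob_space.prob_space[OF prob_space_P] by (auto simp: a_def)
    have "((\<lambda>t. (inner_norm ip (w t))\<^sup>2) has_real_derivative 2 * ip (F.time_derivative t) (w t)) (at_right t)"
      unfolding w_def
      by (intro energy_right_derivative F.mean_functional_L2 F.derivatives_L2(1) t
          F.mean_functional_time_derivative)
    moreover have "ip (F.time_derivative t) (w t)
      \<le> inner_norm ip h * sqrt ((inner_norm ip (w t))\<^sup>2) - (inner_norm ip (w t))\<^sup>2 / \<alpha>"
    proof -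
      have "(\<integral>x. w t x \<partial>\<mu>) = (\<integral>\<omega>. time_integral X h 0 t \<omega> \<partial>Q)"
        unfolding w_def F.mean_functional_def
        by (rule integral_Q[OF F.I_measurable[OF order_refl] F.I_bound_0[OF t(1) order_refl], symmetric])
      also have "\<dots> = 0" using mean_time_integral[OF h t(1)] h_mean by simp
      finally have "ip a (w t) \<le> - (inner_norm ip (\<lambda>x. w t x - 0))\<^sup>2 / \<alpha>"
        using F.mean_functional_has_generator[OF t(1)] B[of t] t
        by (intro dirichlet_form_le[OF wm, where B=B]) (auto simp: w_def a_def)
      moreover have "ip h (w t) \<le> inner_norm ip h * inner_norm ip (w t)"
        using Cauchy_Schwarz[OF h2 w2[OF t(1)]] by simp
      ultimately show ?thesis
        unfolding D using ip_add[OF a2 h2 w2[OF t(1)]] inner_norm_nonneg[OF w2[OF t(1)]] by simp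
    qed
    ultimately show "\<exists>d. d \<le> 2 * (inner_norm ip h * sqrt ((inner_norm ip (w t))\<^sup>2) - (inner_norm ip (w t))\<^sup>2 / \<alpha>) \<and>
        ((\<lambda>t. (inner_norm ip (w t))\<^sup>2) has_real_derivative d) (at_right t)"
      by (intro exI[of _ "2 * ip (F.time_derivative t) (w t)"]) auto
  qed (use \<alpha>_pos inner_norm_nonneg[OF h2] in auto)
  then show ?thesis
    using inner_norm_nonneg[OF w2[OF T]] by (simp add: w_def F.mean_functional_def[abs_def])
qed

end

end

section \<open>Variational bound for relative entropy\<close>

text \<open>One half of the Donsker-Varadhan formula. Pointwise \<open>\<Phi> - ln D \<le> exp \<Phi> / (D * K) - 1 + ln K\<close> where
  \<open>D\<close> is the density of \<open>Q1\<close> and \<open>K\<close> the integral of \<open>exp \<Phi>\<close> under \<open>Q2\<close>; integrating against \<open>Q1\<close> gives the claim.\<close>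

lemma relative_entropy_variational:
  assumes "prob_space Q1" "prob_space Q2" and sets: "sets Q1 = sets Q2"
    and fin: "relative_entropy Q1 Q2 < \<infinity>"
    and [measurable]: "\<Phi> \<in> borel_measurable Q2" and \<Phi>: "\<And>w. w \<in> space Q2 \<Longrightarrow> \<bar>\<Phi> w\<bar> \<le> B"
  shows "(\<integral>w. \<Phi> w \<partial>Q1) \<le> ln (\<integral>w. exp (\<Phi> w) \<partial>Q2) + real_of_ereal (relative_entropy Q1 Q2)"
proof -
  interpret Q1: prob_space Q1 by fact
  interpret Q2: prob_space Q2 by fact
  note [measurable_cong] = sets
  have ac: "absolutely_continuous Q2 Q1" and int: "integrable Q1 (entropy_density (exp 1) Q2 Q1)"
    and R: "real_of_ereal (relative_entropy Q1 Q2) = KL_divergence (exp 1) Q2 Q1"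
    using fin by (auto simp: relative_entropy_def split: if_splits)
  define D where "D w = enn2real (RN_deriv Q2 Q1 w)" for w
  have [measurable]: "D \<in> borel_measurable Q2" unfolding D_def by measurable
  have D0: "0 \<le> D w" for w by (simp add: D_def)
  have ent: "entropy_density (exp 1) Q2 Q1 = (\<lambda>w. ln (D w))"
    by (auto simp: entropy_density_def D_def log_def)
  have dens: "density Q2 (\<lambda>w. ennreal (D w)) = Q1"
  proof -
    have "density Q2 (\<lambda>w. ennreal (D w)) = density Q2 (RN_deriv Q2 Q1)"
      using Q2.RN_deriv_finite[OF Q1.sigma_finite_measure_axioms ac sets]
      by (intro density_cong) (auto simp: D_def less_top elim!: eventually_mono)
    then show ?thesis using Q2.density_RN_deriv[OF ac sets] by simp
  qed
  have pos: "AE w in Q1. 0 < D w"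
    by (subst dens[symmetric], subst AE_density) auto
  have iexp: "integrable Q2 (\<lambda>w. exp (\<Phi> w))"
    by (rule Q2.integrable_const_bound[where B="exp B"]) (use \<Phi> in \<open>auto simp: abs_le_iff\<close>)
  define K where "K = (\<integral>w. exp (\<Phi> w) \<partial>Q2)"
  have "exp (- B) \<le> K"
    unfolding K_def
  proof (intro Q2.integral_ge_const iexp AE_I2)
    show "exp (- B) \<le> exp (\<Phi> w)" if "w \<in> space Q2" for w using \<Phi>[OF that] by simp
  qed
  then have K: "0 < K" by (smt (verit) exp_gt_zero)
  have Dint: "integrable Q2 (\<lambda>w. D w * (exp (\<Phi> w) / D w))"
    by (rule Bochner_Integration.integrable_bound[OF iexp]) (auto)
  have i2: "integrable Q1 (\<lambda>w. exp (\<Phi> w) / D w)"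
    using Dint D0 by (subst dens[symmetric], subst integrable_density) auto
  have "(\<integral>w. exp (\<Phi> w) / D w \<partial>Q1) = (\<integral>w. D w * (exp (\<Phi> w) / D w) \<partial>Q2)"
    using D0 by (subst dens[symmetric], subst integral_density) auto
  also have "\<dots> \<le> K" unfolding K_def by (rule integral_mono[OF Dint iexp]) auto
  finally have le: "(\<integral>w. exp (\<Phi> w) / D w \<partial>Q1) \<le> K" .
  have i\<Phi>: "integrable Q1 \<Phi>"
    by (rule Q1.integrable_const_bound[where B=B]) (use \<Phi> sets_eq_imp_space_eq[OF sets] in auto)
  have "(\<integral>w. \<Phi> w \<partial>Q1) - (\<integral>w. ln (D w) \<partial>Q1) = (\<integral>w. \<Phi> w - ln (D w) \<partial>Q1)"
    using int i\<Phi> by (simp add: ent)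
  also have "\<dots> \<le> (\<integral>w. (exp (\<Phi> w) / D w) / K - 1 + ln K \<partial>Q1)"
  proof (rule integral_mono_AE)
    show "integrable Q1 (\<lambda>w. \<Phi> w - ln (D w))" using int i\<Phi> by (simp add: ent)
    show "integrable Q1 (\<lambda>w. exp (\<Phi> w) / D w / K - 1 + ln K)"
      by (intro Bochner_Integration.integrable_add Bochner_Integration.integrable_diff integrable_divide i2) auto
    show "AE w in Q1. \<Phi> w - ln (D w) \<le> exp (\<Phi> w) / D w / K - 1 + ln K"
      using pos
    proof eventually_elim
      case (elim w)
      have "ln (exp (\<Phi> w) / D w / K) \<le> exp (\<Phi> w) / D w / K - 1"
        using elim K by (intro ln_le_minus_one) auto
      then show ?case using elim K by (simp add: ln_div ln_mult)
    qed
  qed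
  also have "\<dots> \<le> ln K"
  proof -
    have "(\<integral>w. (exp (\<Phi> w) / D w) / K - 1 + ln K \<partial>Q1) = (\<integral>w. exp (\<Phi> w) / D w \<partial>Q1) / K - 1 + ln K"
      using i2 by (simp add: Q1.prob_space del: divide_divide_eq_left)
    also have "\<dots> \<le> ln K" using le K by (simp add: divide_le_eq)
    finally show ?thesis .
  qed
  finally show ?thesis by (simp add: R KL_divergence_def ent K_def)
qed

lemma relative_entropy_nonneg:
  assumes "prob_space Q1" "prob_space Q2" "sets Q1 = sets Q2"
  shows "0 \<le> relative_entropy Q1 Q2"
proof (cases "relative_entropy Q1 Q2 < \<infinity>")
  case True
  interpret Q1: prob_space Q1 by fact
  interpret Q2: prob_space Q2 by fact
  have "0 \<le> real_of_ereal (relative_entropy Q1 Q2)"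
    using relative_entropy_variational[OF assms True, of "\<lambda>_. 0" 0] by (simp add: Q2.prob_space)
  then show ?thesis by (auto simp: relative_entropy_def split: if_splits)
qed auto

section \<open>Bounds for the alternative process\<close>

lemma (in prob_space) abs_integral_le_density_norm:
  assumes \<nu>: "prob_space \<nu>" "sets \<nu> = sets M" and ac: "absolutely_continuous M \<nu>"
    and sq: "(\<lambda>x. enn2real (RN_deriv M \<nu> x)) \<in> L2_fun M" and g: "g \<in> L2_fun M"
  shows "\<bar>\<integral>x. g x \<partial>\<nu>\<bar> \<le> density_norm M \<nu> * L2_norm M g"
proof -
  interpret \<nu>: prob_space \<nu> by fact
  interpret L2: inner_product_on_L2 M "L2_inner M" by (rule inner_product_on_L2_L2_inner)
  have "(\<integral>x. g x \<partial>\<nu>) = L2_inner M (\<lambda>x. enn2real (RN_deriv M \<nu> x)) g"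
    unfolding L2_inner_def
    by (rule RN_deriv_integral[OF \<nu>.sigma_finite_measure_axioms ac \<nu>(2) L2_funD(1)[OF g]])
  then show ?thesis using L2.Cauchy_Schwarz[OF sq g] by (simp add: density_norm_def)
qed

lemma (in prob_space) density_norm_self:
  shows "(\<lambda>x. enn2real (RN_deriv M M x)) \<in> L2_fun M" "density_norm M M = 1"
proof -
  have "AE x in M. 1 = RN_deriv M M x"
    by (rule RN_deriv_unique) (simp_all add: density_1)
  then have AE: "AE x in M. enn2real (RN_deriv M M x) = 1"
    by eventually_elim (metis enn2real_1)
  have "integrable M (\<lambda>x. (enn2real (RN_deriv M M x))\<^sup>2)"
    by (rule integrable_const_bound[where B=1]) (use AE in auto)
  then show sq: "(\<lambda>x. enn2real (RN_deriv M M x)) \<in> L2_fun M" by (simp add: L2_fun_def)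
  have "(\<integral>x. enn2real (RN_deriv M M x) * enn2real (RN_deriv M M x) \<partial>M) = (\<integral>x. 1 \<partial>M)"
    by (rule integral_cong_AE) (use AE in auto)
  then show "density_norm M M = 1"
    by (simp add: density_norm_def inner_norm_def L2_inner_def prob_space)
qed

lemma (in cadlag_on_measurable_space) time_integral_affine:
  fixes K :: real
  assumes k: "k \<in> borel_measurable borel" "\<And>x. \<bar>k x\<bar> \<le> K" and "a \<le> b" "{a..b} \<subseteq> I" "\<omega> \<in> space N"
  shows "time_integral Y (\<lambda>x. s * (k x - m)) a b \<omega> = s * (time_integral Y k a b \<omega> - (b - a) * m)"
proof -
  have c: "set_integrable lborel {a..b} (\<lambda>_. m)"
    unfolding set_integrable_def using assms(3)
    by (intro integrableI_bounded_set_indicator[where B="\<bar>m\<bar>"]) auto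
  have "time_integral Y (\<lambda>x. s * (k x - m)) a b \<omega> = s * (LINT t:{a..b}|lborel. k (Y t \<omega>) - m)"
    unfolding time_integral_def by (rule set_integral_mult_right)
  also have "(LINT t:{a..b}|lborel. k (Y t \<omega>) - m) = time_integral Y k a b \<omega> - (LINT t:{a..b}|lborel. m)"
    using set_integral_diff(2)[OF set_integrable_observed[OF k assms(4,5)] c] by (simp add: time_integral_def)
  also have "(LINT t:{a..b}|lborel. m) = (b - a) * m"
    using assms(3) by (simp add: set_lebesgue_integral_def)
  finally show ?thesis .
qed

text \<open>The minimum is at \<open>r = sqrt (2 * \<eta> / v)\<close>. If \<open>v\<close> or \<open>\<eta>\<close> vanishes it degenerates to a limit at
  \<open>0\<close> or infinity.\<close>

lemma le_sqrt_by_optimisation: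
  fixes x v \<eta> :: real
  assumes v: "0 \<le> v" and \<eta>: "0 \<le> \<eta>" and le: "\<And>r. 0 < r \<Longrightarrow> x \<le> r * v / 2 + \<eta> / r"
  shows "x \<le> sqrt (2 * v * \<eta>)"
proof (cases "v = 0 \<or> \<eta> = 0")
  case True
  have "x \<le> 0"
  proof (rule field_le_epsilon)
    fix e :: real assume e: "0 < e"
    show "x \<le> 0 + e"
    proof (cases "v = 0")
      case True
      have "x \<le> \<eta> / ((\<eta> + 1) / e)" using le[of "(\<eta> + 1) / e"] e \<eta> True by simp
      also have "\<dots> = e * (\<eta> / (\<eta> + 1))" by simp
      also have "\<dots> \<le> e" using e \<eta> by (intro mult_left_le) auto
      finally show ?thesis by simp
    next
      case False
      then have "\<eta> = 0" using \<open>v = 0 \<or> \<eta> = 0\<close> by simp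
      then show ?thesis using le[of "2 * e / v"] e v False by simp
    qed
  qed
  then show ?thesis using True by auto
next
  case False
  define s where "s = sqrt (2 * v * \<eta>)"
  have vp: "0 < v" "0 < \<eta>" using False v \<eta> by auto
  then have s: "0 < s" "s * s = 2 * v * \<eta>" by (auto simp: s_def)
  have "x \<le> (s / v) * v / 2 + \<eta> / (s / v)" using vp s by (intro le) auto
  also have "(s / v) * v / 2 = s / 2" using vp by simp
  also have "\<eta> / (s / v) = (2 * v * \<eta>) / s / 2" by simp
  also have "\<dots> = s / 2" using s by (simp add: s(2)[symmetric])
  finally show ?thesis by (simp add: s_def)
qed

context poincare_markov
begin

text \<open>The density norm is at least \<open>1\<close> as it bounds the total mass, and \<open>c\<close> is at most \<open>1\<close> as the
  constant function \<open>1\<close> has unit length for both inner products.\<close>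

lemma density_norm_prefactor:
  assumes \<nu>: "prob_space \<nu>" "sets \<nu> = sets borel" and ac: "absolutely_continuous \<mu> \<nu>"
    and sq: "(\<lambda>x. enn2real (RN_deriv \<mu> \<nu> x)) \<in> L2_fun \<mu>"
  shows "0 < density_norm \<mu> \<nu>" "0 \<le> ln (inverse c) + ln (density_norm \<mu> \<nu>)"
proof -
  interpret \<nu>: prob_space \<nu> by fact
  have "1 \<le> density_norm \<mu> \<nu> * L2_norm \<mu> (\<lambda>_. 1)"
    using start.abs_integral_le_density_norm[OF \<nu>(1) _ ac sq const_L2[of 1]] \<nu>(2) \<nu>.prob_space by simp
  then have D: "1 \<le> density_norm \<mu> \<nu>"
    using start.prob_space by (simp add: inner_norm_def L2_inner_def)
  then show "0 < density_norm \<mu> \<nu>" by simp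
  have "c \<le> 1"
    using equivalent[OF const_L2[of 1]] inner_norm_one start.prob_space
    by (simp add: inner_norm_def[of "L2_inner \<mu>"] L2_inner_def)
  then have "1 \<le> inverse c" using c_pos by (simp add: one_le_inverse_iff)
  then have "0 \<le> ln (inverse c)" by simp
  moreover have "0 \<le> ln (density_norm \<mu> \<nu>)" using D by simp
  ultimately show "0 \<le> ln (inverse c) + ln (density_norm \<mu> \<nu>)" by simp
qed

context
  fixes h :: "'a \<Rightarrow> real" and H :: real and \<nu> :: "'a measure"
  assumes h: "h \<in> borel_measurable borel" "\<And>x. \<bar>h x\<bar> \<le> H" and h_mean: "(\<integral>x. h x \<partial>\<mu>) = 0"
    and \<nu>: "prob_space \<nu>" "sets \<nu> = sets borel" and ac: "absolutely_continuous \<mu> \<nu>"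
    and sq: "(\<lambda>x. enn2real (RN_deriv \<mu> \<nu> x)) \<in> L2_fun \<mu>"
begin

lemma markov_initial_law_\<nu>: "markov_initial_law M X P \<nu>"
  by (intro markov_initial_law.intro markov_initial_law_axioms.intro cadlag_markov_family_axioms \<nu>)

lemma X_integral_measurable: "time_integral X h 0 T \<in> borel_measurable M"
  by (rule X.time_integral_measurable[OF h(1)]) auto

lemma X_integral_bound: "0 \<le> T \<Longrightarrow> \<omega> \<in> space M \<Longrightarrow> \<bar>time_integral X h 0 T \<omega>\<bar> \<le> H * T"
  using X.time_integral_bound[OF h, of 0 T \<omega>] by simp

lemma expectation_le:
  assumes F: "F \<in> borel_measurable M" "\<And>\<omega>. \<omega> \<in> space M \<Longrightarrow> \<bar>F \<omega>\<bar> \<le> B"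
  shows "\<bar>\<integral>\<omega>. F \<omega> \<partial>initial_law P \<nu>\<bar> \<le> density_norm \<mu> \<nu> * (inner_norm ip (\<lambda>x. \<integral>\<omega>. F \<omega> \<partial>P x) / c)"
proof -
  interpret V: markov_initial_law M X P \<nu> by (rule markov_initial_law_\<nu>)
  have u: "(\<lambda>x. \<integral>\<omega>. F \<omega> \<partial>P x) \<in> L2_fun \<mu>" by (rule L2_fun_expectation[OF F])
  have "\<bar>\<integral>\<omega>. F \<omega> \<partial>initial_law P \<nu>\<bar> = \<bar>\<integral>x. (\<integral>\<omega>. F \<omega> \<partial>P x) \<partial>\<nu>\<bar>" by (simp add: V.integral_Q[OF F])
  also have "\<dots> \<le> density_norm \<mu> \<nu> * L2_norm \<mu> (\<lambda>x. \<integral>\<omega>. F \<omega> \<partial>P x)"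
    using \<nu>(2) by (intro start.abs_integral_le_density_norm[OF \<nu>(1) _ ac sq u]) simp
  also have "\<dots> \<le> density_norm \<mu> \<nu> * (inner_norm ip (\<lambda>x. \<integral>\<omega>. F \<omega> \<partial>P x) / c)"
    using density_norm_prefactor(1)[OF \<nu> ac sq] by (intro mult_left_mono L2_norm_le u) auto
  finally show ?thesis .
qed

lemma relaxation_bound:
  assumes T: "0 \<le> T"
  shows "\<bar>\<integral>\<omega>. time_integral X h 0 T \<omega> \<partial>initial_law P \<nu>\<bar>
    \<le> C / c * (\<alpha> * (1 - exp (- T / \<alpha>))) * density_norm \<mu> \<nu> * L2_norm \<mu> h"
proof -
  let ?e = "\<alpha> * (1 - exp (- T / \<alpha>))"
  have h2: "h \<in> L2_fun \<mu>" by (rule bounded_L2[OF h])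
  have e: "0 \<le> ?e" using T \<alpha>_pos by simp
  have D: "0 < density_norm \<mu> \<nu>" by (rule density_norm_prefactor(1)[OF \<nu> ac sq])
  have "inner_norm ip (\<lambda>x. \<integral>\<omega>. time_integral X h 0 T \<omega> \<partial>P x) \<le> ?e * inner_norm ip h"
    by (rule mean_time_integral_norm_le[OF h h_mean T])
  also have "\<dots> \<le> ?e * (C * L2_norm \<mu> h)" by (intro mult_left_mono inner_norm_le h2 e)
  finally have n: "inner_norm ip (\<lambda>x. \<integral>\<omega>. time_integral X h 0 T \<omega> \<partial>P x) \<le> ?e * (C * L2_norm \<mu> h)" .
  have "\<bar>\<integral>\<omega>. time_integral X h 0 T \<omega> \<partial>initial_law P \<nu>\<bar>
      \<le> density_norm \<mu> \<nu> * (inner_norm ip (\<lambda>x. \<integral>\<omega>. time_integral X h 0 T \<omega> \<partial>P x) / c)"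
    by (rule expectation_le[OF X_integral_measurable X_integral_bound[OF T]])
  also have "\<dots> \<le> density_norm \<mu> \<nu> * (?e * (C * L2_norm \<mu> h) / c)"
    using D c_pos n by (intro mult_left_mono divide_right_mono) auto
  finally show ?thesis by (simp add: mult_ac)
qed

text \<open>With exponent \<open>l\<close> the bound is \<open>(\<kappa> + \<eta>) / l\<close>, where \<open>\<kappa> = l\<^sup>2 * v / (2 * (1 - l * b))\<close> and
  \<open>l * b < 1\<close>. Parametrising \<open>l = r / (1 + b * r)\<close> by \<open>r > 0\<close> makes \<open>1 - l * b = 1 / (1 + b * r)\<close>, and the bound
  becomes \<open>r * v / 2 + \<eta> / r + b * \<eta>\<close>.\<close>

lemma time_average_deviation:
  assumes "cadlag_process N Y" and T: "0 < T"
    and fin: "relative_entropy (path_law T N Y) (path_law T (initial_law P \<nu>) X) < \<infinity>"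
  defines "\<eta> \<equiv> eta T c (density_norm \<mu> \<nu>)
    (real_of_ereal (relative_entropy (path_law T N Y) (path_law T (initial_law P \<nu>) X)))"
  shows "(1 / T) * (\<integral>\<omega>. time_integral Y h 0 T \<omega> \<partial>N)
    \<le> sqrt (2 * v_const \<mu> ip \<alpha> h * \<eta>) + b_const \<mu> ip \<alpha> h * \<eta>"
proof -
  interpret V: markov_initial_law M X P \<nu> by (rule markov_initial_law_\<nu>)
  interpret N: cadlag_process N Y by fact
  interpret Y: cadlag_on_measurable_space N "{0..}" Y
    by standard (auto intro: N.measurable_Y N.cadlag_Y)
  interpret coord: cadlag_on_measurable_space "cadlag_paths T" "{0..T}" "\<lambda>s w. w s :: 'a"
    by (rule coordinate_process)
  let ?Q1 = "path_law T N Y" and ?Q2 = "path_law T (initial_law P \<nu>) X"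
  define R where "R = real_of_ereal (relative_entropy ?Q1 ?Q2)"
  define v where "v = v_const \<mu> ip \<alpha> h"
  define b where "b = b_const \<mu> ip \<alpha> h"
  define D where "D = density_norm \<mu> \<nu>"
  have T0: "0 \<le> T" using T by simp
  have v: "0 \<le> v" and b: "0 \<le> b" unfolding v_def b_def by (rule v_const_nonneg b_const_nonneg)+
  note D = density_norm_prefactor[OF \<nu> ac sq, folded D_def]
  have mY: "(\<lambda>\<omega>. restrict (\<lambda>t. Y t \<omega>) {0..T}) \<in> N \<rightarrow>\<^sub>M cadlag_paths T" by (rule Y.path_measurable) auto
  have mX: "(\<lambda>\<omega>. restrict (\<lambda>t. X t \<omega>) {0..T}) \<in> initial_law P \<nu> \<rightarrow>\<^sub>M cadlag_paths T"
    using X.path_measurable[of T] by (simp cong: measurable_cong_sets)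
  have p1: "prob_space ?Q1" and p2: "prob_space ?Q2"
    unfolding path_law_def by (rule N.prob_space_distr[OF mY] V.Q.prob_space_distr[OF mX])+
  have sets12: "sets ?Q1 = sets ?Q2" and sets2: "sets ?Q2 = sets (cadlag_paths T)" by (simp_all add: path_law_def)
  have R: "0 \<le> R" using relative_entropy_nonneg[OF p1 p2 sets12] by (simp add: R_def real_of_ereal_pos)
  have \<eta>: "\<eta> = (1 / T) * (ln (inverse c) + ln D + R)" by (simp add: \<eta>_def eta_def R_def D_def)
  have \<eta>0: "0 \<le> \<eta>" unfolding \<eta> using T D(2) R by (intro mult_nonneg_nonneg) auto
  have main: "(1 / T) * (\<integral>\<omega>. time_integral Y h 0 T \<omega> \<partial>N) - b * \<eta> \<le> r * v / 2 + \<eta> / r" if r: "0 < r" for r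
  proof -
    define l where "l = r / (1 + b * r)"
    have br: "0 < 1 + b * r" using b r by (intro add_pos_nonneg) auto
    have l: "0 < l" using r br by (simp add: l_def)
    have lb1: "1 - l * b = 1 / (1 + b * r)" using br by (simp add: l_def field_simps)
    then have lb: "l * b < 1" using br by (metis diff_gt_0_iff_gt zero_less_divide_1_iff)
    define \<kappa> where "\<kappa> = l\<^sup>2 * v / (2 * (1 - l * b))"
    define \<Phi> where "\<Phi> w = l * time_integral (\<lambda>s w. w s) h 0 T w" for w :: "real \<Rightarrow> 'a"
    have \<Phi>m: "\<Phi> \<in> borel_measurable (cadlag_paths T)"
      unfolding \<Phi>_def[abs_def] by (intro borel_measurable_times borel_measurable_const coord.time_integral_measurable[OF h(1)]) auto
    have \<Phi>B: "\<bar>\<Phi> w\<bar> \<le> l * (H * T)" if "w \<in> space (cadlag_paths T)" for w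
      unfolding \<Phi>_def abs_mult using coord.time_integral_bound[OF h T0 _ that] l by simp
    define E where "E = (\<integral>w. exp (\<Phi> w) \<partial>?Q2)"
    have "(\<integral>w. \<Phi> w \<partial>?Q1) \<le> ln E + R"
      unfolding E_def R_def
    proof (rule relative_entropy_variational[OF p1 p2 sets12 fin, where B="l * (H * T)"])
      show "\<Phi> \<in> borel_measurable ?Q2" using \<Phi>m by (simp add: path_law_def)
      show "\<bar>\<Phi> w\<bar> \<le> l * (H * T)" if "w \<in> space ?Q2" for w using that by (intro \<Phi>B) (simp add: path_law_def)
    qed
    moreover have "(\<integral>w. \<Phi> w \<partial>?Q1) = l * (\<integral>\<omega>. time_integral Y h 0 T \<omega> \<partial>N)"
      unfolding path_law_def by (subst integral_distr[OF mY \<Phi>m]) (simp add: \<Phi>_def time_integral_restrict[of h T Y])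
    moreover have "ln E \<le> ln (inverse c) + ln D + \<kappa> * T"
    proof -
      have scale: "exp (l * time_integral X h 0 T \<omega>) = exp (time_integral X (\<lambda>x. l * h x) 0 T \<omega>)" for \<omega>
        unfolding time_integral_def by (subst set_integral_mult_right) simp
      have F: "(\<lambda>\<omega>. exp (l * time_integral X h 0 T \<omega>)) \<in> borel_measurable M"
        using X_integral_measurable[of T] by measurable
      have FB: "\<bar>exp (l * time_integral X h 0 T \<omega>)\<bar> \<le> exp (l * (H * T))" if "\<omega> \<in> space M" for \<omega>
        using X_integral_bound[OF T0 that] l by (simp add: abs_le_iff)
      have E: "E = (\<integral>\<omega>. exp (l * time_integral X h 0 T \<omega>) \<partial>initial_law P \<nu>)"
        unfolding E_def path_law_def
        by (subst integral_distr[OF mX measurable_compose[OF \<Phi>m borel_measurable_exp]])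
          (simp add: \<Phi>_def time_integral_restrict[of h T X])
      have "E \<le> D * (inner_norm ip (\<lambda>x. \<integral>\<omega>. exp (l * time_integral X h 0 T \<omega>) \<partial>P x) / c)"
        using expectation_le[OF F FB] unfolding E D_def by linarith
      also have "\<dots> \<le> D * (exp (\<kappa> * T) / c)"
        unfolding scale \<kappa>_def v_def b_def using D c_pos l lb T0
        by (intro mult_left_mono divide_right_mono exponential_moment_norm_le[OF h h_mean]) (auto simp: b_def)
      finally have Ele: "E \<le> D * (exp (\<kappa> * T) / c)" .
      have "0 < E"
      proof -
        have "exp (- (l * (H * T))) \<le> E"
          unfolding E
        proof (rule V.Q.integral_ge_const)
          show "integrable (initial_law P \<nu>) (\<lambda>\<omega>. exp (l * time_integral X h 0 T \<omega>))" by (rule V.integrable_Q[OF F FB])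
          show "AE \<omega> in initial_law P \<nu>. exp (- (l * (H * T))) \<le> exp (l * time_integral X h 0 T \<omega>)"
          proof (rule AE_I2)
            fix \<omega> assume "\<omega> \<in> space (initial_law P \<nu>)"
            then have "\<bar>time_integral X h 0 T \<omega>\<bar> \<le> H * T" by (intro X_integral_bound[OF T0]) simp
            then have "l * (- (H * T)) \<le> l * time_integral X h 0 T \<omega>" using l by (intro mult_left_mono) auto
            then show "exp (- (l * (H * T))) \<le> exp (l * time_integral X h 0 T \<omega>)" by simp
          qed
        qed
        then show ?thesis by (rule less_le_trans[OF exp_gt_zero])
      qed
      then have "ln E \<le> ln (D * (exp (\<kappa> * T) / c))" using Ele by (simp add: ln_mono)
      also have "\<dots> = ln (inverse c) + ln D + \<kappa> * T"
        using D(1) c_pos by (simp add: ln_mult ln_div ln_inverse)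
      finally show ?thesis .
    qed
    ultimately have "l * (\<integral>\<omega>. time_integral Y h 0 T \<omega> \<partial>N) \<le> T * (\<kappa> + \<eta>)"
      unfolding \<eta> using T by (simp add: algebra_simps)
    then have "(1 / T) * (\<integral>\<omega>. time_integral Y h 0 T \<omega> \<partial>N) \<le> (\<kappa> + \<eta>) / l"
      using T l by (simp add: field_simps)
    also have "\<dots> = r * v / 2 + (\<eta> / r + b * \<eta>)"
    proof -
      have "\<kappa> / l = r * v / 2"
        unfolding \<kappa>_def lb1 using l br r by (simp add: power2_eq_square) (simp add: l_def field_simps)
      moreover have "\<eta> / l = \<eta> / r + b * \<eta>" using r br by (simp add: l_def field_simps)
      ultimately show ?thesis by (simp add: add_divide_distrib)
    qed
    finally show ?thesis by simp
  qed
  have "(1 / T) * (\<integral>\<omega>. time_integral Y h 0 T \<omega> \<partial>N) - b * \<eta> \<le> sqrt (2 * v * \<eta>)"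
    by (rule le_sqrt_by_optimisation[OF v \<eta>0 main])
  then show ?thesis by (simp add: v_def b_def)
qed

end

end

theorem theorem3p4:
  fixes M :: "'w measure" and X :: "real \<Rightarrow> 'w \<Rightarrow> 'a::polish_space" and P :: "'a \<Rightarrow> 'w measure"
    and \<mu>s \<mu> \<mu>t :: "'a measure"
    and ip :: "('a \<Rightarrow> real) \<Rightarrow> ('a \<Rightarrow> real) \<Rightarrow> real"
    and c C \<alpha> :: real
    and N :: "'v measure" and Y :: "real \<Rightarrow> 'v \<Rightarrow> 'a"
    and f :: "'a \<Rightarrow> real"
  assumes markov: "cadlag_markov_family M X P"
    and \<mu>s: "prob_space \<mu>s" "sets \<mu>s = sets borel"
    and invariant: "invariant_measure X P \<mu>s"
    and ergodic: "ergodic_measure X P \<mu>s"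
    and \<mu>: "prob_space \<mu>" "sets \<mu> = sets borel"
    and ac: "absolutely_continuous \<mu>s \<mu>"
    and sq: "(\<lambda>x. enn2real (RN_deriv \<mu>s \<mu> x)) \<in> L2_fun \<mu>s"
    and ip: "inner_product_on_L2 \<mu>s ip"
    and cC: "0 < c" "c \<le> C"
    and equivalent: "\<And>g. g \<in> L2_fun \<mu>s \<Longrightarrow>
      c * L2_norm \<mu>s g \<le> inner_norm ip g \<and> inner_norm ip g \<le> C * L2_norm \<mu>s g"
    and ip_one: "\<And>g. g \<in> L2_fun \<mu>s \<Longrightarrow> ip g (\<lambda>_. 1) = L2_inner \<mu>s g (\<lambda>_. 1)"
    and \<alpha>: "0 < \<alpha>"
    and poincare: "\<And>g. \<lbrakk>g \<in> generator_domain \<mu>s (transition_semigroup X P); (\<integral>x. g x \<partial>\<mu>s) = 0\<rbrakk> \<Longrightarrow>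
      (inner_norm ip g)\<^sup>2 \<le> \<alpha> * ip (\<lambda>x. - generator \<mu>s (transition_semigroup X P) g x) g"
    and alternative: "cadlag_process N Y"
    and initial: "distr N borel (Y 0) = \<mu>t"
    and f: "f \<in> borel_measurable borel" "bounded (range f)"
  shows
    "(\<forall>T>0. relative_entropy (path_law T N Y) (path_law T (initial_law P \<mu>) X) < \<infinity> \<longrightarrow>
       (\<forall>s\<in>{1, -1}.
          let v = v_const \<mu>s ip \<alpha> (\<lambda>x. s * centered \<mu>s f x);
              b = b_const \<mu>s ip \<alpha> (\<lambda>x. s * centered \<mu>s f x);
              \<eta> = eta T c (density_norm \<mu>s \<mu>)
                    (real_of_ereal (relative_entropy (path_law T N Y) (path_law T (initial_law P \<mu>) X)))
          in s * ((\<integral>\<omega>. time_average Y f T \<omega> \<partial>N) - (\<integral>\<omega>. time_average X f T \<omega> \<partial>initial_law P \<mu>))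
             \<le> sqrt (2 * v * \<eta>) + b * \<eta>
               + C / c * ((1 - exp (- T / \<alpha>)) / (T / \<alpha>)) * density_norm \<mu>s \<mu>
                 * sqrt (prob_space.variance \<mu>s f))) \<and>
     (\<forall>\<mu>ts \<eta>inf.
        (\<forall>T>0. relative_entropy (path_law T N Y) (path_law T (initial_law P \<mu>) X) < \<infinity>) \<longrightarrow>
        prob_space \<mu>ts \<longrightarrow> sets \<mu>ts = sets borel \<longrightarrow> ergodic_process N Y \<mu>ts \<longrightarrow>
        ((\<lambda>T. relative_entropy (path_law T N Y) (path_law T (initial_law P \<mu>s) X) / ereal T)
           \<longlongrightarrow> ereal \<eta>inf) at_top \<longrightarrow>
        (\<forall>s\<in>{1, -1}.
          let v = v_const \<mu>s ip \<alpha> (\<lambda>x. s * centered \<mu>s f x);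
              b = b_const \<mu>s ip \<alpha> (\<lambda>x. s * centered \<mu>s f x)
          in s * ((\<integral>x. f x \<partial>\<mu>ts) - (\<integral>x. f x \<partial>\<mu>s)) \<le> sqrt (2 * v * \<eta>inf) + b * \<eta>inf))"
proof -
  interpret C: cadlag_markov_family M X P by (rule markov)
  interpret \<mu>s: prob_space \<mu>s by (rule \<mu>s(1))
  interpret N: cadlag_process N Y by (rule alternative)
  interpret Y: cadlag_on_measurable_space N "{0..}" Y
    by standard (auto intro: N.measurable_Y N.cadlag_Y)
  interpret PM: poincare_markov M X P \<mu>s ip c C \<alpha>
    using markov \<mu>s invariant ip cC equivalent \<alpha> ip_one poincare
    by (intro poincare_markov.intro stationary_markov.intro markov_initial_law.intro
        markov_initial_law_axioms.intro stationary_markov_axioms.intro equivalent_inner_product.intro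
        equivalent_inner_product_axioms.intro poincare_markov_axioms.intro) auto
  define m where "m = (\<integral>x. f x \<partial>\<mu>s)"
  define h where "h s x = s * centered \<mu>s f x" for s x
  define v where "v s = v_const \<mu>s ip \<alpha> (h s)" for s
  define b where "b s = b_const \<mu>s ip \<alpha> (h s)" for s
  define R where "R T \<nu> = relative_entropy (path_law T N Y) (path_law T (initial_law P \<nu>) X)" for T \<nu>
  define \<eta> where "\<eta> T \<nu> = eta T c (density_norm \<mu>s \<nu>) (real_of_ereal (R T \<nu>))" for T \<nu>
  obtain B where B: "\<And>x. \<bar>f x\<bar> \<le> B" using f(2) by (auto simp: bounded_iff)
  have h_eq: "h s = (\<lambda>x. s * (f x - m))" for s by (auto simp: h_def centered_def m_def)
  have h_meas: "h s \<in> borel_measurable borel" for s unfolding h_eq using f(1) by measurable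
  have h_bound: "\<bar>h s x\<bar> \<le> B + \<bar>m\<bar>" if "s \<in> {1, -1}" for s x
    using that B[of x] by (auto simp: h_eq)
  have int_f: "integrable \<mu>s f" by (rule PM.bounded_integrable[OF f(1) B])
  have h_mean: "(\<integral>x. h s x \<partial>\<mu>s) = 0" for s
    unfolding h_eq using int_f \<mu>s.prob_space by (simp add: m_def)
  have average_Y: "(1 / T) * (\<integral>\<omega>. time_integral Y (h s) 0 T \<omega> \<partial>N) = s * ((\<integral>\<omega>. time_average Y f T \<omega> \<partial>N) - m)"
    if T: "0 < T" for s T
  proof -
    have "integrable N (time_integral Y f 0 T)"
    proof (rule N.integrable_const_bound[where B="B * T", OF AE_I2])
      show "norm (time_integral Y f 0 T \<omega>) \<le> B * T" if "\<omega> \<in> space N" for \<omega>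
        using Y.time_integral_bound[OF f(1) B _ _ that, of 0 T] T by auto
      show "time_integral Y f 0 T \<in> borel_measurable N" by (rule Y.time_integral_measurable[OF f(1)]) auto
    qed
    moreover have "(\<integral>\<omega>. time_integral Y (h s) 0 T \<omega> \<partial>N) = (\<integral>\<omega>. s * (time_integral Y f 0 T \<omega> - T * m) \<partial>N)"
    proof (rule Bochner_Integration.integral_cong[OF refl])
      show "time_integral Y (h s) 0 T \<omega> = s * (time_integral Y f 0 T \<omega> - T * m)" if "\<omega> \<in> space N" for \<omega>
        using Y.time_integral_affine[OF f(1) B _ _ that, of 0 T s m] T by (simp add: h_eq)
    qed
    ultimately show ?thesis
      using T N.prob_space by (simp add: time_average_eq field_simps)
  qed
  have deviation: "s * ((\<integral>\<omega>. time_average Y f T \<omega> \<partial>N) - m) \<le> sqrt (2 * v s * \<eta> T \<nu>) + b s * \<eta> T \<nu>"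
    if "prob_space \<nu>" "sets \<nu> = sets borel" "absolutely_continuous \<mu>s \<nu>"
      "(\<lambda>x. enn2real (RN_deriv \<mu>s \<nu> x)) \<in> L2_fun \<mu>s" "0 < T" "R T \<nu> < \<infinity>" "s \<in> {1, -1}" for s T \<nu>
    using PM.time_average_deviation[OF h_meas h_bound[OF that(7)] h_mean that(1-4) alternative that(5)] that(6)
    unfolding average_Y[OF that(5)] v_def b_def \<eta>_def R_def by blast
  have relax: "s * (m - (\<integral>\<omega>. time_average X f T \<omega> \<partial>initial_law P \<mu>))
    \<le> C / c * ((1 - exp (- T / \<alpha>)) / (T / \<alpha>)) * density_norm \<mu>s \<mu> * sqrt (\<mu>s.variance f)"
    if T: "0 < T" and s: "s \<in> {1, -1}" for s T
  proof -
    interpret V: markov_initial_law M X P \<mu>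
      by (intro markov_initial_law.intro markov_initial_law_axioms.intro markov \<mu>)
    let ?J = "\<integral>\<omega>. time_integral X (h 1) 0 T \<omega> \<partial>initial_law P \<mu>"
    have "?J = (\<integral>\<omega>. time_integral X f 0 T \<omega> - T * m \<partial>initial_law P \<mu>)"
    proof (rule Bochner_Integration.integral_cong[OF refl])
      show "time_integral X (h 1) 0 T \<omega> = time_integral X f 0 T \<omega> - T * m" if "\<omega> \<in> space (initial_law P \<mu>)" for \<omega>
        using C.X.time_integral_affine[OF f(1) B, of 0 T \<omega> 1 m] T that by (simp add: h_eq)
    qed
    also have "\<dots> = (\<integral>\<omega>. time_integral X f 0 T \<omega> \<partial>initial_law P \<mu>) - T * m"
    proof -
      have "integrable (initial_law P \<mu>) (time_integral X f 0 T)"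
      proof (rule V.integrable_Q[where B="B * T"])
        show "\<bar>time_integral X f 0 T \<omega>\<bar> \<le> B * T" if "\<omega> \<in> space M" for \<omega>
          using C.X.time_integral_bound[OF f(1) B _ _ that, of 0 T] T by auto
        show "time_integral X f 0 T \<in> borel_measurable M" by (rule C.X.time_integral_measurable[OF f(1)]) auto
      qed
      then show ?thesis by simp
    qed
    finally have EJ: "?J = (\<integral>\<omega>. time_integral X f 0 T \<omega> \<partial>initial_law P \<mu>) - T * m" .
    have J: "m - (\<integral>\<omega>. time_average X f T \<omega> \<partial>initial_law P \<mu>) = - (?J / T)"
      unfolding EJ using T by (simp add: time_average_eq diff_divide_distrib)
    have norm_h: "L2_norm \<mu>s (h 1) = sqrt (\<mu>s.variance f)"
      by (simp add: inner_norm_def L2_inner_def h_eq m_def power2_eq_square)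
    have "s * (m - (\<integral>\<omega>. time_average X f T \<omega> \<partial>initial_law P \<mu>)) \<le> \<bar>?J\<bar> / T"
      unfolding J using s T by (auto simp: abs_if divide_right_mono field_simps)
    also have "\<dots> \<le> C / c * (\<alpha> * (1 - exp (- T / \<alpha>))) * density_norm \<mu>s \<mu> * L2_norm \<mu>s (h 1) / T"
      using T by (intro divide_right_mono PM.relaxation_bound[OF h_meas h_bound h_mean \<mu> ac sq]) auto
    also have "\<dots> = C / c * ((1 - exp (- T / \<alpha>)) / (T / \<alpha>)) * density_norm \<mu>s \<mu> * sqrt (\<mu>s.variance f)"
      unfolding norm_h by simp
    finally show ?thesis .
  qed
  have finite_time: "s * ((\<integral>\<omega>. time_average Y f T \<omega> \<partial>N) - (\<integral>\<omega>. time_average X f T \<omega> \<partial>initial_law P \<mu>))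
      \<le> sqrt (2 * v s * \<eta> T \<mu>) + b s * \<eta> T \<mu>
        + C / c * ((1 - exp (- T / \<alpha>)) / (T / \<alpha>)) * density_norm \<mu>s \<mu> * sqrt (\<mu>s.variance f)"
    if "0 < T" "R T \<mu> < \<infinity>" "s \<in> {1, -1}" for s T
    using add_mono[OF deviation[OF \<mu> ac sq that] relax[OF that(1,3)]]
    by (simp add: algebra_simps)
  (* The deviation bound is used with the invariant measure itself as initial distribution, whose
     density norm is 1; integer times suffice to identify the limit. *)
  have long_time: "s * ((\<integral>x. f x \<partial>\<mu>ts) - m) \<le> sqrt (2 * v s * \<eta>inf) + b s * \<eta>inf"
    if erg: "ergodic_process N Y \<mu>ts"
      and lim: "((\<lambda>T. R T \<mu>s / ereal T) \<longlongrightarrow> ereal \<eta>inf) at_top" and s: "s \<in> {1, -1}"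
    for \<mu>ts \<eta>inf s
  proof -
    have seq: "(\<lambda>n. R (real n) \<mu>s / ereal (real n)) \<longlonglongrightarrow> ereal \<eta>inf"
      by (rule filterlim_compose[OF lim filterlim_real_sequentially])
    have "\<forall>\<^sub>F n in sequentially. R (real n) \<mu>s / ereal (real n) < \<infinity>"
      by (rule order_tendstoD(2)[OF seq]) simp
    then have fin: "\<forall>\<^sub>F n in sequentially. 0 < n \<and> R (real n) \<mu>s < \<infinity>"
      using eventually_gt_at_top[of 0]
    proof eventually_elim
      case (elim n)
      then show ?case by (cases "R (real n) \<mu>s") auto
    qed
    (* For n = 0 both sides vanish by the conventions for division by zero and for the real part
       of infinity. *)
    have eta_n: "\<eta> (real n) \<mu>s = ln (inverse c) / real n + real_of_ereal (R (real n) \<mu>s / ereal (real n))" for n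
      by (cases "R (real n) \<mu>s"; cases "n = 0")
        (auto simp: \<eta>_def eta_def \<mu>s.density_norm_self add_divide_distrib)
    have "(\<lambda>n. ln (inverse c) / real n + real_of_ereal (R (real n) \<mu>s / ereal (real n))) \<longlonglongrightarrow> 0 + \<eta>inf"
      by (intro tendsto_add lim_const_over_n lim_real_of_ereal seq)
    then have eta_lim: "(\<lambda>n. \<eta> (real n) \<mu>s) \<longlonglongrightarrow> \<eta>inf" by (simp add: eta_n)
    have "(\<lambda>n. \<integral>\<omega>. time_average Y f (real n) \<omega> \<partial>N) \<longlonglongrightarrow> (\<integral>\<omega>. (\<integral>x. f x \<partial>\<mu>ts) \<partial>N)"
    proof (rule integral_dominated_convergence[where w="\<lambda>_. B"])
      show "AE \<omega> in N. (\<lambda>n. time_average Y f (real n) \<omega>) \<longlonglongrightarrow> (\<integral>x. f x \<partial>\<mu>ts)"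
        using erg f unfolding ergodic_process_def
        by (auto elim!: eventually_mono intro: filterlim_compose[OF _ filterlim_real_sequentially])
      show "(\<lambda>\<omega>. time_average Y f (real n) \<omega>) \<in> borel_measurable N" for n
      proof -
        have [measurable]: "time_integral Y f 0 (real n) \<in> borel_measurable N"
          by (rule Y.time_integral_measurable[OF f(1)]) auto
        show ?thesis unfolding time_average_eq by measurable
      qed
      show "AE \<omega> in N. norm (time_average Y f (real n) \<omega>) \<le> B" for n
      proof (rule AE_I2)
        fix \<omega> assume \<omega>: "\<omega> \<in> space N"
        have "0 \<le> B" using B[of undefined] by linarith
        then show "norm (time_average Y f (real n) \<omega>) \<le> B"
          using Y.time_integral_bound[OF f(1) B _ _ \<omega>, of 0 "real n"]
          by (cases "n = 0") (auto simp: time_average_eq abs_mult field_simps)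
      qed
    qed simp_all
    then have left: "(\<lambda>n. s * ((\<integral>\<omega>. time_average Y f (real n) \<omega> \<partial>N) - m)) \<longlonglongrightarrow> s * ((\<integral>x. f x \<partial>\<mu>ts) - m)"
      using N.prob_space by (intro tendsto_intros) simp
    have right: "(\<lambda>n. sqrt (2 * v s * \<eta> (real n) \<mu>s) + b s * \<eta> (real n) \<mu>s) \<longlonglongrightarrow> sqrt (2 * v s * \<eta>inf) + b s * \<eta>inf"
      by (intro tendsto_intros eta_lim)
    show ?thesis
    proof (rule tendsto_le[OF _ right left])
      show "\<forall>\<^sub>F n in sequentially. s * ((\<integral>\<omega>. time_average Y f (real n) \<omega> \<partial>N) - m)
          \<le> sqrt (2 * v s * \<eta> (real n) \<mu>s) + b s * \<eta> (real n) \<mu>s"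
        using fin
      proof eventually_elim
        case (elim n)
        then show ?case
          by (intro deviation \<mu>s \<mu>s.density_norm_self s) (auto simp: absolutely_continuous_def)
      qed
    qed simp
  qed
  have h_abs: "h s = (\<lambda>x. s * centered \<mu>s f x)" for s by (simp add: h_def[abs_def])
  note defs = v_def b_def R_def \<eta>_def m_def h_abs
  show ?thesis
    unfolding Let_def
  proof (intro conjI allI impI ballI, goal_cases)
    case (1 T s)
    then show ?case using finite_time[of T s] unfolding defs by simp
  next
    case (2 \<mu>ts \<eta>inf s)
    show ?case using long_time[OF 2(4), of \<eta>inf s] 2(5,6) unfolding defs by simp
  qed
qed

end
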